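(* Let $1\le j<k$ be integers with $k\ge2j$. For every $\lambda\in\mathbb{R}\setminus\{0\}$, consider on $\mathbb{R}^{k+2}$ the nilpotent system $$\dot x_1=u,\quad \dot x_i=x_{i-1}\ (2\le i\le k-1),\quad \dot x_k=x_{k-1}+\lambda x_j^2,\quad \dot x_{k+1}=2x_j^2x_k,\quad \dot x_{k+2}=x_j^2x_k^2+\lambda x_j^2x_{k+1},$$ that is $\dot x=f_0(x)+uf_1(x)$ with $f_1=e_1$ and $f_0$ the remaining right-hand side. This system is $W^{k-2j-1,\infty}_0$-STLC, despite satisfying $f_{Q_{j,k,k}}(0)\notin\mathcal{N}^\infty_{j,k}(f)(0)$. Moreover, in $\mathcal{B}^\star$, the only non-vanishing Lie brackets at $0$ are: $f_{M_{i-1}}(0)=e_i$ for $1\le i\le k$, $f_{W_j}(0)=2\lambda e_k$, $f_{P_{j,k}}(0)=4e_{k+1}$ and $f_{Q_{j,k,k}}(0)=4e_{k+2}$.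
   Context: Brackets. $X=\{X_0,X_1\}$ are non-commutative indeterminates, $\mathrm{Br}(X)$ is the free magma over $X$ (formal iterated brackets $(a,b)$); for $b=(b_1,b_2)$, $\lambda(b):=b_1$, $\mu(b):=b_2$; $n_1(b)$ is the number of occurrences of $X_1$ in $b$. $[f,g]:=(Dg)f-(Df)g$; $f_b$ is obtained from $b$ by replacing $X_0,X_1$ by $f_0,f_1$ and evaluating Lie brackets. $b0^\nu:=((\cdots(b,X_0),\ldots),X_0)$ with $\nu$ copies of $X_0$ added. The set $\mathcal{B}^\star$. Let $G\subset\mathrm{Br}(X)$ be the smallest subset with $X_0,X_1\in G$ and $(a,b)\in G$ whenever $a,b\in G$, $a\ne X_0$. Each $b\in G\setminus\{X_0\}$ is uniquely $b=b^*0^{\nu_b}$ with $\nu_b\in\mathbb{N}$ and $b^*$ (the germ) equal to $X_1$ or of the form $(b_1,b_2)$ with $b_1,b_2\neq X_0$. Order $G$ totally by: $X_0$ is maximal; for $a,b\in G\setminus\{X_0\}$, $a<b$ iff $a^*<b^*$ or ($a^*=b^*$ and $\nu_a<\nu_b$); for germs, $a^*<b^*$ iff $n_1(a^* )<n_1(b^* )$, or these are equal and $\lambda(a^* )<\lambda(b^* )$, or both are equal and $\mu(a^* )<\mu(b^* )$. $\mathcal{B}^\star\subset G$ is the unique Hall set for this order: $X\subset\mathcal{B}^\star$ and $(b_1,b_2)\in\mathcal{B}^\star$ iff $b_1,b_2\in\mathcal{B}^\star$, $b_1<b_2$, and ($b_2\in X$ or $\lambda(b_2)\le b_1$). Named elements: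 $M_\nu:=X_10^\nu$, $W_j:=(M_{j-1},M_j)$, $P_{j,k}:=(M_{k-1},W_j)$, $Q_{j,k,l}:=(M_{l-1},P_{j,k})$. $\mathcal{N}^\infty_{j,k}:=\{b\in\mathcal{B}^\star: n_1(b)\ge1\}\setminus\{Q_{j,k,k}\}$ and $\mathcal{N}^\infty_{j,k}(f)(0):=\mathrm{span}\{f_b(0):b\in\mathcal{N}^\infty_{j,k}\}$. Controllability. For $u\in L^1(0,T)$, $x(\cdot;u)$ is the solution with $x(0)=0$, and $u_1(t)=\int_0^tu$. For $m\in\mathbb{N}$, $W^{m,\infty}_0(0,T)$ is the space of $u\in W^{m,\infty}(0,T)$ vanishing at $0$ and $T$ with their derivatives up to order $m-1$, with norm $\|u\|_{W^{m,\infty}}=\|u\|_{L^\infty}+\dots+\|u^{(m)}\|_{L^\infty}$; $W^{-1,\infty}_0(0,T):=L^1(0,T)$ with norm $\|u\|_{W^{-1,\infty}}:=\|u_1\|_{L^\infty}$. The system is $W^{m,\infty}_0$-STLC when for all $T,\rho>0$ there is $\delta>0$ such that for all $x^\star\in B(0,\delta)$ there is $u\in W^{m,\infty}_0(0,T)$ with $x(T;u)=x^\star$ and $\|u\|_{W^{m,\infty}}\le\rho$. *)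

theory Defs
  imports "HOL-Analysis.Analysis" "HOL-Probability.Essential_Supremum"
begin

section \<open>Formal brackets\<close>

datatype br = X0 | X1 | Br br br

fun n1 :: "br \<Rightarrow> nat" where
  "n1 X0 = 0"
| "n1 X1 = 1"
| "n1 (Br a b) = n1 a + n1 b"

definition app0 :: "br \<Rightarrow> nat \<Rightarrow> br" where
  "app0 b \<nu> = ((\<lambda>c. Br c X0) ^^ \<nu>) b"

inductive_set G :: "br set" where
  G_X0: "X0 \<in> G"
| G_X1: "X1 \<in> G"
| G_Br: "a \<in> G \<Longrightarrow> b \<in> G \<Longrightarrow> a \<noteq> X0 \<Longrightarrow> Br a b \<in> G"

fun germ :: "br \<Rightarrow> br" where
  "germ X0 = X0"
| "germ X1 = X1"
| "germ (Br a b) = (if b = X0 then germ a else Br a b)"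

fun nu :: "br \<Rightarrow> nat" where
  "nu X0 = 0"
| "nu X1 = 0"
| "nu (Br a b) = (if b = X0 then Suc (nu a) else 0)"

lemma germ_nu_decomposition: "b = app0 (germ b) (nu b)"
  by (induction b) (auto simp: app0_def)

lemma germ_cases:
  assumes "b \<in> G" "b \<noteq> X0"
  shows "germ b = X1 \<or> (\<exists>b1 b2. germ b = Br b1 b2 \<and> b1 \<noteq> X0 \<and> b2 \<noteq> X0)"
  using assms by induction auto

lemma germ_nu_unique:
  assumes "c = X1 \<or> (\<exists>b1 b2. c = Br b1 b2 \<and> b1 \<noteq> X0 \<and> b2 \<noteq> X0)" "b = app0 c \<nu>"
  shows "c = germ b \<and> \<nu> = nu b"
  unfolding assms(2) using assms(1) by (induction \<nu>) (auto simp: app0_def)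

text \<open>
  The strict order on \<open>G\<close> and the order on germs, mutually. The recursion goes to strictly
  smaller brackets, so the least relation satisfying the rules is the only one; see
  \<open>br_less_iff\<close> and \<open>germ_less_iff\<close> below. The only germ in \<open>G\<close> that is not a bracket is \<open>X1\<close>,
  and it is the only one with \<open>n1 = 1\<close>, so the components are only compared on brackets.
\<close>

inductive br_less :: "br \<Rightarrow> br \<Rightarrow> bool" and germ_less :: "br \<Rightarrow> br \<Rightarrow> bool" where
  less_X0: "a \<noteq> X0 \<Longrightarrow> br_less a X0"
| less_germ: "a \<noteq> X0 \<Longrightarrow> b \<noteq> X0 \<Longrightarrow> germ_less (germ a) (germ b) \<Longrightarrow> br_less a b"
| less_nu: "a \<noteq> X0 \<Longrightarrow> b \<noteq> X0 \<Longrightarrow> germ a = germ b \<Longrightarrow> nu a < nu b \<Longrightarrow> br_less a b"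
| germ_less_n1: "n1 a < n1 b \<Longrightarrow> germ_less a b"
| germ_less_left: "n1 (Br a1 a2) = n1 (Br b1 b2) \<Longrightarrow> br_less a1 b1
    \<Longrightarrow> germ_less (Br a1 a2) (Br b1 b2)"
| germ_less_right: "n1 (Br a1 a2) = n1 (Br b1 b2) \<Longrightarrow> a1 = b1 \<Longrightarrow> br_less a2 b2
    \<Longrightarrow> germ_less (Br a1 a2) (Br b1 b2)"

lemma br_less_X0_right_iff: "br_less a X0 \<longleftrightarrow> a \<noteq> X0"
  by (auto elim: br_less.cases intro: less_X0)

lemma not_br_less_X0_left: "\<not> br_less X0 b"
  by (auto elim: br_less.cases)

lemma br_less_iff:
  "a \<noteq> X0 \<Longrightarrow> b \<noteq> X0 \<Longrightarrow>
    br_less a b \<longleftrightarrow> germ_less (germ a) (germ b) \<or> (germ a = germ b \<and> nu a < nu b)"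
  by (auto elim: br_less.cases intro: less_germ less_nu)

lemma germ_less_iff:
  "germ_less (Br a1 a2) (Br b1 b2) \<longleftrightarrow>
    n1 (Br a1 a2) < n1 (Br b1 b2) \<or>
    n1 (Br a1 a2) = n1 (Br b1 b2) \<and> (br_less a1 b1 \<or> a1 = b1 \<and> br_less a2 b2)"
  by (subst germ_less.simps) auto

inductive_set Bstar :: "br set" where
  Bstar_X0: "X0 \<in> Bstar"
| Bstar_X1: "X1 \<in> Bstar"
| Bstar_Br: "b1 \<in> Bstar \<Longrightarrow> b2 \<in> Bstar \<Longrightarrow> br_less b1 b2 \<Longrightarrow>
    b2 \<in> {X0, X1} \<or> (\<exists>c d. b2 = Br c d \<and> (br_less c b1 \<or> c = b1)) \<Longrightarrow> Br b1 b2 \<in> Bstar"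

lemma Bstar_unique_Hall_set:
  "{X0, X1} \<subseteq> B \<and>
   (\<forall>b1 b2. Br b1 b2 \<in> B \<longleftrightarrow> b1 \<in> B \<and> b2 \<in> B \<and> br_less b1 b2 \<and>
      (b2 \<in> {X0, X1} \<or> (\<exists>c d. b2 = Br c d \<and> (br_less c b1 \<or> c = b1))))
   \<longleftrightarrow> B = Bstar" (is "?H B \<longleftrightarrow> _")
proof
  have Bstar_Br_iff: "Br b1 b2 \<in> Bstar \<longleftrightarrow> b1 \<in> Bstar \<and> b2 \<in> Bstar \<and> br_less b1 b2 \<and>
      (b2 \<in> {X0, X1} \<or> (\<exists>c d. b2 = Br c d \<and> (br_less c b1 \<or> c = b1)))" for b1 b2
    by (subst Bstar.simps) auto
  {
    assume "B = Bstar"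
    then show "?H B"
      using Bstar_Br_iff Bstar_X0 Bstar_X1 by blast
  next
    assume H: "?H B"
    have "b \<in> B \<longleftrightarrow> b \<in> Bstar" for b
    proof (induction b)
      case (Br b1 b2)
      have "Br b1 b2 \<in> B \<longleftrightarrow> b1 \<in> B \<and> b2 \<in> B \<and> br_less b1 b2 \<and>
          (b2 \<in> {X0, X1} \<or> (\<exists>c d. b2 = Br c d \<and> (br_less c b1 \<or> c = b1)))"
        using H by blast
      then show ?case
        unfolding Bstar_Br_iff Br.IH .
    qed (use H Bstar_X0 Bstar_X1 in auto)
    then show "B = Bstar"
      by blast
  }
qed

lemma Bstar_subset_G: "Bstar \<subseteq> G"
proof
  fix b assume "b \<in> Bstar"
  then show "b \<in> G"
  proof induction
    case (Bstar_Br b1 b2)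
    then have "b1 \<noteq> X0"
      using not_br_less_X0_left by blast
    with Bstar_Br show ?case
      by (intro G_Br)
  qed (auto intro: G_X0 G_X1)
qed

definition M :: "nat \<Rightarrow> br" where
  "M \<nu> = app0 X1 \<nu>"

definition W :: "nat \<Rightarrow> br" where
  "W j = Br (M (j - 1)) (M j)"

definition P :: "nat \<Rightarrow> nat \<Rightarrow> br" where
  "P j k = Br (M (k - 1)) (W j)"

definition Q :: "nat \<Rightarrow> nat \<Rightarrow> nat \<Rightarrow> br" where
  "Q j k l = Br (M (l - 1)) (P j k)"

definition N_inf :: "nat \<Rightarrow> nat \<Rightarrow> br set" where
  "N_inf j k = {b \<in> Bstar. n1 b \<ge> 1} - {Q j k k}"

section \<open>Evaluated brackets\<close>

definition lie_bracket ::
  "('a::real_normed_vector \<Rightarrow> 'a) \<Rightarrow> ('a \<Rightarrow> 'a) \<Rightarrow> 'a \<Rightarrow> 'a" where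
  "lie_bracket f g x = frechet_derivative g (at x) (f x) - frechet_derivative f (at x) (g x)"

fun br_eval :: "('a::real_normed_vector \<Rightarrow> 'a) \<Rightarrow> ('a \<Rightarrow> 'a) \<Rightarrow> br \<Rightarrow> 'a \<Rightarrow> 'a" where
  "br_eval f0 f1 X0 = f0"
| "br_eval f0 f1 X1 = f1"
| "br_eval f0 f1 (Br a b) = lie_bracket (br_eval f0 f1 a) (br_eval f0 f1 b)"

definition N_inf_at_0 ::
  "('a::real_normed_vector \<Rightarrow> 'a) \<Rightarrow> ('a \<Rightarrow> 'a) \<Rightarrow> nat \<Rightarrow> nat \<Rightarrow> 'a set" where
  "N_inf_at_0 f0 f1 j k = span ((\<lambda>b. br_eval f0 f1 b 0) ` N_inf j k)"

section \<open>Sobolev spaces on \<open>(0,T)\<close>\<close>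

text \<open>Smooth functions with compact support in \<open>(0,T)\<close>.\<close>

definition test_function :: "real \<Rightarrow> (real \<Rightarrow> real) \<Rightarrow> bool" where
  "test_function T \<phi> \<longleftrightarrow>
    (\<forall>n. (deriv ^^ n) \<phi> differentiable_on UNIV) \<and>
    (\<exists>a b. 0 < a \<and> b < T \<and> (\<forall>t. t \<notin> {a..b} \<longrightarrow> \<phi> t = 0))"

text \<open>For \<open>i = 0\<close> the following says that \<open>u\<close> and \<open>v\<close> agree almost everywhere on \<open>(0,T)\<close>.\<close>

definition weak_deriv :: "real \<Rightarrow> nat \<Rightarrow> (real \<Rightarrow> real) \<Rightarrow> (real \<Rightarrow> real) \<Rightarrow> bool" where
  "weak_deriv T i u v \<longleftrightarrow>
    u absolutely_integrable_on {0<..<T} \<and> v absolutely_integrable_on {0<..<T} \<and>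
    (\<forall>\<phi>. test_function T \<phi> \<longrightarrow>
      integral {0<..<T} (\<lambda>t. u t * (deriv ^^ i) \<phi> t) =
        (-1) ^ i * integral {0<..<T} (\<lambda>t. v t * \<phi> t))"

text \<open>The \<open>L\<^sup>\<infinity>\<close> norm on \<open>(0,T)\<close>; it is infinite for functions that are not measurable.\<close>

definition Linf_norm :: "real \<Rightarrow> (real \<Rightarrow> real) \<Rightarrow> ereal" where
  "Linf_norm T v = esssup (lebesgue_on {0<..<T}) (\<lambda>t. ereal \<bar>v t\<bar>)"

text \<open>
  The order \<open>m \<ge> -1\<close> is an integer. For \<open>m \<ge> 0\<close> the weak derivatives \<open>D i\<close> of \<open>u\<close> are
  unique up to null sets, so the sum under the infimum does not depend on \<open>D\<close>.
\<close>

definition W_norm :: "real \<Rightarrow> int \<Rightarrow> (real \<Rightarrow> real) \<Rightarrow> ereal" where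
  "W_norm T m u =
    (if m = -1 then Linf_norm T (\<lambda>t. integral {0..t} u)
     else (INF D \<in> {D. \<forall>i\<le>nat m. weak_deriv T i u (D i)}. \<Sum>i\<le>nat m. Linf_norm T (D i)))"

text \<open>
  The boundary values of the derivatives of order less than \<open>m\<close> are those of their
  continuous representatives.
\<close>

definition W0_space :: "real \<Rightarrow> int \<Rightarrow> (real \<Rightarrow> real) set" where
  "W0_space T m =
    (if m = -1 then {u. u absolutely_integrable_on {0<..<T}}
     else {u. (\<exists>D. \<forall>i\<le>nat m. weak_deriv T i u (D i) \<and> Linf_norm T (D i) < \<infinity>) \<and>
              (\<exists>D. \<forall>i<nat m. weak_deriv T i u (D i) \<and> continuous_on {0..T} (D i) \<and>
                 D i 0 = 0 \<and> D i T = 0)})"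

section \<open>Small-time local controllability\<close>

text \<open>
  Solutions on \<open>[0,T]\<close> with \<open>x(0) = 0\<close> for integrable controls, in integrated form.
\<close>

definition solution ::
  "('a::euclidean_space \<Rightarrow> 'a) \<Rightarrow> ('a \<Rightarrow> 'a) \<Rightarrow> real \<Rightarrow> (real \<Rightarrow> real) \<Rightarrow> (real \<Rightarrow> 'a) \<Rightarrow> bool" where
  "solution f0 f1 T u x \<longleftrightarrow>
    continuous_on {0..T} x \<and>
    (\<forall>t\<in>{0..T}. ((\<lambda>s. f0 (x s) + u s *\<^sub>R f1 (x s)) has_integral x t) {0..t})"

definition W0_STLC :: "int \<Rightarrow> ('a::euclidean_space \<Rightarrow> 'a) \<Rightarrow> ('a \<Rightarrow> 'a) \<Rightarrow> bool" where
  "W0_STLC m f0 f1 \<longleftrightarrow>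
    (\<forall>T>0. \<forall>\<rho>>0. \<exists>\<delta>>0. \<forall>xs\<in>ball 0 \<delta>. \<exists>u\<in>W0_space T m.
      (\<exists>x. solution f0 f1 T u x \<and> x T = xs) \<and> W_norm T m u \<le> ereal \<rho>)"

section \<open>The system\<close>

text \<open>
  The enumeration \<open>ix\<close> of the index type makes the coordinates of \<open>real ^ 'n\<close> the
  \<open>x_1, ..., x_{k+2}\<close> of the text: \<open>x_i\<close> is \<open>x $ ix i\<close>.
\<close>

definition basis_vec :: "(nat \<Rightarrow> 'n::finite) \<Rightarrow> nat \<Rightarrow> real ^ 'n" where
  "basis_vec ix i = axis (ix i) 1"

definition sys_f0 ::
  "(nat \<Rightarrow> 'n::finite) \<Rightarrow> nat \<Rightarrow> nat \<Rightarrow> real \<Rightarrow> real ^ 'n \<Rightarrow> real ^ 'n" where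
  "sys_f0 ix j k lam x =
    (\<Sum>i\<in>{2..k - 1}. x $ ix (i - 1) *\<^sub>R basis_vec ix i) +
    (x $ ix (k - 1) + lam * (x $ ix j)\<^sup>2) *\<^sub>R basis_vec ix k +
    (2 * (x $ ix j)\<^sup>2 * x $ ix k) *\<^sub>R basis_vec ix (k + 1) +
    ((x $ ix j)\<^sup>2 * (x $ ix k)\<^sup>2 + lam * (x $ ix j)\<^sup>2 * x $ ix (k + 1)) *\<^sub>R basis_vec ix (k + 2)"

definition sys_f1 :: "(nat \<Rightarrow> 'n::finite) \<Rightarrow> real ^ 'n \<Rightarrow> real ^ 'n" where
  "sys_f1 ix x = basis_vec ix 1"

end

theory Submission
  imports Defs
begin

text \<open>
  Write \<open>\<xi>\<close> for the solution of \<open>\<xi>' = x_{k-1}\<close>, so that the control is the \<open>k\<close>-th derivative of \<open>\<xi>\<close> and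
  \<open>x_j\<close> its \<open>(k - j)\<close>-th. With the moments \<open>A\<close>, \<open>B\<close>, \<open>C\<close> of orders \<open>0, 1, 2\<close> of \<open>\<xi>\<close> under the measure
  \<open>x_j\<^sup>2 dt\<close>, integration gives \<open>x_k = \<xi> + \<lambda> A\<close>, \<open>x_{k+1} = 2 B + \<lambda> A\<^sup>2\<close> and
  \<open>x_{k+2} = C + 2 \<lambda> A B + (2/3) \<lambda>\<^sup>2 A\<^sup>3\<close>. Reaching the origin with \<open>A > 0\<close> means that \<open>\<xi>\<close> ends at
  \<open>-\<lambda> A\<close> with \<open>B = -\<lambda> A\<^sup>2 / 2\<close> and \<open>C = \<lambda>\<^sup>2 A\<^sup>3 / 3\<close>, the moments of the uniform measure on the
  segment from \<open>0\<close> to \<open>-\<lambda> A\<close>. They are realised as in Simpson's rule, by many small oscillations of \<open>\<xi>\<close>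
  around the values \<open>0\<close>, \<open>-\<lambda> A / 2\<close>, \<open>-\<lambda> A\<close>; the intermediate value theorem absorbs the errors and
  hits all nearby targets. A dilation that preserves the system and the sup norm of the \<open>(2 (k - j) - 1)\<close>-th
  derivative of \<open>\<xi>\<close> transports this to arbitrarily short times.

  For the brackets, \<open>f_0 = N + x_j\<^sup>2 E\<close> with \<open>N\<close> the integrator chain. The fields \<open>E\<close>, \<open>F = [e_k, E]\<close> and
  \<open>G = [e_k, F]\<close> commute and span an abelian Lie algebra over the polynomials in \<open>x_1, ..., x_{k-1}\<close>. Up to a
  constant field, all brackets containing \<open>X_1\<close> lie in it, and all but the listed ones of \<open>Bstar\<close> vanish, end
  with \<open>X_0\<close>, or have their coefficients in the ideal generated by \<open>x_1, ..., x_j\<close>.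
\<close>

section \<open>Iterated derivatives\<close>

text \<open>Put \<open>q = k - j\<close> and \<open>d = 2 * q - 1\<close>. For
  \<open>m = k - 2 * j - 1\<close> one has \<open>k + m = d\<close>, so a bound on the
  \<open>d\<close>-th derivative of \<xi> bounds the whole norm of the control; for
  \<open>k = 2 * j\<close> that derivative is the primitive of the control. The order
  \<open>d\<close> is critical: when \<xi>(t) becomes \<tau>^d \<xi>(t / \<tau>), the mass
  \<open>A\<close> scales by \<tau>^(2 d - 2 q + 1) = \<tau>^d, just like \<xi>, as the end
  condition \<xi> = -lam A demands. For lam = 0 the coordinate x_{k+2} could never decrease. For lam
  \<noteq> 0 the required moments satisfy B^2 < A C strictly (lam^2 A^4 / 4 against lam^2 A^4 / 3),
  and this slack absorbs errors. The mass \<open>A\<close> does not shrink with the target. It is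
  fixed first, so small that moving between plateaus costs O(A^2), negligible against A; then the
  number of oscillations, so large that their spread is negligible; last the radius of the targets.
  Many oscillations take a long time, hence the dilation. The coordinates x_1, ..., x_{k-1} and the
  value of \<xi> are set exactly by an added polynomial, so a scalar intermediate value argument
  suffices and no topological fixed point theorem is needed.\<close>

definition diff_upto :: "nat \<Rightarrow> (real \<Rightarrow> real) \<Rightarrow> bool" where
  "diff_upto n f \<longleftrightarrow>
    (\<forall>i<n. \<forall>t. ((deriv ^^ i) f has_real_derivative (deriv ^^ Suc i) f t) (at t))"

lemma diff_upto_0 [simp]: "diff_upto 0 f"
  by (simp add: diff_upto_def)

lemma diff_uptoD:
  "diff_upto n f \<Longrightarrow> i < n \<Longrightarrow>
    ((deriv ^^ i) f has_real_derivative (deriv ^^ Suc i) f t) (at t)"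
  by (simp add: diff_upto_def)

lemma diff_upto_Suc_iff:
  "diff_upto (Suc n) f \<longleftrightarrow>
    (\<forall>t. (f has_real_derivative deriv f t) (at t)) \<and> diff_upto n (deriv f)"
  unfolding diff_upto_def All_less_Suc2 by (simp add: funpow_swap1)

lemma diff_upto_SucI:
  assumes "\<And>t. (f has_real_derivative f' t) (at t)" and "diff_upto n f'"
  shows "diff_upto (Suc n) f"
proof -
  have "deriv f = f'"
    using assms(1) by (intro ext DERIV_imp_deriv)
  then show ?thesis
    using assms by (simp add: diff_upto_Suc_iff)
qed

lemma diff_upto_mono: "diff_upto n f \<Longrightarrow> m \<le> n \<Longrightarrow> diff_upto m f"
  by (simp add: diff_upto_def)

lemma diff_upto_SucD: "diff_upto (Suc n) f \<Longrightarrow> diff_upto n f"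
  by (erule diff_upto_mono) simp

lemma diff_upto_continuous:
  assumes "diff_upto n f" and "i < n"
  shows "continuous_on S ((deriv ^^ i) f)"
  using diff_uptoD[OF assms] DERIV_isCont continuous_at_imp_continuous_on by blast

lemma diff_upto_const: "diff_upto n (\<lambda>t. c)"
proof (induction n arbitrary: c)
  case (Suc n)
  show ?case
    by (rule diff_upto_SucI[where f' = "\<lambda>t. 0"]) (auto intro: Suc.IH)
qed simp

lemma diff_upto_id: "diff_upto n (\<lambda>t. t)"
proof (cases n)
  case (Suc m)
  show ?thesis
    unfolding Suc by (rule diff_upto_SucI[where f' = "\<lambda>t. 1"]) (auto intro: diff_upto_const)
qed simp

lemma diff_upto_add:
  "diff_upto n f \<Longrightarrow> diff_upto n g \<Longrightarrow> diff_upto n (\<lambda>t. f t + g t)"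
proof (induction n arbitrary: f g)
  case (Suc n)
  show ?case
    by (rule diff_upto_SucI[where f' = "\<lambda>t. deriv f t + deriv g t"])
      (use Suc in \<open>auto simp: diff_upto_Suc_iff intro!: DERIV_add\<close>)
qed simp

lemma diff_upto_mult:
  "diff_upto n f \<Longrightarrow> diff_upto n g \<Longrightarrow> diff_upto n (\<lambda>t. f t * g t)"
proof (induction n arbitrary: f g)
  case (Suc n)
  show ?case
  proof (rule diff_upto_SucI)
    show "((\<lambda>t. f t * g t) has_real_derivative (deriv f t * g t + deriv g t * f t)) (at t)" for t
      using Suc.prems by (auto simp: diff_upto_Suc_iff intro!: DERIV_mult)
    show "diff_upto n (\<lambda>t. deriv f t * g t + deriv g t * f t)"
      using Suc.prems diff_upto_SucD[OF Suc.prems(1)] diff_upto_SucD[OF Suc.prems(2)]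
      by (intro diff_upto_add Suc.IH) (auto simp: diff_upto_Suc_iff)
  qed
qed simp

lemma diff_upto_cmult: "diff_upto n f \<Longrightarrow> diff_upto n (\<lambda>t. c * f t)"
  by (intro diff_upto_mult diff_upto_const)

lemma diff_upto_sum:
  "(\<And>i. i \<in> I \<Longrightarrow> diff_upto n (f i)) \<Longrightarrow> diff_upto n (\<lambda>t. \<Sum>i\<in>I. f i t)"
  by (induction I rule: infinite_finite_induct) (auto intro: diff_upto_const diff_upto_add)

lemma diff_upto_power: "diff_upto n f \<Longrightarrow> diff_upto n (\<lambda>t. f t ^ e)"
  by (induction e) (auto intro: diff_upto_const diff_upto_mult)

lemma diff_upto_affine: "diff_upto n f \<Longrightarrow> diff_upto n (\<lambda>t. f (a * t + b))"
proof (induction n arbitrary: f)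
  case (Suc n)
  show ?case
  proof (rule diff_upto_SucI)
    show "((\<lambda>t. f (a * t + b)) has_real_derivative (a * deriv f (a * t + b))) (at t)" for t
    proof -
      have "(f has_real_derivative deriv f (a * t + b)) (at (a * t + b))"
        using Suc.prems by (simp add: diff_upto_Suc_iff)
      then have "((\<lambda>t. f (a * t + b)) has_real_derivative (deriv f (a * t + b) * a)) (at t)"
        by (rule DERIV_chain2) (auto intro!: derivative_eq_intros)
      then show ?thesis
        by (simp add: mult.commute)
    qed
    show "diff_upto n (\<lambda>t. a * deriv f (a * t + b))"
      using Suc by (intro diff_upto_cmult) (auto simp: diff_upto_Suc_iff)
  qed
qed simp

lemma diff_upto_inverse:
  assumes "\<And>t. f t \<noteq> 0"
  shows "diff_upto n f \<Longrightarrow> diff_upto n (\<lambda>t. inverse (f t))"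
proof (induction n)
  case (Suc n)
  show ?case
  proof (rule diff_upto_SucI)
    show "((\<lambda>t. inverse (f t)) has_real_derivative
        ((-1) * (inverse (f t) * deriv f t * inverse (f t)))) (at t)" for t
    proof -
      have "(f has_real_derivative deriv f t) (at t)"
        using Suc.prems unfolding diff_upto_Suc_iff by blast
      from DERIV_inverse'[OF this assms] show ?thesis
        by (simp only: mult_minus_left mult_1_left)
    qed
    show "diff_upto n (\<lambda>t. (-1) * (inverse (f t) * deriv f t * inverse (f t)))"
      using Suc.prems Suc.IH[OF diff_upto_SucD[OF Suc.prems]]
      by (intro diff_upto_cmult diff_upto_mult) (auto simp: diff_upto_Suc_iff)
  qed
qed simp

lemma higher_deriv_add:
  assumes "diff_upto n f" "diff_upto n g" "i \<le> n"
  shows "(deriv ^^ i) (\<lambda>t. f t + g t) = (\<lambda>t. (deriv ^^ i) f t + (deriv ^^ i) g t)"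
  using assms(3)
proof (induction i)
  case (Suc i)
  then have "(deriv ^^ Suc i) (\<lambda>t. f t + g t) = deriv (\<lambda>t. (deriv ^^ i) f t + (deriv ^^ i) g t)"
    by simp
  also have "\<dots> = (\<lambda>t. (deriv ^^ Suc i) f t + (deriv ^^ Suc i) g t)"
    using Suc.prems assms by (intro ext DERIV_imp_deriv DERIV_add diff_uptoD[of n]) auto
  finally show ?case .
qed simp

lemma higher_deriv_cmult:
  assumes "diff_upto n f" "i \<le> n"
  shows "(deriv ^^ i) (\<lambda>t. c * f t) = (\<lambda>t. c * (deriv ^^ i) f t)"
  using assms(2)
proof (induction i)
  case (Suc i)
  then have "(deriv ^^ Suc i) (\<lambda>t. c * f t) = deriv (\<lambda>t. c * (deriv ^^ i) f t)"
    by simp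
  also have "\<dots> = (\<lambda>t. c * (deriv ^^ Suc i) f t)"
    using Suc.prems assms by (intro ext DERIV_imp_deriv DERIV_cmult diff_uptoD[of n]) auto
  finally show ?case .
qed simp

lemma higher_deriv_sum:
  assumes "finite I" "\<And>l. l \<in> I \<Longrightarrow> diff_upto n (f l)" "i \<le> n"
  shows "(deriv ^^ i) (\<lambda>t. \<Sum>l\<in>I. f l t) = (\<lambda>t. \<Sum>l\<in>I. (deriv ^^ i) (f l) t)"
  using assms(3)
proof (induction i)
  case (Suc i)
  then have "(deriv ^^ Suc i) (\<lambda>t. \<Sum>l\<in>I. f l t) = deriv (\<lambda>t. \<Sum>l\<in>I. (deriv ^^ i) (f l) t)"
    by simp
  also have "\<dots> = (\<lambda>t. \<Sum>l\<in>I. (deriv ^^ Suc i) (f l) t)"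
    using Suc.prems assms by (intro ext DERIV_imp_deriv DERIV_sum diff_uptoD[of n]) auto
  finally show ?case .
qed simp

lemma higher_deriv_affine:
  assumes "diff_upto n f" "i \<le> n"
  shows "(deriv ^^ i) (\<lambda>t. f (a * t + b)) = (\<lambda>t. a ^ i * (deriv ^^ i) f (a * t + b))"
  using assms(2)
proof (induction i)
  case (Suc i)
  then have *: "(deriv ^^ Suc i) (\<lambda>t. f (a * t + b)) = deriv (\<lambda>t. a ^ i * (deriv ^^ i) f (a * t + b))"
    by simp
  have "((\<lambda>t. (deriv ^^ i) f (a * t + b)) has_real_derivative ((deriv ^^ Suc i) f (a * t + b) * a)) (at t)"
    for t
    by (rule DERIV_chain2[OF diff_uptoD[OF assms(1)]])
      (use Suc.prems in \<open>auto intro!: derivative_eq_intros\<close>)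
  from DERIV_cmult[OF this, of "a ^ i"]
  have "deriv (\<lambda>t. a ^ i * (deriv ^^ i) f (a * t + b)) = (\<lambda>t. a ^ Suc i * (deriv ^^ Suc i) f (a * t + b))"
    by (intro ext DERIV_imp_deriv) (simp add: mult_ac)
  with * show ?case
    by simp
qed simp

lemma higher_deriv_const: "i > 0 \<Longrightarrow> (deriv ^^ i) (\<lambda>t. c :: real) = (\<lambda>t. 0)"
proof (induction i)
  case (Suc i)
  then show ?case by (cases "i = 0") auto
qed simp

text \<open>A two-sided derivative is determined by the one-sided one, so the endpoints are
  included. This reads off derivatives at the junction of two pieces.\<close>

lemma higher_deriv_eq_on_interval:
  assumes "a < b" and f: "diff_upto n f" and g: "diff_upto n g"
    and eq: "\<And>t. t \<in> {a..b} \<Longrightarrow> f t = g t" and "i \<le> n" "t \<in> {a..b}"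
  shows "(deriv ^^ i) f t = (deriv ^^ i) g t"
  using \<open>i \<le> n\<close> \<open>t \<in> {a..b}\<close>
proof (induction i arbitrary: t)
  case (Suc i)
  have f': "((deriv ^^ i) f has_vector_derivative (deriv ^^ Suc i) f t) (at t within {a..b})"
    using diff_uptoD[OF f, of i t] Suc.prems
    by (auto simp: has_real_derivative_iff_has_vector_derivative intro: has_vector_derivative_at_within)
  have g': "((deriv ^^ i) g has_vector_derivative (deriv ^^ Suc i) g t) (at t within {a..b})"
    using diff_uptoD[OF g, of i t] Suc.prems
    by (auto simp: has_real_derivative_iff_has_vector_derivative intro: has_vector_derivative_at_within)
  have "((deriv ^^ i) f has_vector_derivative (deriv ^^ Suc i) g t) (at t within {a..b})"
    by (rule has_vector_derivative_transform[OF Suc.prems(2) _ g']) (use Suc in auto)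
  moreover have "at t within {a..b} \<noteq> bot"
    using Suc.prems(2) \<open>a < b\<close> by (simp add: trivial_limit_within)
  ultimately show ?case
    using f' by (metis vector_derivative_unique_within)
qed (use eq in auto)

lemma higher_deriv_power:
  "(deriv ^^ i) (\<lambda>t. (t - c) ^ e / fact e) =
    (\<lambda>t. if i \<le> e then (t - c) ^ (e - i) / fact (e - i) else (0 :: real))"
proof (induction i)
  case (Suc i)
  have *: "(deriv ^^ Suc i) (\<lambda>t. (t - c) ^ e / fact e) =
      deriv (\<lambda>t. if i \<le> e then (t - c) ^ (e - i) / fact (e - i) else 0)"
    using Suc by simp
  show ?case
  proof (cases "i < e")
    case True
    then obtain l where l: "e - i = Suc l" "e - Suc i = l"
      by (metis Suc_diff_Suc)
    have "((\<lambda>t. (t - c) ^ Suc l / fact (Suc l)) has_real_derivative (t - c) ^ l / fact l) (at t)" for t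
    proof -
      have "((\<lambda>t. (t - c) ^ Suc l) has_real_derivative real (Suc l) * (t - c) ^ l) (at t)"
        by (rule derivative_eq_intros refl | simp)+
      from DERIV_cdivide[OF this, of "fact (Suc l)"]
      have "((\<lambda>t. (t - c) ^ Suc l / fact (Suc l)) has_real_derivative
          real (Suc l) * (t - c) ^ l / (real (Suc l) * fact l)) (at t)"
        by (simp only: fact_Suc)
      then show ?thesis
        by (simp only: mult_divide_mult_cancel_left of_nat_eq_0_iff nat.simps not_False_eq_True)
    qed
    then show ?thesis
      using True l unfolding * by (auto intro!: ext DERIV_imp_deriv)
  next
    case False
    then show ?thesis
      unfolding * by (cases "i = e") auto
  qed
qed simp

section \<open>Cut-off and oscillation profiles of finite smoothness\<close>

text \<open>Differentiating lowers the exponent by one, so the kink at \<open>0\<close> only appears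
  after \<open>n\<close> derivatives. Truncated powers replace smooth bump functions
  throughout.\<close>

lemma diff_upto_pos_power: "diff_upto n (\<lambda>t. max 0 t ^ Suc n)"
proof (induction n)
  case (Suc n)
  show ?case
  proof (rule diff_upto_SucI)
    show "((\<lambda>t. max 0 t ^ Suc (Suc n)) has_real_derivative real (n + 2) * max 0 t ^ Suc n) (at t)"
      for t :: real
    proof (cases t "0 :: real" rule: linorder_cases)
      case less
      have "((\<lambda>t. 0) has_real_derivative 0) (at t)" by simp
      then have "((\<lambda>t. max 0 t ^ Suc (Suc n)) has_real_derivative 0) (at t)"
        by (rule has_field_derivative_transform_within_open[where S = "{..<0}"]) (use less in auto)
      with less show ?thesis by simp
    next
      case greater
      have "((\<lambda>t. t ^ Suc (Suc n)) has_real_derivative real (n + 2) * t ^ Suc n) (at t)"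
        by (rule derivative_eq_intros refl | simp)+
      then have "((\<lambda>t. max 0 t ^ Suc (Suc n)) has_real_derivative real (n + 2) * t ^ Suc n) (at t)"
        by (rule has_field_derivative_transform_within_open[where S = "{0<..}"]) (use greater in auto)
      with greater show ?thesis by simp
    next
      case equal
      have "((\<lambda>h. max 0 h ^ Suc n) \<longlongrightarrow> max 0 0 ^ Suc n) (at (0 :: real))"
        by (intro tendsto_intros)
      then have "((\<lambda>h. max 0 h ^ Suc n) \<longlongrightarrow> 0) (at (0 :: real))"
        by simp
      moreover have "\<forall>\<^sub>F h in at (0::real). max 0 h ^ Suc n = (max 0 (0 + h) ^ Suc (Suc n) - max 0 0 ^ Suc (Suc n)) / h"
        by (auto simp: eventually_at_filter max_def)
      ultimately have "((\<lambda>h. (max 0 (0 + h) ^ Suc (Suc n) - max 0 0 ^ Suc (Suc n)) / h) \<longlongrightarrow> 0) (at (0 :: real))"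
        by (rule Lim_transform_eventually)
      then show ?thesis
        using equal by (simp add: DERIV_def)
    qed
    show "diff_upto n (\<lambda>t. real (n + 2) * max 0 t ^ Suc n)"
      by (intro diff_upto_cmult Suc.IH)
  qed
qed simp

text \<open>A partition-of-unity quotient: the transition from \<open>0\<close> to \<open>1\<close>
  takes place in \<open>{0..1}\<close>, and the denominator never vanishes.\<close>

definition step_fun :: "nat \<Rightarrow> real \<Rightarrow> real" where
  "step_fun n t = max 0 t ^ Suc n / (max 0 t ^ Suc n + max 0 (1 - t) ^ Suc n)"

text \<open>A bump on \<open>{0..1}\<close> made odd about \<open>1/2\<close>, so that its first
  moment cancels.\<close>

definition osc_fun :: "nat \<Rightarrow> real \<Rightarrow> real" where
  "osc_fun n t = max 0 t ^ Suc n * max 0 (1 - t) ^ Suc n * (1 - 2 * t)"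

lemma diff_upto_pos_power_reflect: "diff_upto n (\<lambda>t. max 0 (1 - t) ^ Suc n)"
  using diff_upto_affine[OF diff_upto_pos_power, of n "-1" 1] by simp

lemma step_denominator_pos: "max 0 t ^ Suc n + max 0 (1 - t) ^ Suc n > (0 :: real)"
proof (cases "t > 0")
  case True
  then show ?thesis by (intro add_pos_nonneg) auto
next
  case False
  then show ?thesis by (intro add_nonneg_pos) auto
qed

lemma diff_upto_step: "diff_upto n (step_fun n)"
  unfolding step_fun_def divide_inverse
  using step_denominator_pos[of _ n]
  by (intro diff_upto_mult diff_upto_inverse diff_upto_add diff_upto_pos_power
      diff_upto_pos_power_reflect) (metis less_irrefl)

lemma step_fun_left: "t \<le> 0 \<Longrightarrow> step_fun n t = 0"
  by (simp add: step_fun_def max_def)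

lemma step_fun_right: "t \<ge> 1 \<Longrightarrow> step_fun n t = 1"
  by (simp add: step_fun_def max_def del: power_Suc)

lemma step_fun_bounds: "0 \<le> step_fun n t" "step_fun n t \<le> 1"
proof -
  have "0 \<le> max 0 t ^ Suc n" "0 \<le> max 0 (1 - t) ^ Suc n"
    by (rule zero_le_power, simp)+
  then show "0 \<le> step_fun n t" "step_fun n t \<le> 1"
    unfolding step_fun_def using step_denominator_pos[of t n]
    by (auto intro!: divide_nonneg_nonneg simp: divide_le_eq_1 simp del: power_Suc)
qed

lemma diff_upto_osc: "diff_upto n (osc_fun n)"
proof -
  have "diff_upto n (\<lambda>t. 1 - 2 * t)"
    using diff_upto_affine[OF diff_upto_id, of n "-2" 1] by (simp add: algebra_simps)
  then show ?thesis
    unfolding osc_fun_def by (intro diff_upto_mult diff_upto_pos_power diff_upto_pos_power_reflect)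
qed

lemma osc_fun_outside: "t \<le> 0 \<or> t \<ge> 1 \<Longrightarrow> osc_fun n t = 0"
  by (auto simp: osc_fun_def max_def)

lemma osc_fun_reflect: "osc_fun n (1 - t) = - osc_fun n t"
  by (simp add: osc_fun_def algebra_simps)

lemma higher_deriv_at_0:
  assumes "diff_upto n f" "\<And>t. t \<le> 0 \<Longrightarrow> f t = 0" "i \<le> n"
  shows "(deriv ^^ i) f 0 = 0"
proof -
  have "(deriv ^^ i) f 0 = (deriv ^^ i) (\<lambda>t. 0) 0"
    using assms by (intro higher_deriv_eq_on_interval[of "-1" 0 n] diff_upto_const) auto
  then show ?thesis
    by (cases "i = 0") (auto simp: higher_deriv_const)
qed

text \<open>All derivatives vanish at \<open>0\<close>, so integrating from \<open>0\<close> costs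
  one factor \<open>T\<close> per order. With \<open>r = 0\<close> it shows that a vanishing higher
  derivative forces the function itself to vanish.\<close>

lemma higher_deriv_bound:
  assumes f: "diff_upto n f" "\<And>t. t \<le> 0 \<Longrightarrow> f t = 0"
    and bd: "\<And>t. t \<in> {0..T} \<Longrightarrow> \<bar>(deriv ^^ (i + l)) f t\<bar> \<le> r" and "i + l \<le> n" and "t \<in> {0..T}"
  shows "\<bar>(deriv ^^ i) f t\<bar> \<le> r * T ^ l"
  using bd \<open>i + l \<le> n\<close> \<open>t \<in> {0..T}\<close>
proof (induction l arbitrary: i t)
  case (Suc l)
  have r: "0 \<le> r * T ^ l"
    using Suc.prems(1)[of t] Suc.prems(3) by (auto intro!: mult_nonneg_nonneg)
  have *: "\<bar>(deriv ^^ Suc i) f s\<bar> \<le> r * T ^ l" if "s \<in> {0..T}" for s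
    using Suc.prems that by (intro Suc.IH) auto
  have D: "((deriv ^^ i) f has_field_derivative (deriv ^^ Suc i) f s) (at s within {0..T})" for s
    by (rule has_field_derivative_at_within, rule diff_uptoD[OF f(1)]) (use Suc.prems(2) in simp)
  have "norm ((deriv ^^ i) f t - (deriv ^^ i) f 0) \<le> r * T ^ l * norm (t - 0)"
    by (rule field_differentiable_bound[OF _ D]) (use * Suc.prems(3) in \<open>simp_all del: funpow.simps\<close>)
  also have "r * T ^ l * norm (t - 0) \<le> r * T ^ l * T"
    by (rule mult_left_mono[OF _ r]) (use Suc.prems(3) in simp)
  finally show ?case
    using higher_deriv_at_0[OF f, of i] Suc.prems(2) by (simp add: mult_ac)
qed simp

section \<open>Steering the flat output\<close>

definition moment :: "nat \<Rightarrow> nat \<Rightarrow> (real \<Rightarrow> real) \<Rightarrow> real \<Rightarrow> real" where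
  "moment q e \<xi> T = integral {0..T} (\<lambda>t. \<xi> t ^ e * ((deriv ^^ q) \<xi> t)\<^sup>2)"

lemma moment_integrable:
  assumes "diff_upto n \<xi>" "q < n"
  shows "(\<lambda>t. \<xi> t ^ e * ((deriv ^^ q) \<xi> t)\<^sup>2) integrable_on {a..b}"
  using diff_upto_continuous[OF assms] diff_upto_continuous[OF assms(1), of 0] assms(2)
  by (intro integrable_continuous_interval continuous_intros) auto

lemma moment_cmult:
  assumes "diff_upto n \<xi>" "q < n"
  shows "moment q e (\<lambda>t. c * \<xi> t) T = c ^ (e + 2) * moment q e \<xi> T"
proof -
  have "(deriv ^^ q) (\<lambda>t. c * \<xi> t) = (\<lambda>t. c * (deriv ^^ q) \<xi> t)"
    using assms by (intro higher_deriv_cmult) auto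
  then show ?thesis
    unfolding moment_def
    by (simp add: power_mult_distrib mult_ac power_add power2_eq_square
        flip: Henstock_Kurzweil_Integration.integral_mult_right)
qed

text \<open>Vanishing on the negative half-line encodes zero initial data for all derivatives up to
  order \<open>n\<close> and lets a translate of one path be added to another.\<close>

definition flat_path :: "nat \<Rightarrow> nat \<Rightarrow> real \<Rightarrow> real \<Rightarrow> (real \<Rightarrow> real) \<Rightarrow> bool" where
  "flat_path n d r T \<xi> \<longleftrightarrow> diff_upto n \<xi> \<and> (\<forall>t\<le>0. \<xi> t = 0) \<and> (\<forall>t\<in>{0..T}. \<bar>(deriv ^^ d) \<xi> t\<bar> \<le> r)"

text \<open>The first path is constant from \<open>T1\<close> on and the translated second one is
  zero before, so the sum glues them smoothly. Since \<open>q\<close> and \<open>d\<close> are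
  positive, the shift by \<open>v\<close> changes neither the weight nor the bounded derivative; the
  moments of order \<open>1\<close> and \<open>2\<close> expand binomially.\<close>

lemma
  assumes p1: "flat_path n d r T1 \<xi>1" and v: "\<And>t. t \<ge> T1 \<Longrightarrow> \<xi>1 t = v" and p2: "flat_path n d r T2 \<xi>2"
    and T: "0 < T1" "0 < T2" and dq: "0 < d" "d \<le> n" "0 < q" "q < n"
    and \<xi>: "\<xi> = (\<lambda>t. \<xi>1 t + \<xi>2 (t - T1))"
  shows flat_path_concat: "flat_path n d r (T1 + T2) \<xi>"
    and higher_deriv_concat: "t \<in> {0..T2} \<Longrightarrow> i \<le> n \<Longrightarrow>
      (deriv ^^ i) \<xi> (T1 + t) = (if i = 0 then v else 0) + (deriv ^^ i) \<xi>2 t"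
    and moment_concat_0: "moment q 0 \<xi> (T1 + T2) = moment q 0 \<xi>1 T1 + moment q 0 \<xi>2 T2"
    and moment_concat_1: "moment q 1 \<xi> (T1 + T2) =
      moment q 1 \<xi>1 T1 + moment q 1 \<xi>2 T2 + v * moment q 0 \<xi>2 T2"
    and moment_concat_2: "moment q 2 \<xi> (T1 + T2) =
      moment q 2 \<xi>1 T1 + moment q 2 \<xi>2 T2 + 2 * v * moment q 1 \<xi>2 T2 + v\<^sup>2 * moment q 0 \<xi>2 T2"
proof -
  have d1: "diff_upto n \<xi>1" and d2: "diff_upto n \<xi>2"
    and z1: "\<xi>1 t = 0" and z2: "\<xi>2 t = 0" if "t \<le> 0" for t
    using p1 p2 that by (auto simp: flat_path_def)
  have d2': "diff_upto n (\<lambda>t. \<xi>2 (t - T1))"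
    using diff_upto_affine[OF d2[of 0], of 1 "-T1"] by simp
  have d\<xi>: "diff_upto n \<xi>"
    unfolding \<xi> by (intro diff_upto_add d1[of 0] d2') simp
  have left: "(deriv ^^ i) \<xi> t = (deriv ^^ i) \<xi>1 t" if "t \<in> {0..T1}" "i \<le> n" for i t
    by (rule higher_deriv_eq_on_interval[OF T(1) d\<xi> d1[of 0] _ that(2,1)]) (auto simp: \<xi> z2)
  have right: "(deriv ^^ i) \<xi> (T1 + t) = (if i = 0 then v else 0) + (deriv ^^ i) \<xi>2 t"
    if "t \<in> {0..T2}" "i \<le> n" for i t
  proof -
    have "(deriv ^^ i) \<xi> (T1 + t) = (deriv ^^ i) (\<lambda>t. v + \<xi>2 (t - T1)) (T1 + t)"
      by (rule higher_deriv_eq_on_interval[where a = T1 and b = "T1 + T2" and n = n])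
        (use that d\<xi> d2' T in \<open>auto simp: \<xi> v intro!: diff_upto_add diff_upto_const\<close>)
    also have "\<dots> = (deriv ^^ i) (\<lambda>t. v) (T1 + t) + (deriv ^^ i) (\<lambda>t. \<xi>2 (1 * t + (-T1))) (T1 + t)"
      using higher_deriv_add[OF diff_upto_const d2' that(2), of v] by simp
    also have "(deriv ^^ i) (\<lambda>t. \<xi>2 (1 * t + (-T1))) (T1 + t) = (deriv ^^ i) \<xi>2 t"
      using higher_deriv_affine[OF d2[of 0] that(2), of 1 "-T1"] by simp
    also have "(deriv ^^ i) (\<lambda>t. v) (T1 + t) = (if i = 0 then v else 0)"
      by (auto simp: higher_deriv_const)
    finally show ?thesis .
  qed
  show "(deriv ^^ i) \<xi> (T1 + t) = (if i = 0 then v else 0) + (deriv ^^ i) \<xi>2 t"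
    if "t \<in> {0..T2}" "i \<le> n"
    using right that .
  show "flat_path n d r (T1 + T2) \<xi>"
    unfolding flat_path_def
  proof (intro conjI ballI allI impI)
    show "\<xi> t = 0" if "t \<le> 0" for t
      using that T by (simp add: \<xi> z1 z2)
    show "\<bar>(deriv ^^ d) \<xi> t\<bar> \<le> r" if t: "t \<in> {0..T1 + T2}" for t
    proof (cases "t \<le> T1")
      case True
      then show ?thesis
        using left[of t d] t p1 dq by (auto simp: flat_path_def)
    next
      case False
      then show ?thesis
        using right[of "t - T1" d] t p2 dq by (auto simp: flat_path_def)
    qed
  qed (rule d\<xi>)
  let ?g = "\<lambda>e t. \<xi>2 t ^ e * ((deriv ^^ q) \<xi>2 t)\<^sup>2"
  have mom: "moment q e \<xi> (T1 + T2) =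
      moment q e \<xi>1 T1 + integral {0..T2} (\<lambda>t. (v + \<xi>2 t) ^ e * ((deriv ^^ q) \<xi>2 t)\<^sup>2)" for e
  proof -
    let ?f = "\<lambda>t. \<xi> t ^ e * ((deriv ^^ q) \<xi> t)\<^sup>2"
    have "moment q e \<xi> (T1 + T2) = integral {0..T1} ?f + integral {T1..T1 + T2} ?f"
      unfolding moment_def
      by (rule Henstock_Kurzweil_Integration.integral_combine[symmetric])
        (use T dq in \<open>auto intro!: moment_integrable[OF d\<xi>]\<close>)
    also have "integral {0..T1} ?f = moment q e \<xi>1 T1"
      unfolding moment_def
      by (rule integral_cong) (use left[of _ q] left[of _ 0] dq in auto)
    also have "integral {T1..T1 + T2} ?f = integral {0..T2} (?f \<circ> (\<lambda>t. t + T1))"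
    proof -
      have "continuous_on {0 + T1..T2 + T1} ?f"
        using diff_upto_continuous[OF d\<xi> dq(4)] diff_upto_continuous[OF d\<xi>, of 0] dq
        by (intro continuous_intros) auto
      from integral_shift[OF this] show ?thesis
        by (simp add: add.commute)
    qed
    also have "\<dots> = integral {0..T2} (\<lambda>t. (v + \<xi>2 t) ^ e * ((deriv ^^ q) \<xi>2 t)\<^sup>2)"
      by (rule integral_cong) (use right[of _ q] right[of _ 0] dq in \<open>auto simp: add.commute\<close>)
    finally show ?thesis .
  qed
  have int: "?g e integrable_on {0..T2}" for e
    using d2[of 0] dq by (intro moment_integrable) auto
  show "moment q 0 \<xi> (T1 + T2) = moment q 0 \<xi>1 T1 + moment q 0 \<xi>2 T2"
    unfolding mom by (simp add: moment_def)
  have "integral {0..T2} (\<lambda>t. (v + \<xi>2 t) ^ 1 * ((deriv ^^ q) \<xi>2 t)\<^sup>2) =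
      integral {0..T2} (\<lambda>t. ?g 1 t + v * ?g 0 t)"
    by (rule integral_cong) (simp add: algebra_simps)
  also have "\<dots> = moment q 1 \<xi>2 T2 + v * moment q 0 \<xi>2 T2"
    using integrable_add[OF int[of 1] integrable_on_mult_right[OF int[of 0]], of v]
    by (subst integral_add) (use int[of 1] int[of 0] in
      \<open>auto simp: moment_def intro!: integrable_on_mult_right\<close>)
  finally show "moment q 1 \<xi> (T1 + T2) =
      moment q 1 \<xi>1 T1 + moment q 1 \<xi>2 T2 + v * moment q 0 \<xi>2 T2"
    unfolding mom by simp
  have "integral {0..T2} (\<lambda>t. (v + \<xi>2 t) ^ 2 * ((deriv ^^ q) \<xi>2 t)\<^sup>2) =
      integral {0..T2} (\<lambda>t. ?g 2 t + ((2 * v) * ?g 1 t + v\<^sup>2 * ?g 0 t))"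
    by (rule integral_cong) (simp add: algebra_simps power2_eq_square)
  also have "\<dots> = moment q 2 \<xi>2 T2 + (2 * v * moment q 1 \<xi>2 T2 + v\<^sup>2 * moment q 0 \<xi>2 T2)"
  proof -
    have i1: "(\<lambda>t. (2 * v) * ?g 1 t) integrable_on {0..T2}" and i0: "(\<lambda>t. v\<^sup>2 * ?g 0 t) integrable_on {0..T2}"
      by (intro integrable_on_mult_right int)+
    show ?thesis
      using integral_add[OF int[of 2] integrable_add[OF i1 i0]] integral_add[OF i1 i0]
      by (simp add: moment_def)
  qed
  finally show "moment q 2 \<xi> (T1 + T2) =
      moment q 2 \<xi>1 T1 + moment q 2 \<xi>2 T2 + 2 * v * moment q 1 \<xi>2 T2 + v\<^sup>2 * moment q 0 \<xi>2 T2"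
    unfolding mom by simp
qed

text \<open>Final rest at the value \<open>v\<close> is what makes the relation composable.\<close>

definition reach ::
  "nat \<Rightarrow> nat \<Rightarrow> nat \<Rightarrow> real \<Rightarrow> real \<Rightarrow> real \<Rightarrow> real \<Rightarrow> real \<Rightarrow> real \<Rightarrow> bool" where
  "reach n q d r T v A B C \<longleftrightarrow> (\<exists>\<xi>. flat_path n d r T \<xi> \<and> (\<forall>t\<ge>T. \<xi> t = v) \<and>
    moment q 0 \<xi> T = A \<and> moment q 1 \<xi> T = B \<and> moment q 2 \<xi> T = C)"

lemma reach_concat:
  assumes "reach n q d r T1 v1 A1 B1 C1" "reach n q d r T2 v2 A2 B2 C2"
    and T: "0 < T1" "0 < T2" and dq: "0 < d" "d \<le> n" "0 < q" "q < n"
  shows "reach n q d r (T1 + T2) (v1 + v2) (A1 + A2) (B1 + B2 + v1 * A2)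
    (C1 + C2 + 2 * v1 * B2 + v1\<^sup>2 * A2)"
proof -
  obtain \<xi>1 where 1: "flat_path n d r T1 \<xi>1" "\<And>t. t \<ge> T1 \<Longrightarrow> \<xi>1 t = v1" "moment q 0 \<xi>1 T1 = A1"
      "moment q 1 \<xi>1 T1 = B1" "moment q 2 \<xi>1 T1 = C1"
    using assms(1) unfolding reach_def by blast
  obtain \<xi>2 where 2: "flat_path n d r T2 \<xi>2" "\<And>t. t \<ge> T2 \<Longrightarrow> \<xi>2 t = v2" "moment q 0 \<xi>2 T2 = A2"
      "moment q 1 \<xi>2 T2 = B2" "moment q 2 \<xi>2 T2 = C2"
    using assms(2) unfolding reach_def by blast
  note concat = flat_path_concat[OF 1(1,2) 2(1) T dq refl] moment_concat_0[OF 1(1,2) 2(1) T dq refl]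
    moment_concat_1[OF 1(1,2) 2(1) T dq refl] moment_concat_2[OF 1(1,2) 2(1) T dq refl]
  show ?thesis
    unfolding reach_def
    by (rule exI[of _ "\<lambda>t. \<xi>1 t + \<xi>2 (t - T1)"]) (use concat 1 2 T in auto)
qed

section \<open>Elementary moves: oscillations and steps\<close>

text \<open>Under \<open>t \<mapsto> 1 - t\<close> the profile changes sign, while the square of its
  \<open>q\<close>-th derivative is invariant. Hence an oscillation adds mass to a plateau without
  displacing its centre of mass.\<close>

lemma osc_moment_1: "q < n \<Longrightarrow> moment q 1 (osc_fun n) 1 = 0"
proof -
  assume q: "q < n"
  let ?f = "\<lambda>t. osc_fun n t * ((deriv ^^ q) (osc_fun n) t)\<^sup>2"
  have refl: "(\<lambda>t. osc_fun n ((-1) * t + 1)) = (\<lambda>t. (-1) * osc_fun n t)"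
    using osc_fun_reflect[of n] by simp
  have "(\<lambda>t. (-1) ^ q * (deriv ^^ q) (osc_fun n) ((-1) * t + 1)) =
      (\<lambda>t. (-1) * (deriv ^^ q) (osc_fun n) t)"
    using higher_deriv_affine[OF diff_upto_osc, of q n "-1" 1]
      higher_deriv_cmult[OF diff_upto_osc, of q n "-1"] q unfolding refl by auto
  then have "(-1) ^ q * (deriv ^^ q) (osc_fun n) (1 - t) = - (deriv ^^ q) (osc_fun n) t" for t
    by (auto dest!: fun_cong[of _ _ t])
  then have "((-1) ^ q * (deriv ^^ q) (osc_fun n) (1 - t))\<^sup>2 = ((deriv ^^ q) (osc_fun n) t)\<^sup>2" for t
    by simp
  then have sq: "((deriv ^^ q) (osc_fun n) (1 - t))\<^sup>2 = ((deriv ^^ q) (osc_fun n) t)\<^sup>2" for t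
    by (simp add: power_mult_distrib flip: power_mult)
  have "integral {0..1} ?f = integral {0..1} (\<lambda>t. ?f (1 - t))"
  proof -
    have "integral {-1..-0} (\<lambda>t. ?f (- t)) = integral {0..1} ?f"
      by (rule Henstock_Kurzweil_Integration.integral_reflect_real)
    moreover have "integral {-1..0} ((\<lambda>t. ?f (1 - (t + 1))) ) = integral {0..1} (\<lambda>t. ?f (1 - t))"
    proof -
      have c: "continuous_on UNIV ((deriv ^^ q) (osc_fun n))" "continuous_on UNIV (osc_fun n)"
        using diff_upto_continuous[OF diff_upto_osc q, of UNIV]
          diff_upto_continuous[OF diff_upto_osc, of 0 n UNIV] q by simp_all
      have "continuous_on UNIV ?f"
        by (rule continuous_on_mult[OF c(2) continuous_on_power[OF c(1)]])
      from continuous_on_compose2[OF this, of "{-1 + 1..0 + 1}" "\<lambda>t. 1 - t"]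
      have "continuous_on {-1 + 1..0 + 1} (\<lambda>t. ?f (1 - t))"
        by (simp add: continuous_on_diff)
      from integral_shift[OF this] show ?thesis
        by (simp add: o_def)
    qed
    ultimately show ?thesis
      by simp
  qed
  also have "\<dots> = - integral {0..1} ?f"
    by (simp add: osc_fun_reflect sq)
  finally show ?thesis
    by (simp add: moment_def)
qed

lemma osc_moment_0_pos:
  assumes "q < n"
  shows "moment q 0 (osc_fun n) 1 > 0"
proof -
  have cont: "continuous_on {0..1} (\<lambda>t. ((deriv ^^ q) (osc_fun n) t)\<^sup>2)"
    using diff_upto_continuous[OF diff_upto_osc assms] by (intro continuous_intros)
  have "moment q 0 (osc_fun n) 1 \<ge> 0"
    by (auto simp: moment_def intro: integral_nonneg[OF integrable_continuous_interval[OF cont]])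
  moreover have False if "moment q 0 (osc_fun n) 1 = 0"
  proof -
    have "(deriv ^^ q) (osc_fun n) t = 0" if "t \<in> {0..1}" for t
      using integral_eq_0_iff[OF cont, simplified] \<open>moment q 0 (osc_fun n) 1 = 0\<close> that
      by (auto simp: moment_def)
    \<comment> \<open>Integrating a zero \<open>q\<close>-th derivative gives the value zero at
      \<open>1/4\<close>, whereas the profile is positive there.\<close>
    then have "\<bar>(deriv ^^ 0) (osc_fun n) (1/4)\<bar> \<le> 0 * 1 ^ q"
      using assms by (intro higher_deriv_bound[where n = n]) (auto simp: diff_upto_osc osc_fun_outside)
    then show False
      using zero_less_power[of "1/4 :: real" "Suc n"] zero_less_power[of "3/4 :: real" "Suc n"]
      by (simp add: osc_fun_def mult_le_0_iff not_le[symmetric])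
  qed
  ultimately show ?thesis
    by fastforce
qed

lemma reach_osc:
  assumes "0 < d" "d \<le> n" "0 < q" "q < n" and "\<And>t. t \<in> {0..1} \<Longrightarrow> \<bar>(deriv ^^ d) (osc_fun n) t\<bar> \<le> K"
    and "\<bar>\<alpha>\<bar> * K \<le> r"
  shows "reach n q d r 1 0 (\<alpha>\<^sup>2 * moment q 0 (osc_fun n) 1) 0 (\<alpha> ^ 4 * moment q 2 (osc_fun n) 1)"
  unfolding reach_def
proof (intro exI[of _ "\<lambda>t. \<alpha> * osc_fun n t"] conjI allI impI)
  show "flat_path n d r 1 (\<lambda>t. \<alpha> * osc_fun n t)"
    unfolding flat_path_def
  proof (intro conjI allI impI ballI)
    show "\<bar>(deriv ^^ d) (\<lambda>t. \<alpha> * osc_fun n t) t\<bar> \<le> r" if "t \<in> {0..1}" for t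
    proof -
      have "\<bar>\<alpha>\<bar> * \<bar>(deriv ^^ d) (osc_fun n) t\<bar> \<le> \<bar>\<alpha>\<bar> * K"
        using assms(5) that by (intro mult_left_mono) auto
      then show ?thesis
        using assms higher_deriv_cmult[OF diff_upto_osc \<open>d \<le> n\<close>, of \<alpha>]
        by (simp add: abs_mult)
    qed
  qed (auto simp: osc_fun_outside intro: diff_upto_cmult diff_upto_osc)
qed (use assms in \<open>auto simp: osc_fun_outside moment_cmult[OF diff_upto_osc] osc_moment_1[simplified]
    power2_eq_square eval_nat_numeral\<close>)

text \<open>Each oscillation returns to \<open>0\<close> and has zero first moment, so all cross
  terms of the concatenation vanish and the data simply add up.\<close>

lemma reach_osc_iterate:
  assumes "0 < d" "d \<le> n" "0 < q" "q < n" and "\<And>t. t \<in> {0..1} \<Longrightarrow> \<bar>(deriv ^^ d) (osc_fun n) t\<bar> \<le> K"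
    and "\<bar>\<alpha>\<bar> * K \<le> r" and "0 < N"
  shows "reach n q d r (real N) 0 (real N * (\<alpha>\<^sup>2 * moment q 0 (osc_fun n) 1)) 0
    (real N * (\<alpha> ^ 4 * moment q 2 (osc_fun n) 1))"
  using \<open>0 < N\<close>
proof (induction N rule: nat_induct_non_zero)
  case 1
  then show ?case
    using reach_osc[OF assms(1-6)] by simp
next
  case (Suc N)
  from reach_concat[OF Suc(2) reach_osc[OF assms(1-6)] _ _ assms(1-4)] Suc(1)
  show ?case
    by (simp add: algebra_simps)
qed

lemma step_moment_bounds:
  assumes "q < n"
  shows "0 \<le> moment q e (step_fun n) 1" "moment q e (step_fun n) 1 \<le> moment q 0 (step_fun n) 1"
proof -
  have int: "(\<lambda>t. step_fun n t ^ e * ((deriv ^^ q) (step_fun n) t)\<^sup>2) integrable_on {0..1}" for e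
    using assms by (intro moment_integrable[OF diff_upto_step])
  show "0 \<le> moment q e (step_fun n) 1"
    unfolding moment_def by (intro integral_nonneg int) (auto simp: step_fun_bounds)
  show "moment q e (step_fun n) 1 \<le> moment q 0 (step_fun n) 1"
    unfolding moment_def
    by (intro integral_le int mult_right_mono) (auto simp: step_fun_bounds intro!: power_le_one)
qed

lemma reach_step:
  assumes "0 < d" "d \<le> n" "0 < q" "q < n" and "\<And>t. t \<in> {0..1} \<Longrightarrow> \<bar>(deriv ^^ d) (step_fun n) t\<bar> \<le> K"
    and "\<bar>v\<bar> * K \<le> r"
  shows "reach n q d r 1 v (v\<^sup>2 * moment q 0 (step_fun n) 1) (v ^ 3 * moment q 1 (step_fun n) 1)
    (v ^ 4 * moment q 2 (step_fun n) 1)"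
  unfolding reach_def
proof (intro exI[of _ "\<lambda>t. v * step_fun n t"] conjI allI impI)
  show "flat_path n d r 1 (\<lambda>t. v * step_fun n t)"
    unfolding flat_path_def
  proof (intro conjI allI impI ballI)
    show "\<bar>(deriv ^^ d) (\<lambda>t. v * step_fun n t) t\<bar> \<le> r" if "t \<in> {0..1}" for t
    proof -
      have "\<bar>v\<bar> * \<bar>(deriv ^^ d) (step_fun n) t\<bar> \<le> \<bar>v\<bar> * K"
        using assms(5) that by (intro mult_left_mono) auto
      then show ?thesis
        using assms higher_deriv_cmult[OF diff_upto_step \<open>d \<le> n\<close>, of v]
        by (simp add: abs_mult)
    qed
  qed (auto simp: step_fun_left intro: diff_upto_cmult diff_upto_step)
qed (use assms in \<open>auto simp: step_fun_right moment_cmult[OF diff_upto_step] eval_nat_numeral\<close>)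

section \<open>Perturbed Simpson weights and correction of the final jet\<close>

text \<open>Without errors the solution is Simpson's rule \<open>1/6, 2/3, 1/6\<close>, with second
  moment \<open>4/3\<close> for nodes \<open>0, 1, 2\<close>. The middle mass \<open>s\<close> is
  kept free and the two linear equations fix the others; then the left-hand side of the quadratic
  equation is about \<open>2 - s\<close>. Moving \<open>s\<close> by \<open>1/6\<close> to either
  side of \<open>2/3\<close> outweighs all errors. The \<kappa> term is the spread of the
  oscillations around their plateaus.\<close>

lemma mass_distribution_exists:
  fixes e0 e1 e2 \<kappa> :: real
  assumes "\<bar>e0\<bar> \<le> 1 / 100" "\<bar>e1\<bar> \<le> 1 / 100" "\<bar>e2\<bar> \<le> 1 / 100" "0 \<le> \<kappa>" "\<kappa> \<le> 1 / 100"
  shows "\<exists>b0 b1 b2. {b0, b1, b2} \<subseteq> {0..1} \<and> b0 + b1 + b2 = 1 - e0 \<and> b1 + 2 * b2 = 1 - e1 \<and>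
    b1 + 4 * b2 + \<kappa> * (b0\<^sup>2 + b1\<^sup>2 + b2\<^sup>2) = 4 / 3 - e2"
proof -
  define b2 where "b2 = (\<lambda>s. (1 - e1 - s) / 2)"
  define b0 where "b0 = (\<lambda>s. 1 - e0 - s - b2 s)"
  define f where "f = (\<lambda>s. s + 4 * b2 s + \<kappa> * ((b0 s)\<^sup>2 + s\<^sup>2 + (b2 s)\<^sup>2))"
  have range: "b0 s \<in> {0..1}" "b2 s \<in> {0..1}" if "s \<in> {1/2..5/6}" for s
    using that assms unfolding b0_def b2_def abs_le_iff by (auto simp: field_simps)
  have "f (5/6) \<le> 4 / 3 - e2"
  proof -
    have "(b0 (5/6))\<^sup>2 \<le> 1" "(b2 (5/6))\<^sup>2 \<le> 1"
      using range[of "5/6"] by (auto intro: power_le_one)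
    then have "\<kappa> * ((b0 (5/6))\<^sup>2 + (5/6)\<^sup>2 + (b2 (5/6))\<^sup>2) \<le> (1/100) * 3"
      using assms by (intro mult_mono) (auto simp: power2_eq_square)
    moreover have "4 * b2 (5/6) = 1/3 - 2 * e1"
      by (simp add: b2_def)
    ultimately show ?thesis
      using assms unfolding f_def abs_le_iff by linarith
  qed
  moreover have "4 / 3 - e2 \<le> f (1/2)"
  proof -
    have "0 \<le> \<kappa> * ((b0 (1/2))\<^sup>2 + (1/2)\<^sup>2 + (b2 (1/2))\<^sup>2)"
      using assms by (intro mult_nonneg_nonneg add_nonneg_nonneg zero_le_power2)
    moreover have "4 * b2 (1/2) = 1 - 2 * e1"
      by (simp add: b2_def)
    ultimately show ?thesis
      using assms unfolding f_def abs_le_iff by linarith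
  qed
  moreover have "continuous_on {1/2..5/6} f"
    unfolding f_def b0_def b2_def by (intro continuous_intros) auto
  ultimately obtain s where "1/2 \<le> s" "s \<le> 5/6" "f s = 4 / 3 - e2"
    using IVT2'[of f "5/6" "4 / 3 - e2" "1/2"] by auto
  moreover have "b0 s + s + b2 s = 1 - e0" "s + 2 * b2 s = 1 - e1"
    by (simp_all add: b0_def b2_def field_simps)
  moreover have "{b0 s, s, b2 s} \<subseteq> {0..1}"
    using range[of s] calculation(1,2) by auto
  ultimately show ?thesis
    unfolding f_def by blast
qed

lemma higher_deriv_bounded:
  assumes "diff_upto n f" "i < n"
  shows "\<exists>K>0. \<forall>t\<in>{0..1}. \<bar>(deriv ^^ i) f t\<bar> \<le> K"
proof -
  have "bounded ((deriv ^^ i) f ` {0..1})"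
    using diff_upto_continuous[OF assms] by (intro compact_imp_bounded compact_continuous_image) auto
  then show ?thesis
    unfolding bounded_pos by auto
qed

text \<open>A cut-off times the Taylor polynomial at \<open>1\<close> with prescribed jet:
  \<open>y i\<close> is the derivative of order \<open>k - i\<close>, matching x_i as the
  \<open>(k - i)\<close>-th derivative of \<xi> for \<open>i < k\<close>.\<close>

definition corr_fun :: "nat \<Rightarrow> nat \<Rightarrow> (nat \<Rightarrow> real) \<Rightarrow> real \<Rightarrow> real" where
  "corr_fun n k y t = (\<Sum>i\<in>{1..k}. y i * (step_fun n t * ((t - 1) ^ (k - i) / fact (k - i))))"

lemma diff_upto_scaled_power: "diff_upto n (\<lambda>t. (t - 1) ^ e / fact e)"
proof -
  have "diff_upto n (\<lambda>t. inverse (fact e) * (1 * t + (-1)) ^ e)"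
    by (intro diff_upto_cmult diff_upto_power diff_upto_affine diff_upto_id)
  then show ?thesis
    by (simp add: field_simps)
qed

lemma diff_upto_corr: "diff_upto n (corr_fun n k y)"
  unfolding corr_fun_def
  by (intro diff_upto_sum diff_upto_cmult diff_upto_mult diff_upto_step diff_upto_scaled_power)

lemma corr_fun_left: "t \<le> 0 \<Longrightarrow> corr_fun n k y t = 0"
  by (simp add: corr_fun_def step_fun_left)

text \<open>The polynomial has degree below \<open>k\<close>, so the derivatives of order
  \<open>k\<close> and more vanish at \<open>1\<close>; they are the final values of the control and
  its derivatives.\<close>

lemma corr_fun_jet:
  assumes "l \<le> n"
  shows "(deriv ^^ l) (corr_fun n k y) 1 = (if l < k then y (k - l) else 0)"
proof -
  define p :: "nat \<Rightarrow> real \<Rightarrow> real" where "p = (\<lambda>e t. (t - 1) ^ e / fact e)"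
  have dp: "diff_upto n (p e)" for e
    unfolding p_def by (rule diff_upto_scaled_power)
  have sum: "diff_upto n (\<lambda>t. \<Sum>i\<in>{1..k}. y i * p (k - i) t)"
    by (intro diff_upto_sum diff_upto_cmult dp)
  have "(deriv ^^ l) (corr_fun n k y) 1 = (deriv ^^ l) (\<lambda>t. \<Sum>i\<in>{1..k}. y i * p (k - i) t) 1"
    \<comment> \<open>The comparison takes place on \<open>{1..2}\<close>, to the right of the
      evaluation point, where the cut-off is identically \<open>1\<close>.\<close>
    by (rule higher_deriv_eq_on_interval[OF _ diff_upto_corr sum _ assms, of 1 2])
      (auto simp: corr_fun_def step_fun_right p_def)
  also have "\<dots> = (\<Sum>i\<in>{1..k}. (deriv ^^ l) (\<lambda>t. y i * p (k - i) t) 1)"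
    using higher_deriv_sum[OF _ diff_upto_cmult[OF dp] assms, of "{1..k}" y "\<lambda>i. k - i"] by simp
  also have "\<dots> = (\<Sum>i\<in>{1..k}. y i * (deriv ^^ l) (p (k - i)) 1)"
    by (simp only: higher_deriv_cmult[OF dp assms])
  also have "\<dots> = (\<Sum>i\<in>{1..k}. y i * (if l \<le> k - i then 0 ^ (k - i - l) / fact (k - i - l) else 0))"
    by (simp add: p_def higher_deriv_power cong: if_cong)
  also have "\<dots> = (\<Sum>i\<in>{1..k}. if i = k - l then (if l < k then y (k - l) else 0) else 0)"
    by (rule sum.cong) (auto simp: power_0_left)
  also have "\<dots> = (if l < k then y (k - l) else 0)"
    by (cases "l < k") (auto simp: sum.delta)
  finally show ?thesis .
qed

text \<open>Linearity in \<open>y\<close> reduces this to finitely many fixed profiles. One constant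
  independent of \<open>y\<close> lets the target radius be chosen before the target.\<close>

lemma corr_fun_bound:
  assumes "d < n"
  obtains K where "K \<ge> 1"
    "\<And>y \<delta> l t. (\<And>i. i \<in> {1..k} \<Longrightarrow> \<bar>y i\<bar> \<le> \<delta>) \<Longrightarrow> l \<le> d \<Longrightarrow> t \<in> {0..1} \<Longrightarrow> 0 \<le> \<delta> \<Longrightarrow>
      \<bar>(deriv ^^ l) (corr_fun n k y) t\<bar> \<le> K * \<delta>"
proof -
  define \<psi> where "\<psi> = (\<lambda>i t. step_fun n t * ((t - 1) ^ (k - i) / fact (k - i)))"
  have \<psi>: "diff_upto n (\<psi> i)" for i
    unfolding \<psi>_def by (intro diff_upto_mult diff_upto_step diff_upto_scaled_power)
  have "\<exists>K>0. \<forall>t\<in>{0..1}. \<bar>(deriv ^^ l) (\<psi> i) t\<bar> \<le> K" if "l \<le> d" for i l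
  proof -
    have "l < n"
      using that assms by simp
    then show ?thesis
      by (rule higher_deriv_bounded[OF \<psi>])
  qed
  then have "\<forall>i l. \<exists>K. l \<le> d \<longrightarrow> K > 0 \<and> (\<forall>t\<in>{0..1}. \<bar>(deriv ^^ l) (\<psi> i) t\<bar> \<le> K)"
    by blast
  then obtain M where "\<forall>i l. l \<le> d \<longrightarrow> M i l > 0 \<and> (\<forall>t\<in>{0..1}. \<bar>(deriv ^^ l) (\<psi> i) t\<bar> \<le> M i l)"
    unfolding choice_iff by blast
  then have M: "\<And>i l. l \<le> d \<Longrightarrow> M i l > 0"
      "\<And>i l t. l \<le> d \<Longrightarrow> t \<in> {0..1} \<Longrightarrow> \<bar>(deriv ^^ l) (\<psi> i) t\<bar> \<le> M i l"
    by blast+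
  define K where "K = 1 + (\<Sum>l\<le>d. \<Sum>i\<in>{1..k}. M i l)"
  show thesis
  proof (rule that[of K])
    show "K \<ge> 1"
    proof -
      have "0 \<le> (\<Sum>l\<le>d. \<Sum>i\<in>{1..k}. M i l)"
        using M(1) by (intro sum_nonneg less_imp_le) auto
      then show ?thesis
        by (simp add: K_def)
    qed
    fix y :: "nat \<Rightarrow> real" and \<delta> l t
    assume y: "\<And>i. i \<in> {1..k} \<Longrightarrow> \<bar>y i\<bar> \<le> \<delta>" and l: "l \<le> d" and t: "t \<in> {0..1::real}" and "0 \<le> \<delta>"
    have "(deriv ^^ l) (corr_fun n k y) = (\<lambda>t. \<Sum>i\<in>{1..k}. (deriv ^^ l) (\<lambda>t. y i * \<psi> i t) t)"
    proof -
      have "corr_fun n k y = (\<lambda>t. \<Sum>i\<in>{1..k}. y i * \<psi> i t)"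
        by (rule ext) (simp only: corr_fun_def \<psi>_def)
      moreover have "l \<le> n"
        using l assms by simp
      ultimately show ?thesis
        using higher_deriv_sum[OF _ diff_upto_cmult[OF \<psi>], of "{1..k}" l y "\<lambda>i. i"] by simp
    qed
    also have "\<dots> = (\<lambda>t. \<Sum>i\<in>{1..k}. y i * (deriv ^^ l) (\<psi> i) t)"
      using l assms by (simp add: higher_deriv_cmult[OF \<psi>])
    finally have "\<bar>(deriv ^^ l) (corr_fun n k y) t\<bar> \<le> (\<Sum>i\<in>{1..k}. \<bar>y i * (deriv ^^ l) (\<psi> i) t\<bar>)"
      by (simp add: sum_abs)
    also have "\<dots> \<le> (\<Sum>i\<in>{1..k}. \<delta> * M i l)"
      using y M l t \<open>0 \<le> \<delta>\<close> by (intro sum_mono) (auto simp: abs_mult intro!: mult_mono)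
    also have "\<dots> = (\<Sum>i\<in>{1..k}. M i l) * \<delta>"
      by (simp add: sum_distrib_left mult.commute)
    also have "\<dots> \<le> K * \<delta>"
    proof (rule mult_right_mono)
      have "(\<Sum>i\<in>{1..k}. M i l) \<le> (\<Sum>l\<le>d. \<Sum>i\<in>{1..k}. M i l)"
        using l M(1)
        by (intro member_le_sum[of l "{..d}" "\<lambda>l. \<Sum>i\<in>{1..k}. M i l"] sum_nonneg less_imp_le) auto
      then show "(\<Sum>i\<in>{1..k}. M i l) \<le> K"
        by (simp add: K_def)
    qed fact
    finally show "\<bar>(deriv ^^ l) (corr_fun n k y) t\<bar> \<le> K * \<delta>" .
  qed
qed

text \<open>The moment is of size \<eta>^(e+2); since \<eta> \<le> 1, a linear bound uniform in
  \<open>e\<close> is enough.\<close>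

lemma moment_bound:
  assumes "diff_upto n \<zeta>" "q < n" and "\<eta> \<le> 1"
    and "\<And>t. t \<in> {0..1} \<Longrightarrow> \<bar>\<zeta> t\<bar> \<le> \<eta>" "\<And>t. t \<in> {0..1} \<Longrightarrow> \<bar>(deriv ^^ q) \<zeta> t\<bar> \<le> \<eta>"
  shows "\<bar>moment q e \<zeta> 1\<bar> \<le> \<eta>"
proof -
  have "0 \<le> \<eta>"
    using assms(4)[of 0] by simp
  have "\<bar>\<zeta> t ^ e * ((deriv ^^ q) \<zeta> t)\<^sup>2\<bar> \<le> \<eta>" if t: "t \<in> {0..1}" for t
  proof -
    have "\<bar>\<zeta> t ^ e * ((deriv ^^ q) \<zeta> t)\<^sup>2\<bar> = \<bar>\<zeta> t\<bar> ^ e * \<bar>(deriv ^^ q) \<zeta> t\<bar>\<^sup>2"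
      by (simp add: abs_mult power_abs)
    also have "\<dots> \<le> \<eta> ^ e * \<eta>\<^sup>2"
      using assms t \<open>0 \<le> \<eta>\<close> by (intro mult_mono power_mono) auto
    also have "\<dots> \<le> 1 * \<eta>\<^sup>2"
      using \<open>0 \<le> \<eta>\<close> assms(3) by (intro mult_right_mono power_le_one) auto
    also have "\<dots> \<le> \<eta>"
      using \<open>0 \<le> \<eta>\<close> assms(3) by (simp add: power2_eq_square mult_left_le)
    finally show ?thesis .
  qed
  moreover have "continuous_on {0..1} (\<lambda>t. \<zeta> t ^ e * ((deriv ^^ q) \<zeta> t)\<^sup>2)"
    using diff_upto_continuous[OF assms(1,2)] diff_upto_continuous[OF assms(1), of 0] assms(2)
    by (intro continuous_on_mult continuous_on_power) auto
  ultimately have "norm (integral {0..1} (\<lambda>t. \<zeta> t ^ e * ((deriv ^^ q) \<zeta> t)\<^sup>2)) \<le> \<eta> * (1 - 0)"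
    by (intro integral_bound) auto
  then show ?thesis
    by (simp add: moment_def)
qed

text \<open>
  Plateaus at \<open>0\<close>, \<open>v\<close> and \<open>2 * v\<close> carry the masses \<open>m0\<close>, \<open>m1\<close>, \<open>m2\<close>, each produced by \<open>N\<close> oscillations.
\<close>

lemma reach_plateaus:
  assumes dq: "0 < d" "d \<le> n" "0 < q" "q < n"
    and K: "\<And>t. t \<in> {0..1} \<Longrightarrow> \<bar>(deriv ^^ d) (osc_fun n) t\<bar> \<le> K"
    and Kh: "\<And>t. t \<in> {0..1} \<Longrightarrow> \<bar>(deriv ^^ d) (step_fun n) t\<bar> \<le> Kh" "\<bar>v\<bar> * Kh \<le> r"
    and m: "{m0, m1, m2} \<subseteq> {0..A}" and "0 < N" "A * K\<^sup>2 \<le> r\<^sup>2 * (real N * \<Omega>)" "0 < r"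
    and \<Omega>: "\<Omega> = moment q 0 (osc_fun n) 1" and \<kappa>: "\<kappa> = moment q 2 (osc_fun n) 1 / (real N * \<Omega>\<^sup>2)"
    and H: "H = (\<lambda>e. moment q e (step_fun n) 1)"
  shows "reach n q d r (3 * real N + 2) (2 * v) (m0 + m1 + m2 + 2 * v\<^sup>2 * H 0)
    (v * m1 + 2 * v * m2 + 2 * v ^ 3 * H 1 + v ^ 3 * H 0)
    (v\<^sup>2 * m1 + 4 * v\<^sup>2 * m2 + \<kappa> * (m0\<^sup>2 + m1\<^sup>2 + m2\<^sup>2) + 2 * v ^ 4 * H 2 + 2 * v ^ 4 * H 1 + v ^ 4 * H 0)"
proof -
  have \<Omega>0: "\<Omega> > 0"
    unfolding \<Omega> by (rule osc_moment_0_pos) (use dq in auto)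
  have osc: "reach n q d r (real N) 0 m 0 (\<kappa> * m\<^sup>2)" if "m \<in> {m0, m1, m2}" for m
  proof -
    have m01: "0 \<le> m" "m \<le> A"
      using that m by auto
    \<comment> \<open>This amplitude makes the total mass of \<open>N\<close> oscillations equal to
      \<open>m\<close>. Their second moment is then \<kappa> m^2 with \<kappa> of order
      \<open>1 / N\<close>, and a large \<open>N\<close> also keeps the \<open>d\<close>-th
      derivative below \<open>r\<close>.\<close>
    define \<alpha> where "\<alpha> = sqrt (m / (real N * \<Omega>))"
    have \<alpha>2: "\<alpha>\<^sup>2 = m / (real N * \<Omega>)"
      using m01 \<Omega>0 by (simp add: \<alpha>_def)
    have "(\<bar>\<alpha>\<bar> * K)\<^sup>2 = m * K\<^sup>2 / (real N * \<Omega>)"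
      by (simp add: power_mult_distrib \<alpha>2)
    also have "\<dots> \<le> A * K\<^sup>2 / (real N * \<Omega>)"
      using m01 \<Omega>0 \<open>0 < N\<close> by (intro divide_right_mono mult_right_mono) auto
    also have "\<dots> \<le> r\<^sup>2"
      using assms(10) \<Omega>0 \<open>0 < N\<close> by (simp add: divide_le_eq)
    finally have "\<bar>\<alpha>\<bar> * K \<le> r"
      by (rule power2_le_imp_le) (use \<open>0 < r\<close> in simp)
    from reach_osc_iterate[OF dq K this \<open>0 < N\<close>]
    have "reach n q d r (real N) 0 (real N * (\<alpha>\<^sup>2 * \<Omega>)) 0 (real N * (\<alpha> ^ 4 * moment q 2 (osc_fun n) 1))"
      by (simp add: \<Omega>)
    moreover have "real N * (\<alpha>\<^sup>2 * \<Omega>) = m"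
      using \<Omega>0 \<open>0 < N\<close> by (simp add: \<alpha>2)
    moreover have "real N * (\<alpha> ^ 4 * moment q 2 (osc_fun n) 1) = \<kappa> * m\<^sup>2"
    proof -
      have "\<alpha> ^ 4 = (m / (real N * \<Omega>))\<^sup>2"
        unfolding \<alpha>2[symmetric] by (simp flip: power_mult)
      then show ?thesis
        using \<Omega>0 \<open>0 < N\<close> by (simp add: \<kappa> power2_eq_square field_simps)
    qed
    ultimately show ?thesis by simp
  qed
  have step: "reach n q d r 1 v (v\<^sup>2 * H 0) (v ^ 3 * H 1) (v ^ 4 * H 2)"
    unfolding H by (rule reach_step[OF dq Kh])
  note c = reach_concat[OF _ _ _ _ dq]
  have N: "0 < real N" "0 < real N + 1" "0 < real N + 1 + real N" "0 < real N + 1 + real N + 1"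
    using \<open>0 < N\<close> by auto
  note R = c[OF c[OF c[OF c[OF osc[of m0] step N(1) zero_less_one] osc[of m1] N(2,1)]
      step N(3) zero_less_one] osc[of m2] N(4,1)]
  from R show ?thesis
    by (simp add: algebra_simps eval_nat_numeral)
qed

lemma flat_output_exists:
  assumes "lam \<noteq> 0" "0 < r" "0 < q" "q \<le> d" "d < n"
  obtains T0 \<delta> where "T0 \<ge> T" "T0 > 0" "\<delta> > 0"
    "\<And>y. (\<And>i. i \<in> {1..k + 2} \<Longrightarrow> \<bar>y i\<bar> \<le> \<delta>) \<Longrightarrow> \<exists>\<xi> A B C. flat_path n d r T0 \<xi> \<and>
      moment q 0 \<xi> T0 = A \<and> moment q 1 \<xi> T0 = B \<and> moment q 2 \<xi> T0 = C \<and>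
      (\<forall>l\<le>n. (deriv ^^ l) \<xi> T0 = (if l < k then y (k - l) else 0) - (if l = 0 then lam * A else 0)) \<and>
      y (k + 1) = 2 * B + lam * A\<^sup>2 \<and> y (k + 2) = C + 2 * lam * A * B + 2 / 3 * lam\<^sup>2 * A ^ 3"
proof -
  have dq: "0 < d" "d \<le> n" "0 < q" "q < n"
    using assms by auto
  obtain K where K: "K > 0" "\<And>t. t \<in> {0..1} \<Longrightarrow> \<bar>(deriv ^^ d) (osc_fun n) t\<bar> \<le> K"
    using higher_deriv_bounded[OF diff_upto_osc assms(5)] by auto
  obtain Kh where Kh: "Kh > 0" "\<And>t. t \<in> {0..1} \<Longrightarrow> \<bar>(deriv ^^ d) (step_fun n) t\<bar> \<le> Kh"
    using higher_deriv_bounded[OF diff_upto_step assms(5)] by auto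
  obtain L where L: "L \<ge> 1" and Lb:
    "\<And>y \<delta> l t. (\<And>i. i \<in> {1..k} \<Longrightarrow> \<bar>y i\<bar> \<le> \<delta>) \<Longrightarrow> l \<le> d \<Longrightarrow> t \<in> {0..1} \<Longrightarrow> 0 \<le> \<delta> \<Longrightarrow>
      \<bar>(deriv ^^ l) (corr_fun n k y) t\<bar> \<le> L * \<delta>"
    using corr_fun_bound[OF assms(5), of k] by metis
  define \<Omega> where "\<Omega> = moment q 0 (osc_fun n) 1"
  define \<Omega>4 where "\<Omega>4 = moment q 2 (osc_fun n) 1"
  define H where "H = (\<lambda>e. moment q e (step_fun n) 1)"
  have \<Omega>0: "\<Omega> > 0"
    unfolding \<Omega>_def by (rule osc_moment_0_pos) (use dq in auto)
  have \<Omega>40: "\<Omega>4 \<ge> 0"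
    unfolding \<Omega>4_def moment_def using moment_integrable[OF diff_upto_osc dq(4), of 2]
    by (intro integral_nonneg) auto
  have H: "0 \<le> H e" "H e \<le> H 0" for e
    unfolding H_def using step_moment_bounds dq by auto
  \<comment> \<open>The first entry gives \<open>v\<^sup>2 * H 0 \<le> A / 1000\<close>, since v^2 =
    lam^2 A^2 / 4: the mass gained while stepping between plateaus is negligible. The second keeps
    the \<open>d\<close>-th derivative of a step of height \<open>v\<close> below \<open>r\<close>.
    The end value \<open>2 * v\<close> is -lam A.\<close>
  define A where "A = min (1 / (250 * lam\<^sup>2 * (H 0 + 1))) (2 * r / (\<bar>lam\<bar> * Kh))"
  define v where "v = - lam * A / 2"
  have A0: "A > 0"
    using assms H(1)[of 0] Kh(1) by (simp add: A_def)
  have v0: "v \<noteq> 0"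
    using A0 assms by (simp add: v_def)
  have vKh: "\<bar>v\<bar> * Kh \<le> r"
  proof -
    have "A * (\<bar>lam\<bar> * Kh) \<le> 2 * r"
      using assms Kh(1) by (simp add: A_def flip: pos_le_divide_eq)
    then show ?thesis
      using A0 by (simp add: v_def abs_mult field_simps)
  qed
  have v2: "v\<^sup>2 * H 0 \<le> A / 1000"
  proof -
    have "A * (250 * lam\<^sup>2 * H 0) \<le> A * (250 * lam\<^sup>2 * (H 0 + 1))"
      using A0 by (intro mult_left_mono) auto
    also have "\<dots> \<le> 1"
      using assms H(1)[of 0] by (simp add: A_def flip: pos_le_divide_eq)
    finally have "A * (A * (250 * lam\<^sup>2 * H 0)) \<le> A * 1"
      using A0 by (intro mult_left_mono) simp_all
    then show ?thesis
      by (simp add: v_def power2_eq_square field_simps)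
  qed
  \<comment> \<open>In order: a total duration of at least \<open>T\<close>, an admissible amplitude
    of the oscillations, a relative spread \<kappa> A / v^2 of at most \<open>1/100\<close>, and
    positivity.\<close>
  obtain N where N: "real N \<ge> T" "real N \<ge> A * K\<^sup>2 / (r\<^sup>2 * \<Omega>)" "real N \<ge> 100 * A * \<Omega>4 / (\<Omega>\<^sup>2 * v\<^sup>2)" "real N \<ge> 1"
  proof -
    obtain N where "real N \<ge> max (max T (A * K\<^sup>2 / (r\<^sup>2 * \<Omega>))) (max (100 * A * \<Omega>4 / (\<Omega>\<^sup>2 * v\<^sup>2)) 1)"
      using real_arch_simple by blast
    then show ?thesis by (intro that[of N]) auto
  qed
  have N0: "0 < N"
    using N(4) by auto
  have AK: "A * K\<^sup>2 \<le> r\<^sup>2 * (real N * \<Omega>)"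
    using N(2) \<open>0 < r\<close> \<Omega>0 by (simp add: field_simps)
  define \<kappa> where "\<kappa> = \<Omega>4 / (real N * \<Omega>\<^sup>2)"
  have \<kappa>: "0 \<le> \<kappa> * A / v\<^sup>2" "\<kappa> * A / v\<^sup>2 \<le> 1 / 100"
    using N(3) A0 \<Omega>0 \<Omega>40 v0 N0 by (auto simp: \<kappa>_def field_simps)
  \<comment> \<open>The last two entries come from the coefficients of the correction and target
    terms in the numerators of \<open>e1\<close> and \<open>e2\<close> below, namely at most
    \<open>2 + 2 * \<bar>v\<bar>\<close> and
    \<open>2 + 6 * \<bar>v\<bar> + 4 * v\<^sup>2\<close>.\<close>
  define D where "D = {1, r, A / 1000, \<bar>v\<bar> * A / (1000 * (2 + 2 * \<bar>v\<bar>)),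
    v\<^sup>2 * A / (1000 * (2 + 6 * \<bar>v\<bar> + 4 * v\<^sup>2))}"
  define \<eta> where "\<eta> = Min D"
  have D: "\<eta> \<le> x" if "x \<in> D" for x
    unfolding \<eta>_def using that by (intro Min_le) (auto simp: D_def)
  have pos: "0 < 2 + 2 * \<bar>v\<bar>" "0 < 2 + 6 * \<bar>v\<bar> + 4 * v\<^sup>2"
    by (auto intro: add_pos_nonneg)
  have \<eta>: "0 < \<eta>" "\<eta> \<le> 1" "\<eta> \<le> r" "\<eta> \<le> A / 1000" "\<eta> * (2 + 2 * \<bar>v\<bar>) \<le> \<bar>v\<bar> * A / 1000"
      "\<eta> * (2 + 6 * \<bar>v\<bar> + 4 * v\<^sup>2) \<le> v\<^sup>2 * A / 1000"
  proof -
    have "Min D \<in> D"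
      by (rule Min_in) (auto simp: D_def)
    moreover have "0 < x" if "x \<in> D" for x
      using that v0 A0 \<open>0 < r\<close> pos unfolding D_def by fastforce
    ultimately show "0 < \<eta>"
      by (simp add: \<eta>_def)
    show "\<eta> \<le> 1" "\<eta> \<le> r" "\<eta> \<le> A / 1000"
      by (rule D, simp add: D_def)+
    have "\<eta> \<le> \<bar>v\<bar> * A / (1000 * (2 + 2 * \<bar>v\<bar>))" "\<eta> \<le> v\<^sup>2 * A / (1000 * (2 + 6 * \<bar>v\<bar> + 4 * v\<^sup>2))"
      by (rule D, simp only: D_def insert_iff simp_thms)+
    then show "\<eta> * (2 + 2 * \<bar>v\<bar>) \<le> \<bar>v\<bar> * A / 1000" "\<eta> * (2 + 6 * \<bar>v\<bar> + 4 * v\<^sup>2) \<le> v\<^sup>2 * A / 1000"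
      using pos by (simp_all add: pos_le_divide_eq algebra_simps)
  qed
  show thesis
  \<comment> \<open>The duration consists of three blocks of \<open>N\<close> oscillations, two
    steps of unit length and one unit of time for the correction.\<close>
  proof (rule that[of "3 * real N + 2 + 1" "\<eta> / L"])
    show "T \<le> 3 * real N + 2 + 1" "0 < 3 * real N + 2 + 1" "0 < \<eta> / L"
      using N(1,4) \<eta>(1) L by auto
    fix y :: "nat \<Rightarrow> real"
    assume y: "\<And>i. i \<in> {1..k + 2} \<Longrightarrow> \<bar>y i\<bar> \<le> \<eta> / L"
    define \<zeta> where "\<zeta> = corr_fun n k y"
    have \<zeta>b: "\<bar>(deriv ^^ l) \<zeta> t\<bar> \<le> \<eta>" if "l \<le> d" "t \<in> {0..1}" for l t
    proof -
      have "\<bar>(deriv ^^ l) \<zeta> t\<bar> \<le> L * (\<eta> / L)"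
        unfolding \<zeta>_def using \<eta>(1) L by (intro Lb y that) auto
      then show ?thesis
        using L by simp
    qed
    have d\<zeta>: "diff_upto n \<zeta>"
      unfolding \<zeta>_def by (rule diff_upto_corr)
    define c where "c = (\<lambda>e. moment q e \<zeta> 1)"
    have c: "\<bar>c e\<bar> \<le> \<eta>" for e
      unfolding c_def using \<zeta>b[of 0] \<zeta>b[of q] assms \<eta>(2) by (intro moment_bound[OF d\<zeta> dq(4)]) auto
    have p\<zeta>: "flat_path n d r 1 \<zeta>"
      unfolding flat_path_def
    proof (intro conjI allI impI ballI d\<zeta>)
      show "\<bar>(deriv ^^ d) \<zeta> t\<bar> \<le> r" if "t \<in> {0..1}" for t
        using \<zeta>b[of d t] that \<eta>(3) by simp
    qed (simp add: \<zeta>_def corr_fun_left)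
    have y12: "\<bar>y (k + 1)\<bar> \<le> \<eta>" "\<bar>y (k + 2)\<bar> \<le> \<eta>"
    proof -
      have "\<eta> / L \<le> \<eta>"
        using L \<eta>(1) by (simp add: divide_le_eq mult_le_cancel_left1)
      then show "\<bar>y (k + 1)\<bar> \<le> \<eta>" "\<bar>y (k + 2)\<bar> \<le> \<eta>"
        using y[of "k + 1"] y[of "k + 2"] by auto
    qed
    \<comment> \<open>Relative errors of the three moments, collecting what the steps
      (\<open>H\<close>), the final correction around the value \<open>2 * v\<close>
      (\<open>c\<close>) and the target (\<open>y\<close>) contribute.\<close>
    define e0 where "e0 = (2 * v\<^sup>2 * H 0 + c 0) / A"
    define e1 where "e1 = (2 * v ^ 3 * H 1 + v ^ 3 * H 0 + c 1 + 2 * v * c 0 - y (k + 1) / 2) / (v * A)"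
    define e2 where "e2 = (2 * v ^ 4 * H 2 + 2 * v ^ 4 * H 1 + v ^ 4 * H 0 +
      c 2 + 4 * v * c 1 + 4 * v\<^sup>2 * c 0 - y (k + 2) - 2 * v * y (k + 1)) / (v\<^sup>2 * A)"
    have vH: "v\<^sup>2 * H e \<le> A / 1000" "0 \<le> v\<^sup>2 * H e" for e
      using mult_left_mono[OF H(2)[of e], of "v\<^sup>2"] v2 H(1)[of e] by auto
    have "\<bar>2 * v\<^sup>2 * H 0 + c 0\<bar> \<le> A / 100"
      using vH[of 0] c[of 0] \<eta>(4) unfolding mult.assoc by linarith
    then have e0: "\<bar>e0\<bar> \<le> 1 / 100"
      using A0 by (simp add: e0_def divide_le_eq)
    have vc: "\<bar>v * c e\<bar> \<le> \<bar>v\<bar> * \<eta>" "\<bar>v\<^sup>2 * c e\<bar> \<le> v\<^sup>2 * \<eta>" "\<bar>v * y (k + 1)\<bar> \<le> \<bar>v\<bar> * \<eta>" for e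
      using c[of e] y12 by (auto simp: abs_mult intro: mult_left_mono)
    have "\<bar>2 * v ^ 3 * H 1 + v ^ 3 * H 0 + c 1 + 2 * v * c 0 - y (k + 1) / 2\<bar> \<le> \<bar>v\<bar> * A / 100"
    proof -
      have "\<bar>v ^ 3 * H e\<bar> \<le> \<bar>v\<bar> * (A / 1000)" for e
      proof -
        have "\<bar>v ^ 3 * H e\<bar> = \<bar>v\<bar> * (v\<^sup>2 * H e)"
          using H(1)[of e] by (simp add: abs_mult power3_eq_cube power2_eq_square)
        also have "\<dots> \<le> \<bar>v\<bar> * (A / 1000)"
          by (intro mult_left_mono vH) auto
        finally show ?thesis .
      qed
      from this[of 0] this[of 1] vc(1)[of 0] c[of 1] y12(1) \<eta>(5) \<eta>(1) show ?thesis
        unfolding abs_le_iff by (simp add: algebra_simps)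
    qed
    then have e1: "\<bar>e1\<bar> \<le> 1 / 100"
      using A0 v0 by (simp add: e1_def abs_mult divide_le_eq)
    have "\<bar>2 * v ^ 4 * H 2 + 2 * v ^ 4 * H 1 + v ^ 4 * H 0 +
      c 2 + 4 * v * c 1 + 4 * v\<^sup>2 * c 0 - y (k + 2) - 2 * v * y (k + 1)\<bar> \<le> v\<^sup>2 * A / 100"
    proof -
      have "\<bar>v ^ 4 * H e\<bar> \<le> v\<^sup>2 * (A / 1000)" for e
      proof -
        have "\<bar>v ^ 4 * H e\<bar> = v\<^sup>2 * (v\<^sup>2 * H e)"
          using H(1)[of e] by (simp add: abs_mult eval_nat_numeral)
        also have "\<dots> \<le> v\<^sup>2 * (A / 1000)"
          by (intro mult_left_mono vH) auto
        finally show ?thesis .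
      qed
      from this[of 0] this[of 1] this[of 2] vc(1)[of 1] vc(2)[of 0] vc(3) c[of 2] y12(2) \<eta>(6) \<eta>(1)
      show ?thesis
        unfolding abs_le_iff by (simp add: algebra_simps)
    qed
    then have e2: "\<bar>e2\<bar> \<le> 1 / 100"
      using A0 v0 by (simp add: e2_def abs_mult divide_le_eq)
    obtain b0 b1 b2 where b: "{b0, b1, b2} \<subseteq> {0..1}" "b0 + b1 + b2 = 1 - e0" "b1 + 2 * b2 = 1 - e1"
        "b1 + 4 * b2 + \<kappa> * A / v\<^sup>2 * (b0\<^sup>2 + b1\<^sup>2 + b2\<^sup>2) = 4 / 3 - e2"
      using mass_distribution_exists[OF e0 e1 e2 \<kappa>] by metis
    have m: "{A * b0, A * b1, A * b2} \<subseteq> {0..A}"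
      using b(1) A0 by (auto simp: mult_left_le)
    from reach_plateaus[OF dq K(2) Kh(2) vKh m N0 AK \<open>0 < r\<close> \<Omega>_def \<kappa>_def[unfolded \<Omega>4_def] H_def]
    obtain \<xi>1 where \<xi>1: "flat_path n d r (3 * real N + 2) \<xi>1" "\<And>t. t \<ge> 3 * real N + 2 \<Longrightarrow> \<xi>1 t = 2 * v"
      and M0: "moment q 0 \<xi>1 (3 * real N + 2) = A * b0 + A * b1 + A * b2 + 2 * v\<^sup>2 * H 0"
      and M1: "moment q 1 \<xi>1 (3 * real N + 2) =
        v * (A * b1) + 2 * v * (A * b2) + 2 * v ^ 3 * H 1 + v ^ 3 * H 0"
      and M2: "moment q 2 \<xi>1 (3 * real N + 2) = v\<^sup>2 * (A * b1) + 4 * v\<^sup>2 * (A * b2) +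
        \<kappa> * ((A * b0)\<^sup>2 + (A * b1)\<^sup>2 + (A * b2)\<^sup>2) + 2 * v ^ 4 * H 2 + 2 * v ^ 4 * H 1 + v ^ 4 * H 0"
      unfolding reach_def by blast
    define \<xi> where "\<xi> = (\<lambda>t. \<xi>1 t + \<zeta> (t - (3 * real N + 2)))"
    have T1: "0 < 3 * real N + 2"
      by simp
    note concat = \<xi>1 p\<zeta> T1 zero_less_one dq \<xi>_def
    show "\<exists>\<xi> A B C. flat_path n d r (3 * real N + 2 + 1) \<xi> \<and>
      moment q 0 \<xi> (3 * real N + 2 + 1) = A \<and> moment q 1 \<xi> (3 * real N + 2 + 1) = B \<and>
      moment q 2 \<xi> (3 * real N + 2 + 1) = C \<and>
      (\<forall>l\<le>n. (deriv ^^ l) \<xi> (3 * real N + 2 + 1) =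
        (if l < k then y (k - l) else 0) - (if l = 0 then lam * A else 0)) \<and>
      y (k + 1) = 2 * B + lam * A\<^sup>2 \<and> y (k + 2) = C + 2 * lam * A * B + 2 / 3 * lam\<^sup>2 * A ^ 3"
    proof (intro exI conjI allI impI)
      show "flat_path n d r (3 * real N + 2 + 1) \<xi>"
        by (rule flat_path_concat[OF concat])
      show "moment q 0 \<xi> (3 * real N + 2 + 1) = A"
      proof -
        have "A * (b0 + b1 + b2) = A - (2 * v\<^sup>2 * H 0 + c 0)"
          using A0 unfolding b(2) by (simp add: e0_def right_diff_distrib)
        moreover have "moment q 0 \<xi> (3 * real N + 2 + 1) = moment q 0 \<xi>1 (3 * real N + 2) + c 0"
          unfolding c_def by (rule moment_concat_0[OF concat])
        ultimately show ?thesis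
          unfolding M0 by (simp add: algebra_simps)
      qed
      \<comment> \<open>The values claimed for \<open>B\<close> here and for \<open>C\<close> below
        are obtained by solving the two final equations with lam A = -2 v.\<close>
      show "moment q 1 \<xi> (3 * real N + 2 + 1) = y (k + 1) / 2 + v * A"
      proof -
        have "v * A * (b1 + 2 * b2) = v * A -
            (2 * v ^ 3 * H 1 + v ^ 3 * H 0 + c 1 + 2 * v * c 0 - y (k + 1) / 2)"
        proof -
          have "v * A * e1 = 2 * v ^ 3 * H 1 + v ^ 3 * H 0 + c 1 + 2 * v * c 0 - y (k + 1) / 2"
            unfolding e1_def using A0 v0 by simp
          then show ?thesis
            unfolding b(3) right_diff_distrib by simp
        qed
        moreover have "moment q 1 \<xi> (3 * real N + 2 + 1) =
            moment q 1 \<xi>1 (3 * real N + 2) + c 1 + 2 * v * c 0"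
          unfolding c_def by (rule moment_concat_1[OF concat])
        ultimately show ?thesis
          unfolding M1 by (simp add: algebra_simps)
      qed
      show "moment q 2 \<xi> (3 * real N + 2 + 1) = y (k + 2) + 2 * v * y (k + 1) + 4 / 3 * v\<^sup>2 * A"
      proof -
        have "v\<^sup>2 * A * (b1 + 4 * b2) + \<kappa> * A\<^sup>2 * (b0\<^sup>2 + b1\<^sup>2 + b2\<^sup>2) =
            v\<^sup>2 * A * (b1 + 4 * b2 + \<kappa> * A / v\<^sup>2 * (b0\<^sup>2 + b1\<^sup>2 + b2\<^sup>2))"
          using v0 by (simp add: field_simps power2_eq_square)
        also have "\<dots> = 4 / 3 * (v\<^sup>2 * A) - (2 * v ^ 4 * H 2 + 2 * v ^ 4 * H 1 + v ^ 4 * H 0 +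
            c 2 + 4 * v * c 1 + 4 * v\<^sup>2 * c 0 - y (k + 2) - 2 * v * y (k + 1))"
        proof -
          have "v\<^sup>2 * A * e2 = 2 * v ^ 4 * H 2 + 2 * v ^ 4 * H 1 + v ^ 4 * H 0 +
              c 2 + 4 * v * c 1 + 4 * v\<^sup>2 * c 0 - y (k + 2) - 2 * v * y (k + 1)"
            unfolding e2_def using A0 v0 by simp
          then show ?thesis
            unfolding b(4) right_diff_distrib by simp
        qed
        finally have "v\<^sup>2 * A * (b1 + 4 * b2) + \<kappa> * A\<^sup>2 * (b0\<^sup>2 + b1\<^sup>2 + b2\<^sup>2) =
            4 / 3 * (v\<^sup>2 * A) - (2 * v ^ 4 * H 2 + 2 * v ^ 4 * H 1 + v ^ 4 * H 0 +
            c 2 + 4 * v * c 1 + 4 * v\<^sup>2 * c 0 - y (k + 2) - 2 * v * y (k + 1))" .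
        moreover have "moment q 2 \<xi> (3 * real N + 2 + 1) =
            moment q 2 \<xi>1 (3 * real N + 2) + c 2 + 2 * (2 * v) * c 1 + (2 * v)\<^sup>2 * c 0"
          unfolding c_def by (rule moment_concat_2[OF concat])
        ultimately show ?thesis
          unfolding M2 by (simp add: algebra_simps power_mult_distrib)
      qed
      show "(deriv ^^ l) \<xi> (3 * real N + 2 + 1) =
          (if l < k then y (k - l) else 0) - (if l = 0 then lam * A else 0)" if "l \<le> n" for l
      proof -
        have "(deriv ^^ l) \<xi> (3 * real N + 2 + 1) = (if l = 0 then 2 * v else 0) + (deriv ^^ l) \<zeta> 1"
          using that by (intro higher_deriv_concat[OF concat]) auto
        also have "(deriv ^^ l) \<zeta> 1 = (if l < k then y (k - l) else 0)"
          unfolding \<zeta>_def by (rule corr_fun_jet[OF that])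
        finally show ?thesis
          by (auto simp: v_def)
      qed
      show "y (k + 1) = 2 * (y (k + 1) / 2 + v * A) + lam * A\<^sup>2"
        by (simp add: v_def power2_eq_square)
      show "y (k + 2) = y (k + 2) + 2 * v * y (k + 1) + 4 / 3 * v\<^sup>2 * A +
          2 * lam * A * (y (k + 1) / 2 + v * A) + 2 / 3 * lam\<^sup>2 * A ^ 3"
        by (simp add: v_def power2_eq_square power3_eq_cube field_simps)
    qed
  qed
qed

section \<open>Dilation to arbitrary times\<close>

text \<open>The moment of order \<open>e\<close> scales with exponent d e + 2 (d - q) + 1, where the
  last \<open>1\<close> comes from \<open>dt\<close>. The relation \<open>d + 1 = 2 * q\<close>
  turns this into d (e + 1), so the mass scales exactly like \<xi>.\<close>

lemma
  assumes p: "flat_path n d r T0 \<xi>" and "0 < \<tau>" "d \<le> n"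
    and \<xi>': "\<xi>' = (\<lambda>t. \<tau> ^ d * \<xi> (t / \<tau>))"
  shows flat_path_scale: "flat_path n d r (\<tau> * T0) \<xi>'"
    and higher_deriv_scale: "l \<le> n \<Longrightarrow> (deriv ^^ l) \<xi>' t = \<tau> ^ d / \<tau> ^ l * (deriv ^^ l) \<xi> (t / \<tau>)"
    and moment_scale: "q < n \<Longrightarrow> d + 1 = 2 * q \<Longrightarrow> 0 \<le> T0 \<Longrightarrow>
      moment q e \<xi>' (\<tau> * T0) = \<tau> ^ (d * (e + 1)) * moment q e \<xi> T0"
proof -
  have d\<xi>: "diff_upto n \<xi>"
    using p by (simp add: flat_path_def)
  have \<xi>'_affine: "\<xi>' = (\<lambda>t. \<tau> ^ d * \<xi> (1 / \<tau> * t + 0))"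
    by (simp add: \<xi>')
  have d\<xi>': "diff_upto n \<xi>'"
    unfolding \<xi>'_affine by (intro diff_upto_cmult diff_upto_affine d\<xi>)
  have deriv: "(deriv ^^ l) \<xi>' t = \<tau> ^ d / \<tau> ^ l * (deriv ^^ l) \<xi> (t / \<tau>)" if "l \<le> n" for l t
    unfolding \<xi>'_affine higher_deriv_cmult[OF diff_upto_affine[OF d\<xi>] that]
      higher_deriv_affine[OF d\<xi> that] by (simp add: power_divide)
  then show "(deriv ^^ l) \<xi>' t = \<tau> ^ d / \<tau> ^ l * (deriv ^^ l) \<xi> (t / \<tau>)" if "l \<le> n"
    using that by blast
  have range: "t / \<tau> \<in> {0..T0}" if "t \<in> {0..\<tau> * T0}" for t
    using that \<open>0 < \<tau>\<close> by (auto simp: divide_le_eq mult.commute)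
  show "flat_path n d r (\<tau> * T0) \<xi>'"
    unfolding flat_path_def
  proof (intro conjI allI impI ballI d\<xi>')
    show "\<xi>' t = 0" if "t \<le> 0" for t
      using p that \<open>0 < \<tau>\<close> by (simp add: \<xi>' flat_path_def divide_le_0_iff)
    show "\<bar>(deriv ^^ d) \<xi>' t\<bar> \<le> r" if "t \<in> {0..\<tau> * T0}" for t
      using p range[OF that] \<open>0 < \<tau>\<close> by (simp add: deriv[OF \<open>d \<le> n\<close>] flat_path_def)
  qed
  show "moment q e \<xi>' (\<tau> * T0) = \<tau> ^ (d * (e + 1)) * moment q e \<xi> T0"
    if "q < n" "d + 1 = 2 * q" "0 \<le> T0"
  proof -
    let ?f = "\<lambda>t. \<xi> t ^ e * ((deriv ^^ q) \<xi> t)\<^sup>2"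
    have "((\<lambda>t. ?f (1 / \<tau> * t)) has_integral (1 / \<bar>1 / \<tau>\<bar>) *\<^sub>R moment q e \<xi> T0) ((\<lambda>t. t / (1 / \<tau>)) ` {0..T0})"
      unfolding moment_def using \<open>0 < \<tau>\<close>
      by (intro has_integral_stretch_real integrable_integral moment_integrable[OF d\<xi> \<open>q < n\<close>]) auto
    moreover have "(\<lambda>t. t / (1 / \<tau>)) ` {0..T0} = {0..\<tau> * T0}"
      using \<open>0 < \<tau>\<close> \<open>0 \<le> T0\<close> image_mult_atLeastAtMost[of \<tau> 0 T0] by (simp add: mult.commute)
    ultimately have I: "((\<lambda>t. ?f (t / \<tau>)) has_integral \<tau> * moment q e \<xi> T0) {0..\<tau> * T0}"
      using \<open>0 < \<tau>\<close> by simp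
    have eq: "\<xi>' t ^ e * ((deriv ^^ q) \<xi>' t)\<^sup>2 = \<tau> ^ (d * e) * (\<tau> ^ d / \<tau> ^ q)\<^sup>2 * ?f (t / \<tau>)" for t
    proof -
      have "\<xi>' t = \<tau> ^ d * \<xi> (t / \<tau>)"
        by (simp only: \<xi>')
      then show ?thesis
        using deriv[of q t] \<open>q < n\<close> by (simp add: power_mult_distrib power_mult power_divide)
    qed
    have "moment q e \<xi>' (\<tau> * T0) = \<tau> ^ (d * e) * (\<tau> ^ d / \<tau> ^ q)\<^sup>2 * (\<tau> * moment q e \<xi> T0)"
    proof -
      have "((\<lambda>t. \<xi>' t ^ e * ((deriv ^^ q) \<xi>' t)\<^sup>2) has_integral
          \<tau> ^ (d * e) * (\<tau> ^ d / \<tau> ^ q)\<^sup>2 * (\<tau> * moment q e \<xi> T0)) {0..\<tau> * T0}"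
        unfolding eq by (rule has_integral_mult_right[OF I])
      then show ?thesis
        unfolding moment_def[of q e \<xi>'] by (rule integral_unique)
    qed
    also have "\<dots> = \<tau> ^ (d * e) * ((\<tau> ^ d / \<tau> ^ q)\<^sup>2 * \<tau>) * moment q e \<xi> T0"
      by simp
    also have "(\<tau> ^ d / \<tau> ^ q)\<^sup>2 * \<tau> = \<tau> ^ d"
    proof -
      have "\<tau> ^ d * \<tau> = (\<tau> ^ q)\<^sup>2"
        using that(2) by (metis power_Suc2 Suc_eq_plus1 power_mult mult.commute)
      then have "(\<tau> ^ d / \<tau> ^ q)\<^sup>2 * \<tau> * (\<tau> ^ q)\<^sup>2 = \<tau> ^ d * (\<tau> ^ q)\<^sup>2"
        using \<open>0 < \<tau>\<close> by (simp add: power_divide) (simp add: power2_eq_square)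
      then show ?thesis
        using \<open>0 < \<tau>\<close> by simp
    qed
    finally show ?thesis
      by (simp add: power_add)
  qed
qed

text \<open>
  The weights in \<open>y'\<close> are those of the dilation \<open>t \<mapsto> \<tau> * t\<close> that leaves the system and the bound on the
  \<open>d\<close>-th derivative invariant.
\<close>

lemma flat_output_exists_any_time:
  assumes "lam \<noteq> 0" "0 < r" "0 < q" "d + 1 = 2 * q" "d < n" "0 < T" "k \<le> d + 1"
  shows "\<exists>\<delta>>0. \<forall>y. (\<forall>i\<in>{1..k + 2}. \<bar>y i\<bar> \<le> \<delta>) \<longrightarrow> (\<exists>\<xi> A B C. flat_path n d r T \<xi> \<and>
      moment q 0 \<xi> T = A \<and> moment q 1 \<xi> T = B \<and> moment q 2 \<xi> T = C \<and>
      (\<forall>l\<le>n. (deriv ^^ l) \<xi> T = (if l < k then y (k - l) else 0) - (if l = 0 then lam * A else 0)) \<and>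
      y (k + 1) = 2 * B + lam * A\<^sup>2 \<and> y (k + 2) = C + 2 * lam * A * B + 2 / 3 * lam\<^sup>2 * A ^ 3)"
proof -
  have qd: "q \<le> d"
    using assms by simp
  obtain T0 \<delta> where T0: "T0 \<ge> T" "T0 > 0" and "\<delta> > 0" and
    flat: "\<And>y. (\<And>i. i \<in> {1..k + 2} \<Longrightarrow> \<bar>y i\<bar> \<le> \<delta>) \<Longrightarrow> \<exists>\<xi> A B C. flat_path n d r T0 \<xi> \<and>
      moment q 0 \<xi> T0 = A \<and> moment q 1 \<xi> T0 = B \<and> moment q 2 \<xi> T0 = C \<and>
      (\<forall>l\<le>n. (deriv ^^ l) \<xi> T0 = (if l < k then y (k - l) else 0) - (if l = 0 then lam * A else 0)) \<and>
      y (k + 1) = 2 * B + lam * A\<^sup>2 \<and> y (k + 2) = C + 2 * lam * A * B + 2 / 3 * lam\<^sup>2 * A ^ 3"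
    using flat_output_exists[OF assms(1,2,3) qd assms(5), of T k] by metis
  define \<tau> where "\<tau> = T / T0"
  have \<tau>: "0 < \<tau>" "\<tau> \<le> 1" "\<tau> * T0 = T"
    using T0 \<open>0 < T\<close> by (auto simp: \<tau>_def)
  show ?thesis
  proof (intro exI[of _ "\<delta> * \<tau> ^ (3 * d)"] conjI allI impI)
    show "0 < \<delta> * \<tau> ^ (3 * d)"
      using \<tau> \<open>0 < \<delta>\<close> by simp
    fix y :: "nat \<Rightarrow> real"
    assume y: "\<forall>i\<in>{1..k + 2}. \<bar>y i\<bar> \<le> \<delta> * \<tau> ^ (3 * d)"
    \<comment> \<open>For \<open>i \<ge> 1\<close> the subtraction is not truncated because
      \<open>k \<le> d + 1\<close>; in the application this is the hypothesis
      \<open>k \<ge> 2 * j\<close>. All weights are at most \<open>3 * d\<close>, which gives the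
      common radius.\<close>
    define w where "w i = (if i \<le> k then i + d - k else if i = k + 1 then 2 * d else 3 * d)" for i
    define y' where "y' i = y i / \<tau> ^ w i" for i
    have y': "\<bar>y' i\<bar> \<le> \<delta>" if "i \<in> {1..k + 2}" for i
    proof -
      have "w i \<le> 3 * d"
        using that by (auto simp: w_def)
      then have "\<tau> ^ (3 * d) \<le> \<tau> ^ w i"
        using \<tau> by (intro power_decreasing) auto
      then have "\<bar>y i\<bar> \<le> \<delta> * \<tau> ^ w i"
        using bspec[OF y that] \<open>0 < \<delta>\<close> mult_left_mono[of "\<tau> ^ (3 * d)" "\<tau> ^ w i" \<delta>] by linarith
      then show ?thesis
        using \<tau> by (simp add: y'_def divide_le_eq)
    qed
    from flat[of y', OF y'] obtain \<xi> A B C where p: "flat_path n d r T0 \<xi>"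
      and m: "moment q 0 \<xi> T0 = A" "moment q 1 \<xi> T0 = B" "moment q 2 \<xi> T0 = C"
      and jet: "\<And>l. l \<le> n \<Longrightarrow> (deriv ^^ l) \<xi> T0 =
        (if l < k then y' (k - l) else 0) - (if l = 0 then lam * A else 0)"
      and eqs: "y' (k + 1) = 2 * B + lam * A\<^sup>2" "y' (k + 2) = C + 2 * lam * A * B + 2 / 3 * lam\<^sup>2 * A ^ 3"
      by blast
    define \<xi>' where "\<xi>' = (\<lambda>t. \<tau> ^ d * \<xi> (t / \<tau>))"
    note scale = p \<tau>(1) less_imp_le[OF assms(5)] \<xi>'_def
    have qn: "q < n"
      using qd assms by simp
    show "\<exists>\<xi> A B C. flat_path n d r T \<xi> \<and>
      moment q 0 \<xi> T = A \<and> moment q 1 \<xi> T = B \<and> moment q 2 \<xi> T = C \<and>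
      (\<forall>l\<le>n. (deriv ^^ l) \<xi> T = (if l < k then y (k - l) else 0) - (if l = 0 then lam * A else 0)) \<and>
      y (k + 1) = 2 * B + lam * A\<^sup>2 \<and> y (k + 2) = C + 2 * lam * A * B + 2 / 3 * lam\<^sup>2 * A ^ 3"
    proof (intro exI conjI allI impI)
      show "flat_path n d r T \<xi>'"
        using flat_path_scale[OF scale] \<tau>(3) by simp
      show "moment q 0 \<xi>' T = \<tau> ^ d * A" "moment q 1 \<xi>' T = \<tau> ^ (2 * d) * B"
          "moment q 2 \<xi>' T = \<tau> ^ (3 * d) * C"
        using moment_scale[OF scale qn assms(4), of 0] moment_scale[OF scale qn assms(4), of 1]
          moment_scale[OF scale qn assms(4), of 2] m T0(2) \<tau>(3) by (simp_all add: mult.commute mult_2_right)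
      show "(deriv ^^ l) \<xi>' T = (if l < k then y (k - l) else 0) - (if l = 0 then lam * (\<tau> ^ d * A) else 0)"
        if "l \<le> n" for l
      proof -
        have "(deriv ^^ l) \<xi>' T = \<tau> ^ d / \<tau> ^ l * (deriv ^^ l) \<xi> T0"
        proof -
          have "T / \<tau> = T0"
            using \<tau>(1) by (simp flip: \<tau>(3))
          then show ?thesis
            using higher_deriv_scale[OF scale that, of T] by simp
        qed
        also have "\<dots> = (if l < k then y (k - l) else 0) - (if l = 0 then lam * (\<tau> ^ d * A) else 0)"
        proof (cases "l < k")
          case True
          then have w: "w (k - l) + l = d"
            using assms(7) by (auto simp: w_def)
          then have "\<tau> ^ d / \<tau> ^ l = \<tau> ^ w (k - l)"
            using \<tau>(1) by (metis nonzero_mult_div_cancel_right power_add power_not_zero less_irrefl)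
          then show ?thesis
            using True w \<tau>(1) by (auto simp: jet[OF that] y'_def right_diff_distrib)
        next
          case False
          then show ?thesis
            by (simp add: jet[OF that])
        qed
        finally show ?thesis .
      qed
      have "y (k + 1) = \<tau> ^ (2 * d) * (2 * B + lam * A\<^sup>2)"
        unfolding eqs(1)[symmetric] using \<tau>(1) by (simp add: y'_def w_def)
      then show "y (k + 1) = 2 * (\<tau> ^ (2 * d) * B) + lam * (\<tau> ^ d * A)\<^sup>2"
        by (simp add: algebra_simps power_mult_distrib flip: power_mult)
      have "y (k + 2) = \<tau> ^ (3 * d) * (C + 2 * lam * A * B + 2 / 3 * lam\<^sup>2 * A ^ 3)"
        unfolding eqs(2)[symmetric] using \<tau>(1) by (simp add: y'_def w_def)
      moreover have "\<tau> ^ d * \<tau> ^ (2 * d) = \<tau> ^ (3 * d)" "(\<tau> ^ d) ^ 3 = \<tau> ^ (3 * d)"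
        by (simp_all add: mult.commute flip: power_add power_mult)
      ultimately show "y (k + 2) = \<tau> ^ (3 * d) * C + 2 * lam * (\<tau> ^ d * A) * (\<tau> ^ (2 * d) * B) +
          2 / 3 * lam\<^sup>2 * (\<tau> ^ d * A) ^ 3"
        by (simp add: algebra_simps power_mult_distrib)
    qed
  qed
qed

section \<open>Sobolev norms\<close>

lemma test_function_deriv:
  assumes "test_function T \<phi>"
  shows "test_function T (deriv \<phi>)"
proof -
  obtain a b where ab: "0 < a" "b < T" "\<And>t. t \<notin> {a..b} \<Longrightarrow> \<phi> t = 0"
    using assms by (auto simp: test_function_def)
  have "deriv \<phi> t = 0" if "t \<notin> {a..b}" for t
  proof (rule DERIV_imp_deriv)
    show "(\<phi> has_real_derivative 0) (at t)"
      by (rule has_field_derivative_transform_within_open[where f = "\<lambda>t. 0" and S = "- {a..b}"])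
        (use that ab(3) in \<open>auto simp: open_Compl\<close>)
  qed
  moreover have "(deriv ^^ i) (deriv \<phi>) differentiable_on UNIV" for i
    using assms[unfolded test_function_def, THEN conjunct1, rule_format, of "Suc i"]
    by (simp only: funpow_Suc_right o_apply)
  ultimately show ?thesis
    unfolding test_function_def using ab by blast
qed

lemma test_function_diff_upto: "test_function T \<phi> \<Longrightarrow> diff_upto n \<phi>"
  unfolding test_function_def diff_upto_def differentiable_on_def
  by (auto simp: DERIV_deriv_iff_real_differentiable)

lemma continuous_absolutely_integrable_open:
  fixes f :: "real \<Rightarrow> real"
  assumes "continuous_on {0..T} f"
  shows "f absolutely_integrable_on {0<..<T}"
  by (rule set_integrable_subset[OF absolutely_integrable_continuous_real[OF assms]]) auto

text \<open>Derivatives pass from the test function to \<open>u\<close> one at a time, without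
  boundary terms because the support lies inside \<open>(0,T)\<close>. The induction varies \<phi>,
  which is replaced by its derivative.\<close>

lemma weak_deriv_classical:
  assumes "diff_upto n u" "i < n" "0 < T"
  shows "weak_deriv T i u ((deriv ^^ i) u)"
proof -
  have "integral {0<..<T} (\<lambda>t. u t * (deriv ^^ i) \<phi> t) =
      (-1) ^ i * integral {0<..<T} (\<lambda>t. (deriv ^^ i) u t * \<phi> t)" if "test_function T \<phi>" for \<phi>
    using that \<open>i < n\<close>
  proof (induction i arbitrary: \<phi>)
    case (Suc i)
    have \<phi>: "diff_upto 2 \<phi>"
      using Suc.prems(1) by (rule test_function_diff_upto)
    have ends: "\<phi> 0 = 0" "\<phi> T = 0"
      using Suc.prems(1) by (auto simp: test_function_def)
    let ?v = "(deriv ^^ i) u" and ?v' = "(deriv ^^ Suc i) u"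
    have cont: "continuous_on {0..T} ?v" "continuous_on {0..T} ?v'"
        "continuous_on {0..T} \<phi>" "continuous_on {0..T} (deriv \<phi>)"
      using diff_upto_continuous[OF assms(1) Suc.prems(2)] diff_upto_continuous[OF assms(1) Suc_lessD[OF Suc.prems(2)]]
        diff_upto_continuous[OF \<phi>, of 0] diff_upto_continuous[OF \<phi>, of 1] by simp_all
    have "((\<lambda>t. ?v t * deriv \<phi> t + ?v' t * \<phi> t) has_integral ?v T * \<phi> T - ?v 0 * \<phi> 0) {0..T}"
    proof (rule fundamental_theorem_of_calculus)
      fix t
      have v: "(?v has_real_derivative ?v' t) (at t)"
        by (rule diff_uptoD[OF assms(1)]) (use Suc.prems(2) in simp)
      have "(\<phi> has_real_derivative deriv \<phi> t) (at t)"
        using diff_uptoD[OF \<phi>, of 0 t] by simp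
      from DERIV_mult[OF v this]
      have "((\<lambda>t. ?v t * \<phi> t) has_real_derivative ?v t * deriv \<phi> t + ?v' t * \<phi> t) (at t)"
        by (simp add: algebra_simps)
      then show "((\<lambda>t. ?v t * \<phi> t) has_vector_derivative ?v t * deriv \<phi> t + ?v' t * \<phi> t) (at t within {0..T})"
        by (simp add: has_real_derivative_iff_has_vector_derivative has_vector_derivative_at_within)
    qed (use \<open>0 < T\<close> in simp)
    then have "integral {0..T} (\<lambda>t. ?v t * deriv \<phi> t + ?v' t * \<phi> t) = 0"
      unfolding ends by (simp add: integral_unique)
    moreover have "integral {0..T} (\<lambda>t. ?v t * deriv \<phi> t + ?v' t * \<phi> t) =
        integral {0..T} (\<lambda>t. ?v t * deriv \<phi> t) + integral {0..T} (\<lambda>t. ?v' t * \<phi> t)"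
      by (intro Henstock_Kurzweil_Integration.integral_add integrable_continuous_interval continuous_on_mult cont)
    ultimately have parts: "integral {0<..<T} (\<lambda>t. ?v t * deriv \<phi> t) = - integral {0<..<T} (\<lambda>t. ?v' t * \<phi> t)"
      unfolding integral_open_interval_real[symmetric] by linarith
    have "integral {0<..<T} (\<lambda>t. u t * (deriv ^^ Suc i) \<phi> t) =
        integral {0<..<T} (\<lambda>t. u t * (deriv ^^ i) (deriv \<phi>) t)"
      by (simp only: funpow_Suc_right o_apply)
    also have "\<dots> = (-1) ^ i * integral {0<..<T} (\<lambda>t. ?v t * deriv \<phi> t)"
      using Suc.prems(2) by (intro Suc.IH test_function_deriv Suc.prems(1)) simp
    finally show ?case
      unfolding parts by simp
  qed simp
  moreover have "continuous_on {0..T} u" "continuous_on {0..T} ((deriv ^^ i) u)"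
    using diff_upto_continuous[OF assms(1), of 0] diff_upto_continuous[OF assms(1,2)] \<open>i < n\<close> by auto
  ultimately show ?thesis
    unfolding weak_deriv_def by (blast intro: continuous_absolutely_integrable_open)
qed

lemma Linf_norm_le:
  assumes "continuous_on {0..T} v" "\<And>t. t \<in> {0..T} \<Longrightarrow> \<bar>v t\<bar> \<le> c"
  shows "Linf_norm T v \<le> ereal c"
  unfolding Linf_norm_def
proof (rule esssup_I)
  have "continuous_on {0<..<T} v"
    by (rule continuous_on_subset[OF assms(1)]) auto
  then have "v \<in> borel_measurable (lebesgue_on {0<..<T})"
    by (rule continuous_imp_measurable_on_sets_lebesgue) auto
  then show "(\<lambda>t. ereal \<bar>v t\<bar>) \<in> borel_measurable (lebesgue_on {0<..<T})"
    by measurable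
  show "AE t in lebesgue_on {0<..<T}. ereal \<bar>v t\<bar> \<le> ereal c"
    using assms(2) by (intro AE_I2) auto
qed

text \<open>The \<open>i\<close>-th derivative of the control is the \<open>(i + k)\<close>-th of
  \<xi>, bounded by integrating the \<open>d\<close>-th one \<open>m - i\<close> times from
  \<open>0\<close>. The factor \<open>max 1 T\<close> makes the bound uniform in
  \<open>i\<close>.\<close>

lemma W0_space_flat:
  assumes p: "flat_path n d r T \<xi>" and "d + 1 < n" "0 < T" "k + m = d"
    and jet: "\<And>l. k \<le> l \<Longrightarrow> l \<le> n \<Longrightarrow> (deriv ^^ l) \<xi> T = 0"
  shows "(deriv ^^ k) \<xi> \<in> W0_space T (int m)"
    and "W_norm T (int m) ((deriv ^^ k) \<xi>) \<le> ereal (real (Suc m) * (r * max 1 T ^ m))"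
proof -
  let ?u = "(deriv ^^ k) \<xi>"
  have d\<xi>: "diff_upto n \<xi>" "\<And>t. t \<le> 0 \<Longrightarrow> \<xi> t = 0" and bd: "\<And>t. t \<in> {0..T} \<Longrightarrow> \<bar>(deriv ^^ d) \<xi> t\<bar> \<le> r"
    using p by (auto simp: flat_path_def)
  have comp: "(deriv ^^ i) ?u = (deriv ^^ (i + k)) \<xi>" for i
    by (simp add: funpow_add)
  have u: "diff_upto (n - k) ?u"
    unfolding diff_upto_def
  proof (intro allI impI)
    fix i t assume "i < n - k"
    then show "((deriv ^^ i) ?u has_real_derivative (deriv ^^ Suc i) ?u t) (at t)"
      using diff_uptoD[OF d\<xi>(1), of "i + k" t] unfolding comp by simp
  qed
  have cont: "continuous_on {0..T} ((deriv ^^ i) ?u)" if "i \<le> m" for i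
    using that assms by (intro diff_upto_continuous[OF u]) auto
  have weak: "weak_deriv T i ?u ((deriv ^^ i) ?u)" if "i \<le> m" for i
    using that assms by (intro weak_deriv_classical[OF u]) auto
  have "0 \<le> r"
    using bd[of 0] \<open>0 < T\<close> by simp
  have bound: "\<bar>(deriv ^^ i) ?u t\<bar> \<le> r * max 1 T ^ m" if "i \<le> m" "t \<in> {0..T}" for i t
  proof -
    have "i + k + (m - i) = d"
      using that assms by simp
    then have "\<bar>(deriv ^^ (i + k)) \<xi> t\<bar> \<le> r * T ^ (m - i)"
      using that assms bd by (intro higher_deriv_bound[OF d\<xi>]) auto
    also have "\<dots> \<le> r * max 1 T ^ m"
    proof (rule mult_left_mono[OF _ \<open>0 \<le> r\<close>])
      have "T ^ (m - i) \<le> max 1 T ^ (m - i)"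
        using \<open>0 < T\<close> by (intro power_mono) auto
      also have "\<dots> \<le> max 1 T ^ m"
        by (intro power_increasing) auto
      finally show "T ^ (m - i) \<le> max 1 T ^ m" .
    qed
    finally show ?thesis
      unfolding comp .
  qed
  have Linf: "Linf_norm T ((deriv ^^ i) ?u) \<le> ereal (r * max 1 T ^ m)" if "i \<le> m" for i
    using that by (intro Linf_norm_le cont bound)
  have "(deriv ^^ i) ?u 0 = 0" "(deriv ^^ i) ?u T = 0" if "i < m" for i
    unfolding comp using that assms higher_deriv_at_0[OF d\<xi>, of "i + k"] jet[of "i + k"] by auto
  moreover have "Linf_norm T ((deriv ^^ i) ?u) < \<infinity>" if "i \<le> m" for i
    using Linf[OF that] by (rule order.strict_trans1) simp
  ultimately show "?u \<in> W0_space T (int m)"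
    unfolding W0_space_def using weak cont
    by (auto intro!: exI[of _ "\<lambda>i. (deriv ^^ i) ?u"])
  have "W_norm T (int m) ?u \<le> (\<Sum>i\<le>m. Linf_norm T ((deriv ^^ i) ?u))"
    unfolding W_norm_def using weak by (auto intro!: INF_lower2[of "\<lambda>i. (deriv ^^ i) ?u"])
  also have "\<dots> \<le> (\<Sum>i\<le>m. ereal (r * max 1 T ^ m))"
    using Linf by (intro sum_mono) auto
  also have "\<dots> = ereal (real (Suc m) * (r * max 1 T ^ m))"
    by simp
  finally show "W_norm T (int m) ?u \<le> ereal (real (Suc m) * (r * max 1 T ^ m))" .
qed

text \<open>Here \<open>k = d + 1\<close>, so the primitive of the control is the
  \<open>d\<close>-th derivative itself and no boundary condition at \<open>T\<close> is
  imposed.\<close>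

lemma W0_space_flat_minus_1:
  assumes p: "flat_path n d r T \<xi>" and "d + 1 < n" "k = d + 1"
  shows "(deriv ^^ k) \<xi> \<in> W0_space T (-1)" and "W_norm T (-1) ((deriv ^^ k) \<xi>) \<le> ereal r"
proof -
  have d\<xi>: "diff_upto n \<xi>" "\<And>t. t \<le> 0 \<Longrightarrow> \<xi> t = 0" and bd: "\<And>t. t \<in> {0..T} \<Longrightarrow> \<bar>(deriv ^^ d) \<xi> t\<bar> \<le> r"
    using p by (auto simp: flat_path_def)
  show "(deriv ^^ k) \<xi> \<in> W0_space T (-1)"
    using diff_upto_continuous[OF d\<xi>(1), of k] assms
    by (auto simp: W0_space_def intro!: continuous_absolutely_integrable_open)
  have "integral {0..t} ((deriv ^^ k) \<xi>) = (deriv ^^ d) \<xi> t" if "t \<in> {0..T}" for t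
  proof -
    have "((deriv ^^ k) \<xi> has_integral (deriv ^^ d) \<xi> t - (deriv ^^ d) \<xi> 0) {0..t}"
    proof (rule fundamental_theorem_of_calculus)
      show "((deriv ^^ d) \<xi> has_vector_derivative (deriv ^^ k) \<xi> s) (at s within {0..t})" for s
        using diff_uptoD[OF d\<xi>(1), of d s] assms(2) unfolding assms(3)
        by (simp add: has_real_derivative_iff_has_vector_derivative has_vector_derivative_at_within)
    qed (use that in simp)
    then show ?thesis
      using higher_deriv_at_0[OF d\<xi>, of d] assms(2) by (simp add: integral_unique)
  qed
  moreover have "continuous_on {0..T} ((deriv ^^ d) \<xi>)"
    using assms(2) by (intro diff_upto_continuous[OF d\<xi>(1)]) simp
  then have "continuous_on {0..T} (\<lambda>t. integral {0..t} ((deriv ^^ k) \<xi>))"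
    by (rule continuous_on_eq) (simp add: calculation)
  ultimately have "Linf_norm T (\<lambda>t. integral {0..t} ((deriv ^^ k) \<xi>)) \<le> ereal r"
    using bd by (intro Linf_norm_le) auto
  then show "W_norm T (-1) ((deriv ^^ k) \<xi>) \<le> ereal r"
    by (simp add: W_norm_def)
qed

section \<open>Hall brackets\<close>

lemma n1_germ: "n1 (germ b) = n1 b"
  by (induction b) auto

lemma germ_less_n1_le: "germ_less a b \<Longrightarrow> n1 a \<le> n1 b"
  by (erule germ_less.cases) auto

lemma br_less_n1_le: "br_less a b \<Longrightarrow> b \<noteq> X0 \<Longrightarrow> n1 a \<le> n1 b"
  by (erule br_less.cases) (use germ_less_n1_le[of "germ a" "germ b"] n1_germ[of a] n1_germ[of b] in auto)

lemma M_0: "M 0 = X1"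
  and M_Suc: "M (Suc \<nu>) = Br (M \<nu>) X0"
  by (simp_all add: M_def app0_def)

lemma M_neq_X0 [simp]: "M \<nu> \<noteq> X0" "X0 \<noteq> M \<nu>"
  by (cases \<nu>; simp add: M_0 M_Suc)+

lemma n1_M [simp]: "n1 (M \<nu>) = 1"
  by (induction \<nu>) (simp_all add: M_0 M_Suc)

lemma germ_M: "germ (M \<nu>) = X1"
  by (induction \<nu>) (simp_all add: M_0 M_Suc)

lemma nu_M: "nu (M \<nu>) = \<nu>"
  by (induction \<nu>) (simp_all add: M_0 M_Suc)

lemma M_inj: "M \<nu> = M \<mu> \<longleftrightarrow> \<nu> = \<mu>"
  using nu_M by metis

lemma br_less_M: "br_less (M \<nu>) (M \<mu>) \<longleftrightarrow> \<nu> < \<mu>"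
proof -
  have "\<not> germ_less X1 X1"
    by (auto elim: germ_less.cases)
  then show ?thesis
    by (simp add: br_less_iff germ_M nu_M)
qed

lemma Bstar_Br_iff: "Br b1 b2 \<in> Bstar \<longleftrightarrow> b1 \<in> Bstar \<and> b2 \<in> Bstar \<and> br_less b1 b2 \<and>
    (b2 \<in> {X0, X1} \<or> (\<exists>c d. b2 = Br c d \<and> (br_less c b1 \<or> c = b1)))"
  by (subst Bstar.simps) auto

lemma M_Bstar: "M \<nu> \<in> Bstar"
  by (induction \<nu>) (auto simp: M_0 M_Suc Bstar_X1 Bstar_X0 Bstar_Br_iff br_less_X0_right_iff)

lemma W_Bstar: "1 \<le> j \<Longrightarrow> W j \<in> Bstar"
proof -
  assume "1 \<le> j"
  then obtain i where j: "j = Suc i"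
    by (cases j) auto
  have "br_less (M i) (M (Suc i))"
    by (simp add: br_less_M)
  then show ?thesis
    unfolding W_def j diff_Suc_1 Bstar_Br_iff[of "M i"] using M_Bstar[of i] M_Bstar[of "Suc i"] M_Suc by blast
qed

lemma P_Bstar:
  assumes "1 \<le> j" "j < k"
  shows "P j k \<in> Bstar"
proof -
  have "br_less (M (k - 1)) (W j)"
    by (rule less_germ) (auto simp: W_def germ_M intro: germ_less_n1)
  moreover have "br_less (M (j - 1)) (M (k - 1))"
    using assms by (auto simp: br_less_M)
  ultimately show ?thesis
    unfolding P_def Bstar_Br_iff[of "M (k - 1)"] using M_Bstar W_Bstar[OF assms(1)] by (auto simp: W_def)
qed

lemma Q_Bstar:
  assumes "1 \<le> j" "j < k"
  shows "Q j k k \<in> Bstar"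
proof -
  have "br_less (M (k - 1)) (P j k)"
    by (rule less_germ) (auto simp: P_def W_def germ_M intro: germ_less_n1)
  then show ?thesis
    unfolding Q_def Bstar_Br_iff[of "M (k - 1)"] using M_Bstar P_Bstar[OF assms] by (auto simp: P_def)
qed

lemma Bstar_Br_left_neq_X0: "Br b1 b2 \<in> Bstar \<Longrightarrow> b1 \<noteq> X0"
  using Bstar_Br_iff not_br_less_X0_left by blast

lemma Bstar_n1_pos: "b \<in> Bstar \<Longrightarrow> b \<noteq> X0 \<Longrightarrow> 1 \<le> n1 b"
proof (induction b)
  case (Br b1 b2)
  then show ?case
    using Bstar_Br_left_neq_X0[OF Br.prems(1)] Bstar_Br_iff by fastforce
qed auto

text \<open>The left factor of a bracket already contains an \<open>X1\<close>, so the right factor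
  has none and must be \<open>X0\<close>.\<close>

lemma Bstar_n1_eq_1: "b \<in> Bstar \<Longrightarrow> n1 b = 1 \<Longrightarrow> \<exists>\<nu>. b = M \<nu>"
proof (induction b)
  case X1
  then show ?case
    using M_0 by metis
next
  case (Br b1 b2)
  have b: "b1 \<in> Bstar" "b2 \<in> Bstar"
    using Br.prems(1) Bstar_Br_iff by blast+
  have "1 \<le> n1 b1"
    using Bstar_n1_pos[OF b(1)] Bstar_Br_left_neq_X0[OF Br.prems(1)] .
  then have "n1 b1 = 1" "n1 b2 = 0"
    using Br.prems(2) by auto
  then have "b2 = X0"
    using Bstar_n1_pos[OF b(2)] by auto
  then show ?case
    using Br.IH(1)[OF b(1) \<open>n1 b1 = 1\<close>] M_Suc by metis
qed simp

text \<open>The order gives \<open>n1 b1 \<le> n1 b2\<close>. If \<open>b1\<close> is some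
  \<open>M l\<close>, the Hall condition that the left factor of \<open>b2\<close> is at most
  \<open>b1\<close> forces that factor to be an \<open>M l'\<close> with \<open>l' \<le> l\<close>.
  Hence right factors in the last case never end with \<open>X0\<close>, which makes the later
  classification inductive.\<close>

lemma Bstar_Br_cases:
  assumes "Br b1 b2 \<in> Bstar" "b2 \<noteq> X0"
  obtains (big) "2 \<le> n1 b1" "2 \<le> n1 b2"
  | (W) l where "b1 = M l" "b2 = M (Suc l)"
  | (M) l l' d where "b1 = M l" "b2 = Br (M l') d" "l' \<le> l" "d \<noteq> X0" "2 \<le> n1 b2"
proof -
  have b: "b1 \<in> Bstar" "b2 \<in> Bstar" "br_less b1 b2"
    and hall: "b2 \<in> {X0, X1} \<or> (\<exists>c d. b2 = Br c d \<and> (br_less c b1 \<or> c = b1))"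
    using assms(1) Bstar_Br_iff by blast+
  have b1: "b1 \<noteq> X0"
    using Bstar_Br_left_neq_X0[OF assms(1)] .
  have n: "1 \<le> n1 b1" "n1 b1 \<le> n1 b2"
    using Bstar_n1_pos[OF b(1) b1] br_less_n1_le[OF b(3) assms(2)] .
  show thesis
  proof (cases "n1 b1 = 1")
    case False
    then show thesis
      using n by (intro big) auto
  next
    case True
    then obtain l where l: "b1 = M l"
      using Bstar_n1_eq_1[OF b(1)] by blast
    show thesis
    proof (cases "n1 b2 = 1")
      case True
      then obtain \<mu> where \<mu>: "b2 = M \<mu>"
        using Bstar_n1_eq_1[OF b(2)] by blast
      \<comment> \<open>The Hall condition gives \<open>\<mu> - 1 \<le> l\<close>, so the two
        indices are consecutive.\<close>
      have "l < \<mu>"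
        using b(3) unfolding l \<mu> br_less_M .
      then obtain \<mu>' where \<mu>': "\<mu> = Suc \<mu>'"
        by (cases \<mu>) auto
      then have "br_less (M \<mu>') (M l) \<or> M \<mu>' = M l"
        using hall unfolding l \<mu> by (auto simp: M_Suc)
      then have "\<mu>' = l"
        using \<open>l < \<mu>\<close> \<mu>' by (auto simp: br_less_M M_inj)
      then show thesis
        using W l \<mu> \<mu>' by blast
    next
      case False
      then have n2: "2 \<le> n1 b2"
        using n by linarith
      then obtain c d where cd: "b2 = Br c d" "br_less c (M l) \<or> c = M l"
        using hall assms(2) unfolding l by auto
      have c: "c \<in> Bstar" "c \<noteq> X0"
        using b(2) Bstar_Br_iff Bstar_Br_left_neq_X0 unfolding cd(1) by blast+
      have "n1 c \<le> 1"
        using cd(2) br_less_n1_le[of c "M l"] by auto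
      then have "n1 c = 1"
        using Bstar_n1_pos[OF c] by simp
      then obtain l' where l': "c = M l'"
        using Bstar_n1_eq_1[OF c(1)] by blast
      have "l' \<le> l"
        using cd(2) unfolding l' by (auto simp: br_less_M M_inj)
      moreover have "d \<noteq> X0"
        using n2 \<open>n1 c = 1\<close> cd(1) by auto
      ultimately show thesis
        using M[OF l] cd(1) l' n2 by blast
    qed
  qed
qed

section \<open>Polynomial vector fields\<close>

lemma lie_bracket_eq:
  assumes "(f has_derivative f') (at x)" "(g has_derivative g') (at x)"
  shows "lie_bracket f g x = g' (f x) - f' (g x)"
  using frechet_derivative_at[OF assms(1)] frechet_derivative_at[OF assms(2)]
  by (simp add: lie_bracket_def)

lemma lie_bracket_add_left:
  assumes "\<And>x. f differentiable at x" "\<And>x. g differentiable at x" "\<And>x. h differentiable at x"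
  shows "lie_bracket (\<lambda>x. f x + g x) h = (\<lambda>x. lie_bracket f h x + lie_bracket g h x)"
proof
  fix x
  have D: "(f has_derivative frechet_derivative f (at x)) (at x)"
    "(g has_derivative frechet_derivative g (at x)) (at x)"
    "(h has_derivative frechet_derivative h (at x)) (at x)"
    using assms frechet_derivative_works by blast+
  show "lie_bracket (\<lambda>x. f x + g x) h x = lie_bracket f h x + lie_bracket g h x"
    using lie_bracket_eq[OF has_derivative_add[OF D(1,2)] D(3)] lie_bracket_eq[OF D(1,3)]
      lie_bracket_eq[OF D(2,3)] linear_add[OF has_derivative_linear[OF D(3)]] by simp
qed

lemma lie_bracket_swap: "lie_bracket g f = (\<lambda>x. - lie_bracket f g x)"
  by (simp add: lie_bracket_def fun_eq_iff)

lemma lie_bracket_add_right: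
  assumes "\<And>x. f differentiable at x" "\<And>x. g differentiable at x" "\<And>x. h differentiable at x"
  shows "lie_bracket h (\<lambda>x. f x + g x) = (\<lambda>x. lie_bracket h f x + lie_bracket h g x)"
  using lie_bracket_add_left[OF assms] lie_bracket_swap[of h] by (simp add: fun_eq_iff)

lemma lie_bracket_const: "lie_bracket (\<lambda>x. a) (\<lambda>x. b) = (\<lambda>x. 0)"
  by (simp add: lie_bracket_def frechet_derivative_const fun_eq_iff)

lemma lie_bracket_zero_right: "f differentiable at x \<Longrightarrow> lie_bracket f (\<lambda>x. 0) x = 0"
  using lie_bracket_eq[of f _ x "\<lambda>x. 0" "\<lambda>x. 0"] frechet_derivative_works[of f "at x"]
    has_derivative_linear[THEN linear_0] by fastforce

lemma real_polynomial_differentiable: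
  "real_polynomial_function p \<Longrightarrow> p differentiable at x"
  by (induction rule: real_polynomial_function.induct)
    (auto intro: bounded_linear_imp_differentiable)

lemma real_polynomial_has_derivative:
  "real_polynomial_function p \<Longrightarrow> (p has_derivative frechet_derivative p (at x)) (at x)"
  using real_polynomial_differentiable frechet_derivative_works by blast

lemma real_polynomial_directional:
  assumes "real_polynomial_function p" "polynomial_function v"
  shows "real_polynomial_function (\<lambda>x. frechet_derivative p (at x) (v x))"
  using assms(1)
proof (induction rule: real_polynomial_function.induct)
  case (linear f)
  then have "frechet_derivative f (at x) = f" for x
    using frechet_derivative_at[OF bounded_linear.has_derivative[OF linear has_derivative_ident]] by simp
  then show ?case
    using assms(2) linear by (simp add: polynomial_function_def o_def)
next
  case (const c)
  then show ?case
    by (simp add: frechet_derivative_const real_polynomial_function.intros(2))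
next
  case (add f g)
  have "frechet_derivative (\<lambda>x. f x + g x) (at x) =
      (\<lambda>h. frechet_derivative f (at x) h + frechet_derivative g (at x) h)" for x
    using has_derivative_add[OF real_polynomial_has_derivative[OF add(1)] real_polynomial_has_derivative[OF add(2)]]
    by (rule frechet_derivative_at[symmetric])
  then show ?case
    using add by (simp add: real_polynomial_function.intros(3))
next
  case (mult f g)
  have "frechet_derivative (\<lambda>x. f x * g x) (at x) =
      (\<lambda>h. f x * frechet_derivative g (at x) h + frechet_derivative f (at x) h * g x)" for x
    using has_derivative_mult[OF real_polynomial_has_derivative[OF mult(1)] real_polynomial_has_derivative[OF mult(2)]]
    by (rule frechet_derivative_at[symmetric])
  then show ?case
    using mult by (simp add: real_polynomial_function.intros(3,4))
qed

text \<open>Used both for invariance in vertical directions and for vanishing along the zero set of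
  the ideal.\<close>

lemma frechet_derivative_along_line:
  fixes p :: "'a::real_normed_vector \<Rightarrow> 'b::real_normed_vector"
  assumes "p differentiable at x" "\<And>t. p (x + t *\<^sub>R v) = c"
  shows "frechet_derivative p (at x) v = 0"
proof -
  have p: "(p has_derivative frechet_derivative p (at x)) (at (x + 0 *\<^sub>R v))"
    using frechet_derivative_works[THEN iffD1, OF assms(1)] by simp
  have "((\<lambda>t. x + t *\<^sub>R v) has_derivative (\<lambda>t. t *\<^sub>R v)) (at 0)"
    by (auto intro!: derivative_eq_intros)
  from has_derivative_compose[OF this p]
  have "((\<lambda>t :: real. c) has_derivative (\<lambda>t. frechet_derivative p (at x) (t *\<^sub>R v))) (at 0)"
    unfolding assms(2) .
  then have "(\<lambda>t :: real. frechet_derivative p (at x) (t *\<^sub>R v)) = (\<lambda>t. 0)"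
    using has_derivative_unique has_derivative_const by blast
  then show ?thesis
    by (metis scaleR_one)
qed

section \<open>The system\<close>

lemma moment_has_derivative:
  assumes "diff_upto n \<xi>" "q < n" "t \<in> {0..T}"
  shows "(moment q e \<xi> has_real_derivative \<xi> t ^ e * ((deriv ^^ q) \<xi> t)\<^sup>2) (at t within {0..T})"
proof -
  have "continuous_on {0..T} (\<lambda>t. \<xi> t ^ e * ((deriv ^^ q) \<xi> t)\<^sup>2)"
    using diff_upto_continuous[OF assms(1,2)] diff_upto_continuous[OF assms(1), of 0] assms(2)
    by (intro continuous_on_mult continuous_on_power) auto
  from integral_has_real_derivative[OF this assms(3)] show ?thesis
    unfolding moment_def .
qed

locale nilpotent_system =
  fixes j k :: nat and lam :: real and ix :: "nat \<Rightarrow> 'n::finite"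
  assumes j1: "1 \<le> j" and jk: "j < k" and j2k: "2 * j \<le> k" and lam: "lam \<noteq> 0"
    and ix: "bij_betw ix {1..k + 2} UNIV"
begin

abbreviation "f0 \<equiv> sys_f0 ix j k lam"
abbreviation "f1 \<equiv> sys_f1 ix"
abbreviation "e \<equiv> basis_vec ix"

lemma k2: "2 \<le> k"
  using j1 jk by simp

lemma ix_eq_iff: "i \<in> {1..k + 2} \<Longrightarrow> l \<in> {1..k + 2} \<Longrightarrow> ix i = ix l \<longleftrightarrow> i = l"
  using ix unfolding bij_betw_def inj_on_def by blast

lemma basis_vec_nth:
  "i \<in> {1..k + 2} \<Longrightarrow> l \<in> {1..k + 2} \<Longrightarrow> e i $ ix l = (if i = l then 1 else 0)"
  using ix_eq_iff[of i l] by (auto simp: basis_vec_def axis_def)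

lemma sum_basis_nth:
  assumes "l \<in> {1..k + 2}"
  shows "(\<Sum>i\<in>{1..k + 2}. c i *\<^sub>R e i) $ ix l = c l"
proof -
  have "(\<Sum>i\<in>{1..k + 2}. c i *\<^sub>R e i) $ ix l = (\<Sum>i\<in>{1..k + 2}. if i = l then c i else 0)"
    unfolding sum_component by (rule sum.cong) (auto simp: basis_vec_nth[OF _ assms])
  then show ?thesis
    using assms by (simp add: sum.delta)
qed

lemma vec_eqI: "(\<And>i. i \<in> {1..k + 2} \<Longrightarrow> x $ ix i = y $ ix i) \<Longrightarrow> x = y"
  for x y :: "real ^ 'n"
  using ix unfolding bij_betw_def vec_eq_iff by (metis UNIV_I imageE)

lemma sum_coordinates:
  "(\<Sum>i\<in>{1..k + 2}. F i) = F 1 + (\<Sum>i\<in>{2..k - 1}. F i) + F k + F (k + 1) + F (k + 2)"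
  for F :: "nat \<Rightarrow> 'b::comm_monoid_add"
proof -
  have "{1..k + 2} = insert 1 ({2..k - 1} \<union> {k, k + 1, k + 2})"
    using k2 by auto
  moreover have "(\<Sum>i\<in>{2..k - 1} \<union> {k, k + 1, k + 2}. F i) = (\<Sum>i\<in>{2..k - 1}. F i) + (\<Sum>i\<in>{k, k + 1, k + 2}. F i)"
    using k2 by (intro sum.union_disjoint) auto
  ultimately show ?thesis
    using k2 by (simp add: add.assoc)
qed

section \<open>Explicit trajectories and controllability\<close>

text \<open>The moments satisfy A' = x_j^2, B' = \<xi> x_j^2 and C' = \<xi>^2 x_j^2. After
  substituting x_k = \<xi> + lam A, the last two right-hand sides are exact derivatives of
  polynomials in A, B, C.\<close>

lemma solution_flat:
  assumes d\<xi>: "diff_upto n \<xi>" "\<And>t. t \<le> 0 \<Longrightarrow> \<xi> t = 0" and "k < n" and q: "q = k - j"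
  defines "A \<equiv> moment q 0 \<xi>" and "B \<equiv> moment q 1 \<xi>" and "C \<equiv> moment q 2 \<xi>"
  defines "X \<equiv> \<lambda>i t. if i < k then (deriv ^^ (k - i)) \<xi> t
    else if i = k then \<xi> t + lam * A t
    else if i = k + 1 then 2 * B t + lam * (A t)\<^sup>2
    else C t + 2 * lam * A t * B t + 2 / 3 * lam\<^sup>2 * A t ^ 3"
  shows "solution f0 f1 T ((deriv ^^ k) \<xi>) (\<lambda>t. \<Sum>i\<in>{1..k + 2}. X i t *\<^sub>R e i)"
proof -
  define x where "x = (\<lambda>t. \<Sum>i\<in>{1..k + 2}. X i t *\<^sub>R e i)"
  define F where "F i t = (if i = 1 then (deriv ^^ k) \<xi> t else if i < k then X (i - 1) t
    else if i = k then X (k - 1) t + lam * (X j t)\<^sup>2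
    else if i = k + 1 then 2 * (X j t)\<^sup>2 * X k t
    else (X j t)\<^sup>2 * (X k t)\<^sup>2 + lam * (X j t)\<^sup>2 * X (k + 1) t)" for i t
  have qn: "q < n"
    using \<open>k < n\<close> q by simp
  have Xj: "X j t = (deriv ^^ q) \<xi> t" for t
    using jk by (simp add: X_def q)
  have x_nth: "x t $ ix i = X i t" if "i \<in> {1..k + 2}" for i t
    unfolding x_def by (rule sum_basis_nth[OF that])
  have field: "f0 (x t) + (deriv ^^ k) \<xi> t *\<^sub>R f1 (x t) = (\<Sum>i\<in>{1..k + 2}. F i t *\<^sub>R e i)" for t
  proof -
    have nth: "x t $ ix (k - 1) = X (k - 1) t" "x t $ ix j = X j t" "x t $ ix k = X k t"
        "x t $ ix (k + 1) = X (k + 1) t"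
      using k2 j1 jk by (auto intro!: x_nth)
    have "(\<Sum>i\<in>{2..k - 1}. x t $ ix (i - 1) *\<^sub>R e i) = (\<Sum>i\<in>{2..k - 1}. F i t *\<^sub>R e i)"
    proof (rule sum.cong[OF refl])
      fix i assume "i \<in> {2..k - 1}"
      then have "i - 1 \<in> {1..k + 2}" "F i t = X (i - 1) t"
        by (auto simp: F_def)
      then show "x t $ ix (i - 1) *\<^sub>R e i = F i t *\<^sub>R e i"
        by (simp only: x_nth)
    qed
    moreover have "F 1 t = (deriv ^^ k) \<xi> t" "F k t = X (k - 1) t + lam * (X j t)\<^sup>2"
        "F (k + 1) t = 2 * (X j t)\<^sup>2 * X k t"
        "F (k + 2) t = (X j t)\<^sup>2 * (X k t)\<^sup>2 + lam * (X j t)\<^sup>2 * X (k + 1) t"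
      using k2 by (simp_all add: F_def)
    ultimately show ?thesis
      unfolding sum_coordinates sys_f0_def sys_f1_def nth by (simp only: ac_simps)
  qed
  have deriv: "(X i has_real_derivative F i t) (at t within {0..T})"
    if i: "i \<in> {1..k + 2}" and t: "t \<in> {0..T}" for i t
  proof -
    have D: "((deriv ^^ l) \<xi> has_real_derivative (deriv ^^ Suc l) \<xi> t) (at t within {0..T})" if "l < n" for l
      by (rule has_field_derivative_at_within[OF diff_uptoD[OF d\<xi>(1) that]])
    have D0: "(\<xi> has_real_derivative X (k - 1) t) (at t within {0..T})"
      using D[of 0] k2 qn by (simp add: X_def)
    note M = moment_has_derivative[OF d\<xi>(1) qn t]
    have DA: "(A has_real_derivative (X j t)\<^sup>2) (at t within {0..T})"
      unfolding A_def Xj using M[of 0] by simp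
    have DB: "(B has_real_derivative \<xi> t * (X j t)\<^sup>2) (at t within {0..T})"
      unfolding B_def Xj using M[of 1] by simp
    have DC: "(C has_real_derivative (\<xi> t)\<^sup>2 * (X j t)\<^sup>2) (at t within {0..T})"
      unfolding C_def Xj using M[of 2] .
    consider "i < k" | "i = k" | "i = k + 1" | "i = k + 2"
      using i by fastforce
    then show ?thesis
    proof cases
      case 1
      have "Suc (k - i) = (if i = 1 then k else k - (i - 1))"
        using 1 i by auto
      then have "(deriv ^^ Suc (k - i)) \<xi> t = F i t"
        using 1 i by (auto simp: F_def X_def simp del: funpow.simps)
      moreover have "X i = (deriv ^^ (k - i)) \<xi>"
        using 1 by (simp add: X_def)
      ultimately show ?thesis
        using D[of "k - i"] 1 \<open>k < n\<close> by (simp del: funpow.simps)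
    next
      case 2
      have "((\<lambda>t. \<xi> t + lam * A t) has_real_derivative X (k - 1) t + lam * (X j t)\<^sup>2) (at t within {0..T})"
        by (intro DERIV_add DERIV_cmult D0 DA)
      moreover have "X k = (\<lambda>t. \<xi> t + lam * A t)" "F k t = X (k - 1) t + lam * (X j t)\<^sup>2"
        using k2 by (auto simp: X_def F_def)
      ultimately show ?thesis
        using 2 by simp
    next
      case 3
      have "((\<lambda>t. 2 * B t + lam * (A t)\<^sup>2) has_real_derivative
          2 * (\<xi> t * (X j t)\<^sup>2) + lam * (2 * A t * (X j t)\<^sup>2)) (at t within {0..T})"
        by (rule derivative_eq_intros DB DA refl | simp)+
      moreover have "X (k + 1) = (\<lambda>t. 2 * B t + lam * (A t)\<^sup>2)" "X k t = \<xi> t + lam * A t"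
          "F (k + 1) t = 2 * (X j t)\<^sup>2 * X k t"
        using k2 by (auto simp: X_def F_def)
      ultimately show ?thesis
        using 3 by (simp add: algebra_simps)
    next
      case 4
      have "((\<lambda>t. C t + 2 * lam * A t * B t + 2 / 3 * lam\<^sup>2 * A t ^ 3) has_real_derivative
          (\<xi> t)\<^sup>2 * (X j t)\<^sup>2 + 2 * lam * ((X j t)\<^sup>2 * B t + A t * (\<xi> t * (X j t)\<^sup>2)) +
          2 * lam\<^sup>2 * (A t)\<^sup>2 * (X j t)\<^sup>2) (at t within {0..T})"
        by (rule derivative_eq_intros DB DA DC refl | simp add: algebra_simps power2_eq_square)+
      moreover have "X (k + 2) = (\<lambda>t. C t + 2 * lam * A t * B t + 2 / 3 * lam\<^sup>2 * A t ^ 3)"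
          "X k t = \<xi> t + lam * A t" "X (k + 1) t = 2 * B t + lam * (A t)\<^sup>2"
          "F (k + 2) t = (X j t)\<^sup>2 * (X k t)\<^sup>2 + lam * (X j t)\<^sup>2 * X (k + 1) t"
        using k2 by (auto simp: X_def F_def)
      ultimately show ?thesis
        using 4 by (simp add: algebra_simps power2_eq_square)
    qed
  qed
  have dx: "(x has_vector_derivative f0 (x t) + (deriv ^^ k) \<xi> t *\<^sub>R f1 (x t)) (at t within {0..T})"
    if "t \<in> {0..T}" for t
    unfolding field unfolding x_def
  proof (intro has_vector_derivative_sum)
    fix i assume "i \<in> {1..k + 2}"
    from has_vector_derivative_scaleR[OF deriv[OF this that] has_vector_derivative_const]
    show "((\<lambda>t. X i t *\<^sub>R e i) has_vector_derivative F i t *\<^sub>R e i) (at t within {0..T})"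
      by simp
  qed
  have X0: "X i 0 = 0" if "i \<in> {1..k + 2}" for i
    using that higher_deriv_at_0[OF d\<xi>, of "k - i"] \<open>k < n\<close> d\<xi>(2)[of 0]
    by (auto simp: X_def A_def B_def C_def moment_def)
  have x0: "x 0 = 0"
    unfolding x_def by (intro sum.neutral) (simp add: X0)
  show ?thesis
    unfolding solution_def x_def[symmetric]
  proof (intro conjI ballI)
    show "continuous_on {0..T} x"
      unfolding continuous_on_eq_continuous_within
      by (intro ballI has_vector_derivative_continuous[OF dx])
    show "((\<lambda>s. f0 (x s) + (deriv ^^ k) \<xi> s *\<^sub>R f1 (x s)) has_integral x t) {0..t}" if "t \<in> {0..T}" for t
    proof -
      have "((\<lambda>s. f0 (x s) + (deriv ^^ k) \<xi> s *\<^sub>R f1 (x s)) has_integral x t - x 0) {0..t}"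
      proof (rule fundamental_theorem_of_calculus)
        show "(x has_vector_derivative f0 (x s) + (deriv ^^ k) \<xi> s *\<^sub>R f1 (x s)) (at s within {0..t})"
          if "s \<in> {0..t}" for s
          by (rule has_vector_derivative_within_subset[OF dx]) (use that \<open>t \<in> {0..T}\<close> in auto)
      qed (use that in simp)
      then show ?thesis
        by (simp add: x0)
    qed
  qed
qed

text \<open>The smoothness \<open>d + k + 2\<close> leaves continuous derivatives of the control up
  to all orders needed for the norm. Vanishing of the jet from order \<open>k\<close> on at
  \<open>T\<close> supplies the boundary conditions of the space.\<close>

lemma steering:
  assumes "0 < T" "0 < r"
  defines "d \<equiv> 2 * (k - j) - 1"
  shows "\<exists>\<delta>>0. \<forall>xs\<in>ball 0 \<delta>. \<exists>\<xi>. flat_path (d + k + 2) d r T \<xi> \<and>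
    (\<forall>l. k \<le> l \<and> l \<le> d + k + 2 \<longrightarrow> (deriv ^^ l) \<xi> T = 0) \<and>
    (\<exists>x. solution f0 f1 T ((deriv ^^ k) \<xi>) x \<and> x T = xs)"
proof -
  define q n where "q = k - j" and "n = d + k + 2"
  have "0 < q" "d + 1 = 2 * q" "d < n" "k \<le> d + 1" "k < n"
    using j1 jk j2k by (auto simp: q_def d_def n_def)
  from flat_output_exists_any_time[OF lam \<open>0 < r\<close> this(1,2,3) \<open>0 < T\<close> this(4)]
  obtain \<delta> where "\<delta> > 0" and flat: "\<And>y. \<forall>i\<in>{1..k + 2}. \<bar>y i\<bar> \<le> \<delta> \<Longrightarrow> \<exists>\<xi> A B C. flat_path n d r T \<xi> \<and>
      moment q 0 \<xi> T = A \<and> moment q 1 \<xi> T = B \<and> moment q 2 \<xi> T = C \<and>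
      (\<forall>l\<le>n. (deriv ^^ l) \<xi> T = (if l < k then y (k - l) else 0) - (if l = 0 then lam * A else 0)) \<and>
      y (k + 1) = 2 * B + lam * A\<^sup>2 \<and> y (k + 2) = C + 2 * lam * A * B + 2 / 3 * lam\<^sup>2 * A ^ 3"
    by blast
  show ?thesis
  proof (intro exI[of _ \<delta>] conjI ballI)
    fix xs :: "real ^ 'n" assume "xs \<in> ball 0 \<delta>"
    then have "norm xs \<le> \<delta>"
      by simp
    then have "\<forall>i\<in>{1..k + 2}. \<bar>xs $ ix i\<bar> \<le> \<delta>"
      using component_le_norm_cart[of xs] by (meson order_trans)
    from flat[OF this] obtain \<xi> where p: "flat_path n d r T \<xi>"
      and jet: "\<And>l. l \<le> n \<Longrightarrow> (deriv ^^ l) \<xi> T =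
        (if l < k then xs $ ix (k - l) else 0) - (if l = 0 then lam * moment q 0 \<xi> T else 0)"
      and eqs: "xs $ ix (k + 1) = 2 * moment q 1 \<xi> T + lam * (moment q 0 \<xi> T)\<^sup>2"
        "xs $ ix (k + 2) = moment q 2 \<xi> T + 2 * lam * moment q 0 \<xi> T * moment q 1 \<xi> T +
          2 / 3 * lam\<^sup>2 * moment q 0 \<xi> T ^ 3"
      by blast
    have d\<xi>: "diff_upto n \<xi>" "\<And>t. t \<le> 0 \<Longrightarrow> \<xi> t = 0"
      using p by (auto simp: flat_path_def)
    show "\<exists>\<xi>. flat_path (d + k + 2) d r T \<xi> \<and>
      (\<forall>l. k \<le> l \<and> l \<le> d + k + 2 \<longrightarrow> (deriv ^^ l) \<xi> T = 0) \<and>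
      (\<exists>x. solution f0 f1 T ((deriv ^^ k) \<xi>) x \<and> x T = xs)"
    proof (intro exI[of _ \<xi>] conjI allI impI exI)
      show "flat_path (d + k + 2) d r T \<xi>"
        using p by (simp add: n_def)
      show "(deriv ^^ l) \<xi> T = 0" if "k \<le> l \<and> l \<le> d + k + 2" for l
        using jet[of l] that k2 by (simp add: n_def)
      show "solution f0 f1 T ((deriv ^^ k) \<xi>) (\<lambda>t. \<Sum>i\<in>{1..k + 2}. (if i < k then (deriv ^^ (k - i)) \<xi> t
          else if i = k then \<xi> t + lam * moment q 0 \<xi> t
          else if i = k + 1 then 2 * moment q 1 \<xi> t + lam * (moment q 0 \<xi> t)\<^sup>2
          else moment q 2 \<xi> t + 2 * lam * moment q 0 \<xi> t * moment q 1 \<xi> t +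
            2 / 3 * lam\<^sup>2 * moment q 0 \<xi> t ^ 3) *\<^sub>R e i)"
        by (rule solution_flat[OF d\<xi> \<open>k < n\<close> q_def])
      show "(\<Sum>i\<in>{1..k + 2}. (if i < k then (deriv ^^ (k - i)) \<xi> T
          else if i = k then \<xi> T + lam * moment q 0 \<xi> T
          else if i = k + 1 then 2 * moment q 1 \<xi> T + lam * (moment q 0 \<xi> T)\<^sup>2
          else moment q 2 \<xi> T + 2 * lam * moment q 0 \<xi> T * moment q 1 \<xi> T +
            2 / 3 * lam\<^sup>2 * moment q 0 \<xi> T ^ 3) *\<^sub>R e i) = xs" (is "?x = xs")
      proof (rule vec_eqI)
        fix i assume i: "i \<in> {1..k + 2}"
        have "(deriv ^^ (k - i)) \<xi> T = xs $ ix i" if "i < k"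
          using jet[of "k - i"] that i \<open>k < n\<close> by auto
        moreover have "\<xi> T + lam * moment q 0 \<xi> T = xs $ ix k"
          using jet[of 0] k2 by simp
        moreover have "i = k + 2" if "\<not> i < k" "i \<noteq> k" "i \<noteq> k + 1"
          using that i by simp
        ultimately show "?x $ ix i = xs $ ix i"
          unfolding sum_basis_nth[OF i] using eqs by auto
      qed
    qed
  qed fact
qed

lemma STLC: "W0_STLC (int k - 2 * int j - 1) f0 f1"
  unfolding W0_STLC_def
proof (intro allI impI)
  fix T \<rho> :: real assume "0 < T" "0 < \<rho>"
  define d n where "d = 2 * (k - j) - 1" and "n = d + k + 2"
  note steer = steering[OF \<open>0 < T\<close>, folded d_def, folded n_def]
  show "\<exists>\<delta>>0. \<forall>xs\<in>ball 0 \<delta>. \<exists>u\<in>W0_space T (int k - 2 * int j - 1).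
    (\<exists>x. solution f0 f1 T u x \<and> x T = xs) \<and> W_norm T (int k - 2 * int j - 1) u \<le> ereal \<rho>"
  \<comment> \<open>The case distinction follows the separate meaning of the space of order
    \<open>-1\<close>.\<close>
  proof (cases "k = 2 * j")
    case True
    have dn: "d + 1 < n" "k = d + 1" and m: "int k - 2 * int j - 1 = -1"
      using True j1 by (auto simp: d_def n_def)
    obtain \<delta> where "\<delta> > 0" and \<delta>: "\<forall>xs\<in>ball 0 \<delta>. \<exists>\<xi>. flat_path n d \<rho> T \<xi> \<and>
        (\<forall>l. k \<le> l \<and> l \<le> n \<longrightarrow> (deriv ^^ l) \<xi> T = 0) \<and>
        (\<exists>x. solution f0 f1 T ((deriv ^^ k) \<xi>) x \<and> x T = xs)"
      using steer[OF \<open>0 < \<rho>\<close>] by (elim exE conjE)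
    show ?thesis
      unfolding m
    proof (intro exI[of _ \<delta>] conjI ballI)
      fix xs :: "real ^ 'n" assume "xs \<in> ball 0 \<delta>"
      then obtain \<xi> where p: "flat_path n d \<rho> T \<xi>"
        and "\<exists>x. solution f0 f1 T ((deriv ^^ k) \<xi>) x \<and> x T = xs"
        using bspec[OF \<delta>] by blast
      with W0_space_flat_minus_1[OF p dn]
      show "\<exists>u\<in>W0_space T (- 1). (\<exists>x. solution f0 f1 T u x \<and> x T = xs) \<and> W_norm T (- 1) u \<le> ereal \<rho>"
        by blast
    qed fact
  next
    case False
    define m where "m = k - 2 * j - 1"
    have dn: "d + 1 < n" "k + m = d" and m: "int k - 2 * int j - 1 = int m"
      using False j1 jk j2k by (auto simp: d_def n_def m_def)
    define r where "r = \<rho> / (real (Suc m) * max 1 T ^ m)"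
    have pos: "0 < real (Suc m) * max 1 T ^ m"
      by (intro mult_pos_pos zero_less_power) auto
    have r: "0 < r" "real (Suc m) * (r * max 1 T ^ m) = \<rho>"
      using \<open>0 < \<rho>\<close> pos by (simp_all add: r_def)
    obtain \<delta> where "\<delta> > 0" and \<delta>: "\<forall>xs\<in>ball 0 \<delta>. \<exists>\<xi>. flat_path n d r T \<xi> \<and>
        (\<forall>l. k \<le> l \<and> l \<le> n \<longrightarrow> (deriv ^^ l) \<xi> T = 0) \<and>
        (\<exists>x. solution f0 f1 T ((deriv ^^ k) \<xi>) x \<and> x T = xs)"
      using steer[OF r(1)] by (elim exE conjE)
    show ?thesis
      unfolding m
    proof (intro exI[of _ \<delta>] conjI ballI)
      fix xs :: "real ^ 'n" assume "xs \<in> ball 0 \<delta>"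
      then obtain \<xi> where p: "flat_path n d r T \<xi>"
        and jet: "\<And>l. k \<le> l \<Longrightarrow> l \<le> n \<Longrightarrow> (deriv ^^ l) \<xi> T = 0"
        and x: "\<exists>x. solution f0 f1 T ((deriv ^^ k) \<xi>) x \<and> x T = xs"
        using bspec[OF \<delta>] by blast
      show "\<exists>u\<in>W0_space T (int m). (\<exists>x. solution f0 f1 T u x \<and> x T = xs) \<and> W_norm T (int m) u \<le> ereal \<rho>"
        using W0_space_flat[OF p dn(1) \<open>0 < T\<close> dn(2) jet] x unfolding r(2) by blast
    qed fact
  qed
qed

section \<open>The abelian algebra of vertical fields\<close>

definition chain :: "real ^ 'n \<Rightarrow> real ^ 'n" where
  "chain x = (\<Sum>i\<in>{2..k}. x $ ix (i - 1) *\<^sub>R e i)"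

text \<open>The factor of x_j^2 in the drift, \<open>E\<close> in the overview; \<open>FF\<close>
  and \<open>GG\<close> are its first and second derivatives in x_k.\<close>

definition EE :: "real ^ 'n \<Rightarrow> real ^ 'n" where
  "EE x = lam *\<^sub>R e k + (2 * x $ ix k) *\<^sub>R e (k + 1) + ((x $ ix k)\<^sup>2 + lam * x $ ix (k + 1)) *\<^sub>R e (k + 2)"

definition FF :: "real ^ 'n \<Rightarrow> real ^ 'n" where
  "FF x = 2 *\<^sub>R e (k + 1) + (2 * x $ ix k) *\<^sub>R e (k + 2)"

definition GG :: "real ^ 'n" where
  "GG = 2 *\<^sub>R e (k + 2)"

definition vert :: "(real ^ 'n \<Rightarrow> real) \<Rightarrow> (real ^ 'n \<Rightarrow> real) \<Rightarrow> (real ^ 'n \<Rightarrow> real) \<Rightarrow> real ^ 'n \<Rightarrow> real ^ 'n" where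
  "vert \<alpha> \<beta> \<gamma> x = \<alpha> x *\<^sub>R EE x + \<beta> x *\<^sub>R FF x + \<gamma> x *\<^sub>R GG"

definition vertical :: "real ^ 'n \<Rightarrow> bool" where
  "vertical h \<longleftrightarrow> (\<forall>i\<in>{1..<k}. h $ ix i = 0)"

text \<open>Polynomials in x_1, ..., x_{k-1} only, encoded by invariance under vertical
  translations, so that vertical fields annihilate them.\<close>

definition base_poly :: "(real ^ 'n \<Rightarrow> real) \<Rightarrow> bool" where
  "base_poly p \<longleftrightarrow> real_polynomial_function p \<and> (\<forall>x h. vertical h \<longrightarrow> p (x + h) = p x)"

definition ideal_zeros :: "(real ^ 'n) set" where
  "ideal_zeros = {x. \<forall>i\<in>{1..j}. x $ ix i = 0}"

text \<open>The ideal generated by x_1, ..., x_j, described by its zero set; stability under a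
  derivation then amounts to tangency to that linear subspace.\<close>

definition ideal_poly :: "(real ^ 'n \<Rightarrow> real) \<Rightarrow> bool" where
  "ideal_poly p \<longleftrightarrow> base_poly p \<and> (\<forall>x\<in>ideal_zeros. p x = 0)"

abbreviation partial :: "nat \<Rightarrow> (real ^ 'n \<Rightarrow> real) \<Rightarrow> real ^ 'n \<Rightarrow> real" where
  "partial i p \<equiv> \<lambda>x. frechet_derivative p (at x) (e i)"

abbreviation chain_deriv :: "(real ^ 'n \<Rightarrow> real) \<Rightarrow> real ^ 'n \<Rightarrow> real" where
  "chain_deriv p \<equiv> \<lambda>x. frechet_derivative p (at x) (chain x)"

lemma chain_nth:
  assumes "i \<in> {1..k + 2}"
  shows "chain x $ ix i = (if i \<in> {2..k} then x $ ix (i - 1) else 0)"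
proof -
  have "chain x $ ix i = (\<Sum>l\<in>{2..k}. if l = i then x $ ix (l - 1) else 0)"
    unfolding chain_def sum_component
    by (rule sum.cong) (use assms in \<open>auto simp: basis_vec_nth[OF _ assms]\<close>)
  then show ?thesis
    by (simp add: sum.delta)
qed

lemma f0_eq: "f0 x = chain x + vert (\<lambda>x. (x $ ix j)\<^sup>2) (\<lambda>x. 0) (\<lambda>x. 0) x"
proof -
  have "{2..k} = insert k {2..k - 1}"
    using k2 by auto
  then have "chain x = (\<Sum>i\<in>{2..k - 1}. x $ ix (i - 1) *\<^sub>R e i) + x $ ix (k - 1) *\<^sub>R e k"
    using k2 by (simp add: chain_def)
  then show ?thesis
    by (simp add: sys_f0_def vert_def EE_def algebra_simps)
qed

lemma base_poly_polynomial: "base_poly p \<Longrightarrow> real_polynomial_function p"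
  by (simp add: base_poly_def)

lemma base_poly_const [simp]: "base_poly (\<lambda>x. c)"
  by (auto simp: base_poly_def)

lemma base_poly_nth: "i \<in> {1..<k} \<Longrightarrow> base_poly (\<lambda>x. x $ ix i)"
  by (auto simp: base_poly_def vertical_def intro!: real_polynomial_function.intros(1) bounded_linear_vec_nth)

lemma base_poly_add: "base_poly p \<Longrightarrow> base_poly q \<Longrightarrow> base_poly (\<lambda>x. p x + q x)"
  by (auto simp: base_poly_def)

lemma base_poly_mult: "base_poly p \<Longrightarrow> base_poly q \<Longrightarrow> base_poly (\<lambda>x. p x * q x)"
  by (auto simp: base_poly_def)

lemma base_poly_minus: "base_poly p \<Longrightarrow> base_poly (\<lambda>x. - p x)"
  by (auto simp: base_poly_def)

lemma vertical_scaleR: "vertical h \<Longrightarrow> vertical (t *\<^sub>R h)"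
  by (simp add: vertical_def)

lemma base_poly_deriv_vertical:
  "base_poly p \<Longrightarrow> vertical h \<Longrightarrow> frechet_derivative p (at x) h = 0"
  by (rule frechet_derivative_along_line[where c = "p x"])
    (auto simp: base_poly_def vertical_scaleR intro: real_polynomial_differentiable)

text \<open>Translating by a vertical vector changes neither \<open>p\<close> nor its derivative, so
  only the invariance of \<open>v\<close> remains to be used.\<close>

lemma base_poly_directional:
  assumes p: "base_poly p" and v: "polynomial_function v" "\<And>x h. vertical h \<Longrightarrow> v (x + h) = v x"
  shows "base_poly (\<lambda>x. frechet_derivative p (at x) (v x))"
  unfolding base_poly_def
proof (intro conjI allI impI)
  show "real_polynomial_function (\<lambda>x. frechet_derivative p (at x) (v x))"
    using p v by (intro real_polynomial_directional) (auto simp: base_poly_def)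
  fix x h assume h: "vertical h"
  have "(p has_derivative frechet_derivative p (at (x + h))) (at (x + h))"
    using p by (simp add: base_poly_def real_polynomial_has_derivative)
  moreover have "((\<lambda>x. x + h) has_derivative (\<lambda>y. y)) (at x)"
    by (auto intro!: derivative_eq_intros)
  ultimately have "((\<lambda>x. p (x + h)) has_derivative (\<lambda>y. frechet_derivative p (at (x + h)) y)) (at x)"
    using has_derivative_compose[of "\<lambda>x. x + h" "\<lambda>y. y" x UNIV p] by blast
  then have "(p has_derivative frechet_derivative p (at (x + h))) (at x)"
    using p h by (simp add: base_poly_def)
  then have "frechet_derivative p (at (x + h)) = frechet_derivative p (at x)"
    by (rule frechet_derivative_at)
  then show "frechet_derivative p (at (x + h)) (v (x + h)) = frechet_derivative p (at x) (v x)"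
    using v h by simp
qed

lemma linear_chain: "linear chain"
  by (auto simp: chain_def linear_iff sum.distrib algebra_simps scaleR_sum_right)

lemma chain_vertical: "vertical h \<Longrightarrow> chain h = 0"
proof -
  assume "vertical h"
  then have "h $ ix (i - 1) = 0" if "i \<in> {2..k}" for i
    unfolding vertical_def by (rule bspec) (use that in auto)
  then show ?thesis
    by (simp add: chain_def)
qed

lemma base_poly_partial: "base_poly p \<Longrightarrow> base_poly (partial i p)"
  by (rule base_poly_directional) auto

lemma base_poly_chain_deriv: "base_poly p \<Longrightarrow> base_poly (chain_deriv p)"
  using linear_chain
  by (intro base_poly_directional polynomial_function_bounded_linear)
    (auto simp: linear_linear linear_add chain_vertical)

lemma ideal_zeros_line: "x \<in> ideal_zeros \<Longrightarrow> y \<in> ideal_zeros \<Longrightarrow> x + t *\<^sub>R y \<in> ideal_zeros"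
  by (auto simp: ideal_zeros_def)

lemma ideal_poly_directional:
  "ideal_poly p \<Longrightarrow> x \<in> ideal_zeros \<Longrightarrow> v \<in> ideal_zeros \<Longrightarrow> frechet_derivative p (at x) v = 0"
  by (rule frechet_derivative_along_line[where c = 0])
    (auto simp: ideal_poly_def base_poly_def ideal_zeros_line intro: real_polynomial_differentiable)

text \<open>For \<open>i > j\<close> the direction \<open>e i\<close> is tangent to the zero set.
  This fails for \<open>i \<le> j\<close>, and that is how the nonzero bracket \<open>W j\<close>
  arises.\<close>

lemma ideal_poly_partial:
  assumes "ideal_poly p" "j < i" "i \<le> k"
  shows "ideal_poly (partial i p)"
proof -
  have "e i \<in> ideal_zeros"
    using assms jk by (auto simp: ideal_zeros_def basis_vec_nth)
  then show ?thesis
    using assms(1) ideal_poly_directional[OF assms(1)] base_poly_partial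
    unfolding ideal_poly_def by blast
qed

text \<open>The chain shifts indices upwards: coordinate \<open>i\<close> of the image is coordinate
  \<open>i - 1\<close>, and the first one is \<open>0\<close>.\<close>

lemma chain_ideal_zeros: "x \<in> ideal_zeros \<Longrightarrow> chain x \<in> ideal_zeros"
proof -
  assume x: "x \<in> ideal_zeros"
  have "chain x $ ix i = 0" if "i \<in> {1..j}" for i
  proof (cases "i = 1")
    case False
    then have "i - 1 \<in> {1..j}"
      using that by auto
    then have "x $ ix (i - 1) = 0"
      using x by (simp add: ideal_zeros_def)
    then show ?thesis
      using that jk by (simp add: chain_nth)
  qed (simp add: chain_nth)
  then show ?thesis
    by (simp add: ideal_zeros_def)
qed

lemma ideal_poly_chain_deriv: "ideal_poly p \<Longrightarrow> ideal_poly (chain_deriv p)"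
  using ideal_poly_directional chain_ideal_zeros base_poly_chain_deriv unfolding ideal_poly_def by blast

lemma zero_ideal_zeros: "0 \<in> ideal_zeros"
  by (simp add: ideal_zeros_def)

lemma ideal_poly_0: "ideal_poly p \<Longrightarrow> p 0 = 0"
  using zero_ideal_zeros by (simp add: ideal_poly_def)

lemma vert_0: "vert \<alpha> \<beta> \<gamma> 0 = (\<alpha> 0 * lam) *\<^sub>R e k + (2 * \<beta> 0) *\<^sub>R e (k + 1) + (2 * \<gamma> 0) *\<^sub>R e (k + 2)"
  by (simp add: vert_def EE_def FF_def GG_def mult.commute)

definition EE' :: "real ^ 'n \<Rightarrow> real ^ 'n \<Rightarrow> real ^ 'n" where
  "EE' x h = (2 * h $ ix k) *\<^sub>R e (k + 1) + (2 * x $ ix k * h $ ix k + lam * h $ ix (k + 1)) *\<^sub>R e (k + 2)"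

definition FF' :: "real ^ 'n \<Rightarrow> real ^ 'n" where
  "FF' h = (2 * h $ ix k) *\<^sub>R e (k + 2)"

lemma nth_has_derivative: "((\<lambda>x. x $ i) has_derivative (\<lambda>h. h $ i)) (at x)"
  by (rule bounded_linear.has_derivative[OF bounded_linear_vec_nth has_derivative_ident])

lemma EE_has_derivative: "(EE has_derivative EE' x) (at x)"
  unfolding EE_def[abs_def] EE'_def[abs_def]
  by (rule derivative_eq_intros nth_has_derivative refl | simp add: algebra_simps)+

lemma FF_has_derivative: "(FF has_derivative FF') (at x)"
  unfolding FF_def[abs_def] FF'_def[abs_def]
  by (rule derivative_eq_intros nth_has_derivative refl | simp add: algebra_simps)+

definition vert_deriv where
  "vert_deriv \<alpha> \<beta> \<gamma> x h = (frechet_derivative \<alpha> (at x) h *\<^sub>R EE x + frechet_derivative \<beta> (at x) h *\<^sub>R FF x +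
    frechet_derivative \<gamma> (at x) h *\<^sub>R GG) + (\<alpha> x *\<^sub>R EE' x h + \<beta> x *\<^sub>R FF' h)"

lemma vert_has_derivative:
  assumes "base_poly \<alpha>" "base_poly \<beta>" "base_poly \<gamma>"
  shows "(vert \<alpha> \<beta> \<gamma> has_derivative vert_deriv \<alpha> \<beta> \<gamma> x) (at x)"
proof -
  note D = real_polynomial_has_derivative[OF base_poly_polynomial]
  have "((\<lambda>x. \<alpha> x *\<^sub>R EE x + \<beta> x *\<^sub>R FF x + \<gamma> x *\<^sub>R GG) has_derivative
      (\<lambda>h. (\<alpha> x *\<^sub>R EE' x h + frechet_derivative \<alpha> (at x) h *\<^sub>R EE x) +
        (\<beta> x *\<^sub>R FF' h + frechet_derivative \<beta> (at x) h *\<^sub>R FF x) +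
        (\<gamma> x *\<^sub>R 0 + frechet_derivative \<gamma> (at x) h *\<^sub>R GG))) (at x)"
    by (intro has_derivative_add has_derivative_scaleR D assms EE_has_derivative FF_has_derivative
        has_derivative_const)
  then show ?thesis
    unfolding vert_def[abs_def] vert_deriv_def[abs_def] by (simp add: algebra_simps)
qed

lemma vert_differentiable:
  "base_poly \<alpha> \<Longrightarrow> base_poly \<beta> \<Longrightarrow> base_poly \<gamma> \<Longrightarrow> vert \<alpha> \<beta> \<gamma> differentiable at x"
  using vert_has_derivative unfolding differentiable_def by blast

lemma EE_nth: "EE x $ ix k = lam" "EE x $ ix (k + 1) = 2 * x $ ix k" "i \<in> {1..<k} \<Longrightarrow> EE x $ ix i = 0"
  and FF_nth: "FF x $ ix k = 0" "FF x $ ix (k + 1) = 2" "i \<in> {1..<k} \<Longrightarrow> FF x $ ix i = 0"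
  and GG_nth: "GG $ ix k = 0" "GG $ ix (k + 1) = 0" "i \<in> {1..<k} \<Longrightarrow> GG $ ix i = 0"
  using k2 by (auto simp: EE_def FF_def GG_def basis_vec_nth)

lemma vertical_vert: "vertical (vert \<alpha> \<beta> \<gamma> x)"
  by (auto simp: vertical_def vert_def EE_nth FF_nth GG_nth)

text \<open>Coefficients are not differentiated, so it remains that \<open>EE\<close>,
  \<open>FF\<close>, \<open>GG\<close> commute. For \<open>EE\<close> and \<open>FF\<close> both
  derivatives equal 2 lam e_{k+2}; the term lam x_{k+1} in \<open>EE\<close> is there to balance
  them.\<close>

lemma bracket_vert_vert:
  assumes "base_poly \<alpha>" "base_poly \<beta>" "base_poly \<gamma>" "base_poly \<alpha>'" "base_poly \<beta>'" "base_poly \<gamma>'"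
  shows "lie_bracket (vert \<alpha> \<beta> \<gamma>) (vert \<alpha>' \<beta>' \<gamma>') = (\<lambda>x. 0)"
proof
  fix x
  have nth: "vert a b c x $ ix k = a x * lam" "vert a b c x $ ix (k + 1) = 2 * (a x * x $ ix k + b x)" for a b c
    unfolding vert_def vector_add_component vector_scaleR_component EE_nth FF_nth GG_nth
    by (simp_all add: algebra_simps)
  have "vert_deriv \<alpha>' \<beta>' \<gamma>' x (vert \<alpha> \<beta> \<gamma> x) = vert_deriv \<alpha> \<beta> \<gamma> x (vert \<alpha>' \<beta>' \<gamma>' x)"
    unfolding vert_deriv_def EE'_def FF'_def nth
    using base_poly_deriv_vertical[OF _ vertical_vert] assms
    by (simp add: algebra_simps)
  then show "lie_bracket (vert \<alpha> \<beta> \<gamma>) (vert \<alpha>' \<beta>' \<gamma>') x = 0"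
    using lie_bracket_eq[OF vert_has_derivative[OF assms(1-3)] vert_has_derivative[OF assms(4-6)]] by simp
qed

lemma chain_has_derivative: "(chain has_derivative chain) (at x)"
  using linear_chain by (intro bounded_linear_imp_has_derivative) (simp add: linear_linear)

text \<open>The chain annihilates vertical vectors, as x_k feeds no further integrator. Only the
  derivative along the chain remains; its component x_{k-1} in direction \<open>e k\<close> turns
  \<open>EE\<close> into \<open>FF\<close> and \<open>FF\<close> into \<open>GG\<close>.\<close>

lemma bracket_vert_chain:
  assumes "base_poly \<alpha>" "base_poly \<beta>" "base_poly \<gamma>"
  shows "lie_bracket (vert \<alpha> \<beta> \<gamma>) chain = vert (\<lambda>x. - chain_deriv \<alpha> x)
    (\<lambda>x. - (chain_deriv \<beta> x + x $ ix (k - 1) * \<alpha> x)) (\<lambda>x. - (chain_deriv \<gamma> x + x $ ix (k - 1) * \<beta> x))"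
proof
  fix x
  have "chain x $ ix k = x $ ix (k - 1)" "chain x $ ix (k + 1) = 0"
    using k2 by (auto simp: chain_nth)
  then show "lie_bracket (vert \<alpha> \<beta> \<gamma>) chain x = vert (\<lambda>x. - chain_deriv \<alpha> x)
    (\<lambda>x. - (chain_deriv \<beta> x + x $ ix (k - 1) * \<alpha> x)) (\<lambda>x. - (chain_deriv \<gamma> x + x $ ix (k - 1) * \<beta> x)) x"
    unfolding lie_bracket_eq[OF vert_has_derivative[OF assms] chain_has_derivative]
      chain_vertical[OF vertical_vert]
    unfolding vert_deriv_def vert_def EE'_def FF'_def FF_def GG_def
    by (simp add: algebra_simps)
qed

lemma bracket_const_vert:
  assumes "base_poly \<alpha>" "base_poly \<beta>" "base_poly \<gamma>"
  shows "i \<in> {1..<k} \<Longrightarrow>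
      lie_bracket (\<lambda>x. e i) (vert \<alpha> \<beta> \<gamma>) = vert (partial i \<alpha>) (partial i \<beta>) (partial i \<gamma>)"
    and "lie_bracket (\<lambda>x. e k) (vert \<alpha> \<beta> \<gamma>) = vert (\<lambda>x. 0) \<alpha> \<beta>"
proof -
  have br: "lie_bracket (\<lambda>x. c) (vert \<alpha> \<beta> \<gamma>) x = vert_deriv \<alpha> \<beta> \<gamma> x c" for c x
    using lie_bracket_eq[OF has_derivative_const vert_has_derivative[OF assms]]
      has_derivative_linear[OF vert_has_derivative[OF assms]] by simp
  show "lie_bracket (\<lambda>x. e i) (vert \<alpha> \<beta> \<gamma>) = vert (partial i \<alpha>) (partial i \<beta>) (partial i \<gamma>)"
    if "i \<in> {1..<k}"
    using that by (auto simp: fun_eq_iff br vert_deriv_def vert_def EE'_def FF'_def basis_vec_nth)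
  have "vertical (e k)"
    using k2 by (auto simp: vertical_def basis_vec_nth)
  then show "lie_bracket (\<lambda>x. e k) (vert \<alpha> \<beta> \<gamma>) = vert (\<lambda>x. 0) \<alpha> \<beta>"
    using k2 assms by (auto simp: fun_eq_iff br vert_deriv_def vert_def EE'_def FF'_def basis_vec_nth
        base_poly_deriv_vertical FF_def GG_def algebra_simps)
qed

section \<open>Brackets with the drift and with constant fields\<close>

abbreviation "ev \<equiv> br_eval f0 f1"

text \<open>Index shifted by one, so that \<open>M \<nu>\<close> has this constant part; beyond the
  end of the chain it is \<open>0\<close>.\<close>

definition chain_basis :: "nat \<Rightarrow> real ^ 'n" where
  "chain_basis \<nu> = (if \<nu> < k then e (Suc \<nu>) else 0)"

definition vert_fields :: "(real ^ 'n \<Rightarrow> real ^ 'n) set" where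
  "vert_fields = {vert \<alpha> \<beta> \<gamma> | \<alpha> \<beta> \<gamma>. base_poly \<alpha> \<and> base_poly \<beta> \<and> base_poly \<gamma>}"

definition ideal_fields :: "(real ^ 'n \<Rightarrow> real ^ 'n) set" where
  "ideal_fields = {vert \<alpha> \<beta> \<gamma> | \<alpha> \<beta> \<gamma>. ideal_poly \<alpha> \<and> ideal_poly \<beta> \<and> ideal_poly \<gamma>}"

lemma vert_fieldsI: "base_poly \<alpha> \<Longrightarrow> base_poly \<beta> \<Longrightarrow> base_poly \<gamma> \<Longrightarrow> vert \<alpha> \<beta> \<gamma> \<in> vert_fields"
  unfolding vert_fields_def by blast

lemma vert_fieldsE:
  assumes "f \<in> vert_fields"
  obtains \<alpha> \<beta> \<gamma> where "f = vert \<alpha> \<beta> \<gamma>" "base_poly \<alpha>" "base_poly \<beta>" "base_poly \<gamma>"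
  using assms unfolding vert_fields_def by blast

lemma ideal_fieldsI: "ideal_poly \<alpha> \<Longrightarrow> ideal_poly \<beta> \<Longrightarrow> ideal_poly \<gamma> \<Longrightarrow> vert \<alpha> \<beta> \<gamma> \<in> ideal_fields"
  unfolding ideal_fields_def by blast

lemma ideal_fieldsE:
  assumes "f \<in> ideal_fields"
  obtains \<alpha> \<beta> \<gamma> where "f = vert \<alpha> \<beta> \<gamma>" "ideal_poly \<alpha>" "ideal_poly \<beta>" "ideal_poly \<gamma>"
  using assms unfolding ideal_fields_def by blast

lemma ideal_poly_base: "ideal_poly p \<Longrightarrow> base_poly p"
  by (simp add: ideal_poly_def)

lemma ideal_fields_vert_fields: "f \<in> ideal_fields \<Longrightarrow> f \<in> vert_fields"
  by (elim ideal_fieldsE) (simp add: vert_fieldsI ideal_poly_base)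

lemma vert_fields_differentiable: "f \<in> vert_fields \<Longrightarrow> f differentiable at x"
  by (elim vert_fieldsE) (simp add: vert_differentiable)

lemma ideal_fields_at_0: "f \<in> ideal_fields \<Longrightarrow> f 0 = 0"
  by (elim ideal_fieldsE) (simp add: vert_0 ideal_poly_0)

lemma vert_add: "(\<lambda>x. vert \<alpha> \<beta> \<gamma> x + vert \<alpha>' \<beta>' \<gamma>' x) =
    vert (\<lambda>x. \<alpha> x + \<alpha>' x) (\<lambda>x. \<beta> x + \<beta>' x) (\<lambda>x. \<gamma> x + \<gamma>' x)"
  by (simp add: fun_eq_iff vert_def algebra_simps)

lemma vert_minus: "(\<lambda>x. - vert \<alpha> \<beta> \<gamma> x) = vert (\<lambda>x. - \<alpha> x) (\<lambda>x. - \<beta> x) (\<lambda>x. - \<gamma> x)"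
  by (simp add: fun_eq_iff vert_def)

lemma vert_zero: "vert (\<lambda>x. 0) (\<lambda>x. 0) (\<lambda>x. 0) = (\<lambda>x. 0)"
  by (simp add: fun_eq_iff vert_def)

lemma ideal_poly_zero: "ideal_poly (\<lambda>x. 0)"
  by (simp add: ideal_poly_def)

lemma ideal_poly_add: "ideal_poly p \<Longrightarrow> ideal_poly q \<Longrightarrow> ideal_poly (\<lambda>x. p x + q x)"
  by (simp add: ideal_poly_def base_poly_add)

lemma ideal_poly_minus: "ideal_poly p \<Longrightarrow> ideal_poly (\<lambda>x. - p x)"
  by (simp add: ideal_poly_def base_poly_minus)

lemma ideal_poly_mult: "base_poly q \<Longrightarrow> ideal_poly p \<Longrightarrow> ideal_poly (\<lambda>x. q x * p x)"
  by (simp add: ideal_poly_def base_poly_mult)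

lemma vert_fields_zero: "(\<lambda>x. 0) \<in> vert_fields"
  using vert_fieldsI[OF base_poly_const base_poly_const base_poly_const, of 0 0 0] unfolding vert_zero .

lemma ideal_fields_zero: "(\<lambda>x. 0) \<in> ideal_fields"
  using ideal_fieldsI[OF ideal_poly_zero ideal_poly_zero ideal_poly_zero] unfolding vert_zero .

lemma ideal_fields_add: "f \<in> ideal_fields \<Longrightarrow> g \<in> ideal_fields \<Longrightarrow> (\<lambda>x. f x + g x) \<in> ideal_fields"
  by (elim ideal_fieldsE) (simp add: vert_add ideal_fieldsI ideal_poly_add)

lemma ideal_fields_minus: "f \<in> ideal_fields \<Longrightarrow> (\<lambda>x. - f x) \<in> ideal_fields"
  by (elim ideal_fieldsE) (simp add: vert_minus ideal_fieldsI ideal_poly_minus)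

lemma vert_fields_add: "f \<in> vert_fields \<Longrightarrow> g \<in> vert_fields \<Longrightarrow> (\<lambda>x. f x + g x) \<in> vert_fields"
  by (elim vert_fieldsE) (simp add: vert_add vert_fieldsI base_poly_add)

lemma vert_fields_minus: "f \<in> vert_fields \<Longrightarrow> (\<lambda>x. - f x) \<in> vert_fields"
  by (elim vert_fieldsE) (simp add: vert_minus vert_fieldsI base_poly_minus)

lemma bracket_vert_fields_vert_fields: "f \<in> vert_fields \<Longrightarrow> g \<in> vert_fields \<Longrightarrow> lie_bracket f g = (\<lambda>x. 0)"
  by (elim vert_fieldsE) (simp add: bracket_vert_vert)

lemma base_poly_kminus: "base_poly (\<lambda>x. x $ ix (k - 1))"
  using k2 by (intro base_poly_nth) auto

abbreviation "drift_vert \<equiv> vert (\<lambda>x. (x $ ix j)\<^sup>2) (\<lambda>x. 0) (\<lambda>x. 0)"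

lemma base_poly_j: "base_poly (\<lambda>x. x $ ix j)"
  using j1 jk by (intro base_poly_nth) auto

lemma ideal_poly_j: "ideal_poly (\<lambda>x. x $ ix j)"
  using j1 base_poly_j by (simp add: ideal_poly_def ideal_zeros_def)

lemma ideal_poly_j2: "ideal_poly (\<lambda>x. (x $ ix j)\<^sup>2)"
  using ideal_poly_mult[OF base_poly_j ideal_poly_j] by (simp add: power2_eq_square)

lemma drift_vert_vert_fields: "drift_vert \<in> ideal_fields"
  by (intro ideal_fieldsI ideal_poly_j2 ideal_poly_zero)

lemma chain_differentiable: "chain differentiable at x"
  using chain_has_derivative unfolding differentiable_def by blast

lemma bracket_f0:
  assumes "\<And>x. f differentiable at x"
  shows "lie_bracket f f0 = (\<lambda>x. lie_bracket f chain x + lie_bracket f drift_vert x)"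
proof -
  have "f0 = (\<lambda>x. chain x + drift_vert x)"
    by (rule ext) (rule f0_eq)
  then show ?thesis
    using lie_bracket_add_right[OF chain_differentiable vert_fields_differentiable assms]
      ideal_fields_vert_fields[OF drift_vert_vert_fields] by simp
qed

text \<open>The rest of the drift is itself vertical and commutes with \<open>f\<close>.\<close>

lemma bracket_vert_fields_f0_eq: "f \<in> vert_fields \<Longrightarrow> lie_bracket f f0 = lie_bracket f chain"
  using bracket_f0[OF vert_fields_differentiable] bracket_vert_fields_vert_fields[OF _ ideal_fields_vert_fields[OF drift_vert_vert_fields]]
  by simp

lemma bracket_vert_fields_f0: "f \<in> vert_fields \<Longrightarrow> lie_bracket f f0 \<in> vert_fields"
proof -
  assume f: "f \<in> vert_fields"
  then obtain \<alpha> \<beta> \<gamma> where "f = vert \<alpha> \<beta> \<gamma>" and p: "base_poly \<alpha>" "base_poly \<beta>" "base_poly \<gamma>"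
    by (rule vert_fieldsE)
  then show ?thesis
    unfolding bracket_vert_fields_f0_eq[OF f] using bracket_vert_chain[OF p]
    by (simp only:) (intro vert_fieldsI base_poly_minus base_poly_add base_poly_mult base_poly_chain_deriv base_poly_kminus p)
qed

text \<open>Each new coefficient is a derivative along the chain or has the factor x_{k-1}, and the
  chain vanishes at \<open>0\<close>. This disposes of the brackets with several \<open>X1\<close>
  that end with \<open>X0\<close>.\<close>

lemma bracket_vert_fields_f0_at_0: "f \<in> vert_fields \<Longrightarrow> lie_bracket f f0 0 = 0"
proof -
  assume f: "f \<in> vert_fields"
  then obtain \<alpha> \<beta> \<gamma> where "f = vert \<alpha> \<beta> \<gamma>" and p: "base_poly \<alpha>" "base_poly \<beta>" "base_poly \<gamma>"
    by (rule vert_fieldsE)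
  moreover have "frechet_derivative p (at 0) 0 = 0" if "base_poly p" for p
    using has_derivative_linear[OF real_polynomial_has_derivative[OF base_poly_polynomial[OF that]]]
    by (rule linear_0)
  moreover have "chain 0 = 0"
    by (rule linear_0[OF linear_chain])
  ultimately show ?thesis
    unfolding bracket_vert_fields_f0_eq[OF f] by (simp add: bracket_vert_chain vert_0)
qed

lemma bracket_ideal_fields_f0: "f \<in> ideal_fields \<Longrightarrow> lie_bracket f f0 \<in> ideal_fields"
proof -
  assume f: "f \<in> ideal_fields"
  then obtain \<alpha> \<beta> \<gamma> where "f = vert \<alpha> \<beta> \<gamma>" and p: "ideal_poly \<alpha>" "ideal_poly \<beta>" "ideal_poly \<gamma>"
    by (rule ideal_fieldsE)
  moreover have "base_poly \<alpha>" "base_poly \<beta>" "base_poly \<gamma>"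
    using p by (auto simp: ideal_poly_def)
  ultimately have "lie_bracket f f0 = vert (\<lambda>x. - chain_deriv \<alpha> x)
    (\<lambda>x. - (chain_deriv \<beta> x + x $ ix (k - 1) * \<alpha> x)) (\<lambda>x. - (chain_deriv \<gamma> x + x $ ix (k - 1) * \<beta> x))"
    unfolding bracket_vert_fields_f0_eq[OF ideal_fields_vert_fields[OF f]] by (simp add: bracket_vert_chain)
  moreover have "ideal_poly (\<lambda>x. - chain_deriv \<alpha> x)"
    "ideal_poly (\<lambda>x. - (chain_deriv \<beta> x + x $ ix (k - 1) * \<alpha> x))"
    "ideal_poly (\<lambda>x. - (chain_deriv \<gamma> x + x $ ix (k - 1) * \<beta> x))"
    by (intro ideal_poly_minus ideal_poly_add ideal_poly_mult ideal_poly_chain_deriv base_poly_kminus p)+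
  ultimately show ?thesis
    by (simp add: ideal_fieldsI)
qed

lemma bracket_chain_basis_vert:
  assumes "base_poly \<alpha>" "base_poly \<beta>" "base_poly \<gamma>"
  shows "lie_bracket (\<lambda>x. chain_basis l) (vert \<alpha> \<beta> \<gamma>) =
    (if Suc l < k then vert (partial (Suc l) \<alpha>) (partial (Suc l) \<beta>) (partial (Suc l) \<gamma>)
     else if Suc l = k then vert (\<lambda>x. 0) \<alpha> \<beta> else (\<lambda>x. 0))"
proof -
  have "lie_bracket (\<lambda>x. 0) (vert \<alpha> \<beta> \<gamma>) = (\<lambda>x. 0)"
    unfolding lie_bracket_swap[of "\<lambda>x. 0" "vert \<alpha> \<beta> \<gamma>"]
    by (simp add: lie_bracket_zero_right vert_differentiable[OF assms])
  then show ?thesis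
    using bracket_const_vert(1)[OF assms, of "Suc l"] bracket_const_vert(2)[OF assms]
    by (auto simp: chain_basis_def)
qed

lemma bracket_chain_basis_vert_fields: "f \<in> vert_fields \<Longrightarrow> lie_bracket (\<lambda>x. chain_basis l) f \<in> vert_fields"
proof -
  assume "f \<in> vert_fields"
  then obtain \<alpha> \<beta> \<gamma> where "f = vert \<alpha> \<beta> \<gamma>" and p: "base_poly \<alpha>" "base_poly \<beta>" "base_poly \<gamma>"
    by (rule vert_fieldsE)
  then show ?thesis
    by (simp add: bracket_chain_basis_vert[OF p, of l] vert_fields_zero vert_fieldsI base_poly_partial)
qed

text \<open>The direction is \<open>e (Suc l)\<close> with \<open>Suc l > j\<close>, hence tangent
  to the zero set of the ideal; at the end of the chain the coefficients are merely shifted.\<close>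

lemma bracket_chain_basis_ideal_fields:
  assumes "f \<in> ideal_fields" "j \<le> l"
  shows "lie_bracket (\<lambda>x. chain_basis l) f \<in> ideal_fields"
proof -
  obtain \<alpha> \<beta> \<gamma> where f: "f = vert \<alpha> \<beta> \<gamma>" and p: "ideal_poly \<alpha>" "ideal_poly \<beta>" "ideal_poly \<gamma>"
    by (rule ideal_fieldsE[OF assms(1)])
  then have b: "base_poly \<alpha>" "base_poly \<beta>" "base_poly \<gamma>"
    by (auto simp: ideal_poly_def)
  consider "Suc l < k" | "Suc l = k" | "k < Suc l"
    by linarith
  then show ?thesis
  proof cases
    case 1
    then have "ideal_poly (partial (Suc l) q)" if "ideal_poly q" for q
      using that assms(2) by (intro ideal_poly_partial) auto
    then show ?thesis
      unfolding f bracket_chain_basis_vert[OF b] using 1 p by (simp add: ideal_fieldsI)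
  next
    case 2
    then show ?thesis
      unfolding f bracket_chain_basis_vert[OF b] using 2 ideal_poly_zero p by (simp add: ideal_fieldsI)
  next
    case 3
    then show ?thesis
      unfolding f bracket_chain_basis_vert[OF b] using 3 ideal_fields_zero by simp
  qed
qed

lemma bracket_chain_basis_chain: "lie_bracket (\<lambda>x. chain_basis l) chain = (\<lambda>x. chain_basis (Suc l))"
proof
  fix x
  have "lie_bracket (\<lambda>x. chain_basis l) chain x = chain (chain_basis l)"
    using lie_bracket_eq[OF has_derivative_const chain_has_derivative] by simp
  also have "\<dots> = chain_basis (Suc l)"
  proof (rule vec_eqI)
    fix i assume i: "i \<in> {1..k + 2}"
    show "chain (chain_basis l) $ ix i = chain_basis (Suc l) $ ix i"
    proof (cases "i \<in> {2..k}")
      case True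
      then have "i - 1 \<in> {1..k + 2}"
        by auto
      from basis_vec_nth[OF _ this, of "Suc l"] show ?thesis
        unfolding chain_nth[OF i] using True i by (auto simp: chain_basis_def basis_vec_nth)
    qed (use i in \<open>auto simp: chain_nth chain_basis_def basis_vec_nth\<close>)
  qed
  finally show "lie_bracket (\<lambda>x. chain_basis l) chain x = chain_basis (Suc l)" .
qed

lemma chain_basis_plus_differentiable: "f \<in> vert_fields \<Longrightarrow> (\<lambda>x. chain_basis l + f x) differentiable at x"
  using vert_fields_differentiable[of f] by (intro differentiable_add) auto

lemma bracket_chain_basis_plus_vert_fields:
  assumes "f \<in> vert_fields" "g \<in> vert_fields"
  shows "lie_bracket (\<lambda>x. chain_basis l + f x) g = lie_bracket (\<lambda>x. chain_basis l) g"
  using lie_bracket_add_left[of "\<lambda>x. chain_basis l" f g] vert_fields_differentiable assms bracket_vert_fields_vert_fields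
  by simp

lemma bracket_chain_basis_plus_f0:
  assumes "f \<in> vert_fields"
  shows "lie_bracket (\<lambda>x. chain_basis l + f x) f0 =
    (\<lambda>x. chain_basis (Suc l) + (lie_bracket (\<lambda>x. chain_basis l) drift_vert x + lie_bracket f f0 x))"
proof -
  have f0: "f0 differentiable at x" for x
  proof -
    have "f0 = (\<lambda>x. chain x + drift_vert x)"
      by (rule ext) (rule f0_eq)
    then show ?thesis
      using chain_differentiable vert_fields_differentiable[OF ideal_fields_vert_fields[OF drift_vert_vert_fields]]
      by simp
  qed
  have "lie_bracket (\<lambda>x. chain_basis l + f x) f0 = (\<lambda>x. lie_bracket (\<lambda>x. chain_basis l) f0 x + lie_bracket f f0 x)"
    by (rule lie_bracket_add_left) (auto intro: vert_fields_differentiable[OF assms] f0)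
  then show ?thesis
    by (simp add: bracket_f0 bracket_chain_basis_chain add.assoc)
qed

section \<open>Evaluation of the Hall brackets\<close>

text \<open>Bracketing with the drift advances the constant part along the chain. The first vertical
  term appears at \<nu> = j, from differentiating x_j^2 along \<open>e j\<close>; afterwards all
  terms stay in the ideal.\<close>

lemma ev_M:
  "\<exists>m\<in>ideal_fields. ev (M \<nu>) = (\<lambda>x. chain_basis \<nu> + m x) \<and> (\<nu> < j \<longrightarrow> m = (\<lambda>x. 0)) \<and>
    (\<nu> = j \<longrightarrow> m = vert (\<lambda>x. 2 * x $ ix j) (\<lambda>x. 0) (\<lambda>x. 0))"
proof (induction \<nu>)
  case 0
  have "ev (M 0) = (\<lambda>x. chain_basis 0 + 0)"
    using k2 by (simp add: M_0 chain_basis_def sys_f1_def fun_eq_iff)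
  then show ?case
    using ideal_fields_zero j1 by (intro bexI[of _ "\<lambda>x. 0"]) auto
next
  case (Suc \<nu>)
  then obtain m where m: "m \<in> ideal_fields" "ev (M \<nu>) = (\<lambda>x. chain_basis \<nu> + m x)" "\<nu> < j \<longrightarrow> m = (\<lambda>x. 0)"
    by blast
  define m' where "m' = (\<lambda>x. lie_bracket (\<lambda>x. chain_basis \<nu>) drift_vert x + lie_bracket m f0 x)"
  have b: "base_poly (\<lambda>x. (x $ ix j)\<^sup>2)"
    using ideal_poly_j2 by (simp add: ideal_poly_def)
  have pj: "partial i (\<lambda>x. (x $ ix j)\<^sup>2) = (\<lambda>x. if i = j then 2 * x $ ix j else 0)" if "i \<in> {1..k + 2}" for i
  proof
    fix x :: "real ^ 'n"
    have "((\<lambda>x. (x $ ix j)\<^sup>2) has_derivative (\<lambda>h. 2 * (h $ ix j * x $ ix j))) (at x)"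
      by (rule derivative_eq_intros nth_has_derivative refl | simp add: mult.assoc)+
    then have "frechet_derivative (\<lambda>x. (x $ ix j)\<^sup>2) (at x) = (\<lambda>h. 2 * (h $ ix j * x $ ix j))"
      by (rule frechet_derivative_at[symmetric])
    then show "partial i (\<lambda>x. (x $ ix j)\<^sup>2) x = (if i = j then 2 * x $ ix j else 0)"
      using that j1 jk by (simp add: basis_vec_nth)
  qed
  have zero: "partial i (\<lambda>x. 0) = (\<lambda>x. 0)" for i
    by (simp add: frechet_derivative_const)
  have br: "lie_bracket (\<lambda>x. chain_basis \<nu>) drift_vert =
      (if Suc \<nu> < k then vert (\<lambda>x. if Suc \<nu> = j then 2 * x $ ix j else 0) (\<lambda>x. 0) (\<lambda>x. 0)
       else if Suc \<nu> = k then vert (\<lambda>x. 0) (\<lambda>x. (x $ ix j)\<^sup>2) (\<lambda>x. 0) else (\<lambda>x. 0))"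
    unfolding bracket_chain_basis_vert[OF b base_poly_const base_poly_const] zero using pj[of "Suc \<nu>"] by auto
  have "lie_bracket (\<lambda>x. chain_basis \<nu>) drift_vert \<in> ideal_fields"
  proof -
    have "ideal_poly (\<lambda>x. if Suc \<nu> = j then 2 * x $ ix j else 0)"
      using ideal_poly_mult[OF base_poly_const ideal_poly_j, of 2] ideal_poly_zero
      by (cases "Suc \<nu> = j") simp_all
    then show ?thesis
      unfolding br using ideal_poly_zero ideal_poly_j2 ideal_fields_zero by (simp add: ideal_fieldsI)
  qed
  then have "m' \<in> ideal_fields"
    unfolding m'_def by (intro ideal_fields_add bracket_ideal_fields_f0 m)
  moreover have "ev (M (Suc \<nu>)) = (\<lambda>x. chain_basis (Suc \<nu>) + m' x)"
    using bracket_chain_basis_plus_f0[OF ideal_fields_vert_fields[OF m(1)], of \<nu>] by (simp add: M_Suc m(2) m'_def)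
  moreover have "m' = (if Suc \<nu> = j then vert (\<lambda>x. 2 * x $ ix j) (\<lambda>x. 0) (\<lambda>x. 0) else (\<lambda>x. 0))" if "Suc \<nu> \<le> j"
  proof -
    have "lie_bracket m f0 = (\<lambda>x. 0)"
    proof -
      have "m = (\<lambda>x. 0)"
        using m(3) that by simp
      then show ?thesis
        unfolding bracket_vert_fields_f0_eq[OF ideal_fields_vert_fields[OF m(1)]]
        using lie_bracket_swap[of "\<lambda>x. 0" chain]
        by (simp add: lie_bracket_zero_right chain_differentiable)
    qed
    then show ?thesis
      using that jk by (auto simp: m'_def br vert_zero)
  qed
  ultimately show ?case
    by (intro bexI[of _ m']) auto
qed

lemma ev_M_at_0: "ev (M \<nu>) 0 = chain_basis \<nu>"
  using ev_M[of \<nu>] ideal_fields_at_0 by auto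

lemma bracket_M_vert_fields:
  assumes "f \<in> vert_fields"
  shows "lie_bracket (ev (M l)) f = lie_bracket (\<lambda>x. chain_basis l) f"
proof -
  obtain m where "m \<in> ideal_fields" "ev (M l) = (\<lambda>x. chain_basis l + m x)"
    using ev_M[of l] by blast
  then show ?thesis
    using bracket_chain_basis_plus_vert_fields[OF ideal_fields_vert_fields assms] by simp
qed

lemma ev_M_M:
  assumes ma: "ma \<in> vert_fields" "ev (M a) = (\<lambda>x. chain_basis a + ma x)" and mb: "mb \<in> vert_fields" "ev (M b) = (\<lambda>x. chain_basis b + mb x)"
  shows "ev (Br (M a) (M b)) = (\<lambda>x. lie_bracket (\<lambda>x. chain_basis a) mb x + - lie_bracket (\<lambda>x. chain_basis b) ma x)"
proof -
  have "ev (Br (M a) (M b)) = (\<lambda>x. lie_bracket (\<lambda>x. chain_basis a + ma x) (\<lambda>x. chain_basis b) x + lie_bracket (\<lambda>x. chain_basis a + ma x) mb x)"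
    unfolding br_eval.simps ma mb
    by (rule lie_bracket_add_right) (auto intro: chain_basis_plus_differentiable vert_fields_differentiable ma mb)
  also have "lie_bracket (\<lambda>x. chain_basis a + ma x) (\<lambda>x. chain_basis b) = (\<lambda>x. - lie_bracket (\<lambda>x. chain_basis b) ma x)"
  proof -
    have "lie_bracket (\<lambda>x. chain_basis a + ma x) (\<lambda>x. chain_basis b) =
        (\<lambda>x. lie_bracket (\<lambda>x. chain_basis a) (\<lambda>x. chain_basis b) x + lie_bracket ma (\<lambda>x. chain_basis b) x)"
      by (rule lie_bracket_add_left) (auto intro: vert_fields_differentiable ma)
    then show ?thesis
      using lie_bracket_swap[of ma "\<lambda>x. chain_basis b"] by (simp add: lie_bracket_const)
  qed
  also have "lie_bracket (\<lambda>x. chain_basis a + ma x) mb = lie_bracket (\<lambda>x. chain_basis a) mb"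
    by (rule bracket_chain_basis_plus_vert_fields[OF ma(1) mb(1)])
  finally show ?thesis
    by (simp add: add.commute)
qed

lemma partial_const: "partial i (\<lambda>x. c) = (\<lambda>x. 0)"
  by (simp add: frechet_derivative_const)

text \<open>As \<open>M (j - 1)\<close> is the constant field \<open>e j\<close>, only the
  derivative of 2 x_j \<open>EE\<close> along \<open>e j\<close> survives. It is the step that
  leaves the ideal.\<close>

lemma ev_W: "ev (W j) = vert (\<lambda>x. 2) (\<lambda>x. 0) (\<lambda>x. 0)"
proof -
  obtain ma where ma: "ma \<in> ideal_fields" "ev (M (j - 1)) = (\<lambda>x. chain_basis (j - 1) + ma x)" "ma = (\<lambda>x. 0)"
    using ev_M[of "j - 1"] j1 by auto
  obtain mb where mb: "mb \<in> ideal_fields" "ev (M j) = (\<lambda>x. chain_basis j + mb x)"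
      "mb = vert (\<lambda>x. 2 * x $ ix j) (\<lambda>x. 0) (\<lambda>x. 0)"
    using ev_M[of j] by auto
  have b: "base_poly (\<lambda>x. 2 * x $ ix j)"
    by (intro base_poly_mult base_poly_const base_poly_j)
  have p: "partial j (\<lambda>x. 2 * x $ ix j) = (\<lambda>x. 2)"
  proof
    fix x :: "real ^ 'n"
    have "((\<lambda>x. 2 * x $ ix j) has_derivative (\<lambda>h. 2 * h $ ix j)) (at x)"
      by (intro has_derivative_mult_right nth_has_derivative)
    then have "frechet_derivative (\<lambda>x. 2 * x $ ix j) (at x) = (\<lambda>h. 2 * h $ ix j)"
      by (rule frechet_derivative_at[symmetric])
    then show "partial j (\<lambda>x. 2 * x $ ix j) x = 2"
      using j1 jk by (simp add: basis_vec_nth)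
  qed
  have "ev (W j) = lie_bracket (\<lambda>x. chain_basis (j - 1)) mb"
    unfolding W_def ev_M_M[OF ideal_fields_vert_fields[OF ma(1)] ma(2) ideal_fields_vert_fields[OF mb(1)] mb(2)]
      ma(3) lie_bracket_const[of "chain_basis j" 0] by simp
  then show ?thesis
    unfolding mb(3) bracket_chain_basis_vert[OF b base_poly_const base_poly_const] using j1 jk p partial_const
    by simp
qed

lemma bracket_chain_basis_vert_const:
  "lie_bracket (\<lambda>x. chain_basis l) (vert (\<lambda>x. a) (\<lambda>x. b) (\<lambda>x. c)) =
    (if Suc l = k then vert (\<lambda>x. 0) (\<lambda>x. a) (\<lambda>x. b) else (\<lambda>x. 0))"
  unfolding bracket_chain_basis_vert[OF base_poly_const base_poly_const base_poly_const] partial_const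
  by (simp add: vert_zero)

lemma vert_const_vert_fields: "vert (\<lambda>x. a) (\<lambda>x. b) (\<lambda>x. c) \<in> vert_fields"
  by (intro vert_fieldsI base_poly_const)

lemma ev_P: "ev (P j k) = vert (\<lambda>x. 0) (\<lambda>x. 2) (\<lambda>x. 0)"
  using k2 unfolding P_def br_eval.simps ev_W bracket_M_vert_fields[OF vert_const_vert_fields] bracket_chain_basis_vert_const
  by simp

lemma ev_Q: "ev (Q j k k) = vert (\<lambda>x. 0) (\<lambda>x. 0) (\<lambda>x. 2)"
  using k2 unfolding Q_def br_eval.simps ev_P bracket_M_vert_fields[OF vert_const_vert_fields] bracket_chain_basis_vert_const
  by simp

text \<open>Below \<open>j\<close> both fields are constant. From \<open>j\<close> on both constant
  directions are tangent to the zero set, so no coefficient leaves the ideal.\<close>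

lemma ev_W_other:
  "ev (Br (M l) (M (Suc l))) \<in> vert_fields \<and>
    (Suc l < j \<longrightarrow> ev (Br (M l) (M (Suc l))) = (\<lambda>x. 0)) \<and>
    (j \<le> l \<longrightarrow> ev (Br (M l) (M (Suc l))) \<in> ideal_fields)"
proof -
  obtain ma where ma: "ma \<in> ideal_fields" "ev (M l) = (\<lambda>x. chain_basis l + ma x)" "l < j \<longrightarrow> ma = (\<lambda>x. 0)"
    using ev_M[of l] by blast
  obtain mb where mb: "mb \<in> ideal_fields" "ev (M (Suc l)) = (\<lambda>x. chain_basis (Suc l) + mb x)" "Suc l < j \<longrightarrow> mb = (\<lambda>x. 0)"
    using ev_M[of "Suc l"] by blast
  note ma' = ideal_fields_vert_fields[OF ma(1)] and mb' = ideal_fields_vert_fields[OF mb(1)]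
  note W = ev_M_M[OF ma' ma(2) mb' mb(2)]
  show ?thesis
  proof (intro conjI impI)
    show "ev (Br (M l) (M (Suc l))) \<in> vert_fields"
      unfolding W by (intro vert_fields_add vert_fields_minus bracket_chain_basis_vert_fields ma' mb')
    show "ev (Br (M l) (M (Suc l))) = (\<lambda>x. 0)" if "Suc l < j"
      unfolding W using that ma(3) mb(3) by (simp add: lie_bracket_const)
    show "ev (Br (M l) (M (Suc l))) \<in> ideal_fields" if "j \<le> l"
      unfolding W using that by (intro ideal_fields_add ideal_fields_minus bracket_chain_basis_ideal_fields ma mb) auto
  qed
qed

text \<open>The classification records the left factor \<open>M l\<close> with
  \<open>l \<ge> j\<close>: by the Hall condition every later left factor of index at least
  \<open>l\<close> is also transverse to none of the ideal, so membership in the ideal propagates.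
  Brackets ending with \<open>X0\<close> need only the first half.\<close>

lemma ev_Bstar:
  assumes "b \<in> Bstar" "2 \<le> n1 b"
  shows "ev b \<in> vert_fields \<and> (\<forall>c d. b = Br c d \<longrightarrow> d \<noteq> X0 \<longrightarrow>
    ev b = (\<lambda>x. 0) \<or> (\<exists>l\<ge>j. c = M l \<and> ev b \<in> ideal_fields) \<or> b \<in> {W j, P j k, Q j k k})"
  using assms
proof (induction b rule: br.induct)
  case (Br c d)
  have cd: "c \<in> Bstar" "d \<in> Bstar"
    using Br.prems(1) Bstar_Br_iff by blast+
  show ?case
  proof (cases "d = X0")
    case True
    then have "ev c \<in> vert_fields"
      using Br.IH(1)[OF cd(1)] Br.prems(2) by simp
    then show ?thesis
      using True bracket_vert_fields_f0 by simp
  next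
    case False
    show ?thesis
      using Br.prems(1) False
    proof (cases rule: Bstar_Br_cases)
      case big
      then have "ev (Br c d) = (\<lambda>x. 0)"
        using Br.IH(1)[OF cd(1)] Br.IH(2)[OF cd(2)] bracket_vert_fields_vert_fields by simp
      then show ?thesis
        using vert_fields_zero by simp
    next
      case (W l)
      consider "Suc l < j" | "Suc l = j" | "j \<le> l"
        by linarith
      then show ?thesis
      proof cases
        case 2
        then have "Br (M l) (M (Suc l)) = W j"
          by (auto simp: W_def)
        then show ?thesis
          unfolding W using ev_W_other[of l] by simp
      qed (use ev_W_other[of l] in \<open>auto simp: W\<close>)
    next
      \<comment> \<open>Here \<open>d\<close> has left factor \<open>M l'\<close> and does not end
        with \<open>X0\<close>, so the classification applies to it. In the ideal case
        \<open>j \<le> l' \<le> l\<close>; otherwise \<open>d\<close> has constant coefficients and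
        only \<open>l = k - 1\<close> can give something nonzero.\<close>
      case (M l l' d')
      have IH: "ev d \<in> vert_fields" "ev d = (\<lambda>x. 0) \<or> (\<exists>l''\<ge>j. M l' = M l'' \<and> ev d \<in> ideal_fields) \<or>
          d \<in> {W j, P j k, Q j k k}"
        using Br.IH(2)[OF cd(2) M(5)] M(2,4) by auto
      have br: "ev (Br c d) = lie_bracket (\<lambda>x. chain_basis l) (ev d)"
        using bracket_M_vert_fields[OF IH(1)] M(1) by simp
      have "ev (Br c d) = (\<lambda>x. 0) \<or> (\<exists>l\<ge>j. c = M l \<and> ev (Br c d) \<in> ideal_fields) \<or>
          Br c d \<in> {W j, P j k, Q j k k}"
        using IH(2)
      proof (elim disjE)
        assume "ev d = (\<lambda>x. 0)"
        then show ?thesis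
          unfolding br by (simp add: lie_bracket_const)
      next
        assume "\<exists>l''\<ge>j. M l' = M l'' \<and> ev d \<in> ideal_fields"
        then have "j \<le> l" "ev d \<in> ideal_fields"
          using M(3) M_inj by auto
        then show ?thesis
          unfolding br using M(1) bracket_chain_basis_ideal_fields by blast
      next
        assume "d \<in> {W j, P j k, Q j k k}"
        then consider "d = W j" | "d = P j k" | "d = Q j k k"
          by blast
        then show ?thesis
        proof cases
          case 1
          show ?thesis
          proof (cases "Suc l = k")
            case True
            then have "Br c d = P j k"
              using 1 M(1) by (auto simp: P_def)
            then show ?thesis by simp
          next
            case False
            then show ?thesis
              unfolding br unfolding 1 ev_W bracket_chain_basis_vert_const by simp
          qed
        next
          case 2
          show ?thesis
          proof (cases "Suc l = k")
            case True
            then have "Br c d = Q j k k"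
              using 2 M(1) by (auto simp: Q_def)
            then show ?thesis by simp
          next
            case False
            then show ?thesis
              unfolding br unfolding 2 ev_P bracket_chain_basis_vert_const by simp
          qed
        next
          case 3
          then show ?thesis
            unfolding br unfolding 3 ev_Q bracket_chain_basis_vert_const vert_zero by simp
        qed
      qed
      moreover have "ev (Br c d) \<in> vert_fields"
        unfolding br by (rule bracket_chain_basis_vert_fields[OF IH(1)])
      ultimately show ?thesis
        by blast
    qed
  qed
qed auto

lemma f0_at_0: "f0 0 = 0"
  by (simp add: sys_f0_def)

lemma basis_vec_neq_0: "i \<in> {1..k + 2} \<Longrightarrow> e i \<noteq> 0"
  using basis_vec_nth[of i i] by auto

lemma ev_at_0:
  "i \<in> {1..k} \<Longrightarrow> ev (M (i - 1)) 0 = e i"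
  "ev (W j) 0 = (2 * lam) *\<^sub>R e k"
  "ev (P j k) 0 = 4 *\<^sub>R e (k + 1)"
  "ev (Q j k k) 0 = 4 *\<^sub>R e (k + 2)"
  by (auto simp: ev_M_at_0 chain_basis_def ev_W ev_P ev_Q vert_0)

lemma ev_nonzero_cases:
  assumes "b \<in> Bstar" "ev b 0 \<noteq> 0"
  shows "b \<in> {M (i - 1) | i. i \<in> {1..k}} \<union> {W j, P j k, Q j k k}"
proof -
  have X0: "b \<noteq> X0"
    using assms(2) f0_at_0 by auto
  show ?thesis
  proof (cases "n1 b = 1")
    case True
    then obtain \<nu> where \<nu>: "b = M \<nu>"
      using Bstar_n1_eq_1[OF assms(1)] by blast
    then have "\<nu> < k"
      using assms(2) by (auto simp: ev_M_at_0 chain_basis_def split: if_splits)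
    then show ?thesis
      unfolding \<nu> by (auto intro!: exI[of _ "Suc \<nu>"])
  next
    case False
    then have n: "2 \<le> n1 b"
      using Bstar_n1_pos[OF assms(1) X0] by simp
    then obtain c d where b: "b = Br c d"
      by (cases b) auto
    have "c \<in> Bstar"
      using assms(1) unfolding b Bstar_Br_iff by blast
    have "d \<noteq> X0"
    proof
      assume "d = X0"
      then have "ev c \<in> vert_fields"
        using ev_Bstar[OF \<open>c \<in> Bstar\<close>] n b by simp
      then show False
        using assms(2) bracket_vert_fields_f0_at_0 b \<open>d = X0\<close> by simp
    qed
    then have "ev b = (\<lambda>x. 0) \<or> (\<exists>l\<ge>j. c = M l \<and> ev b \<in> ideal_fields) \<or> b \<in> {W j, P j k, Q j k k}"
      using ev_Bstar[OF assms(1) n] b by blast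
    then show ?thesis
      using assms(2) ideal_fields_at_0 by auto
  qed
qed

lemma ev_nonzero:
  "{b \<in> Bstar. ev b 0 \<noteq> 0} = {M (i - 1) | i. i \<in> {1..k}} \<union> {W j, P j k, Q j k k}"
proof (intro equalityI subsetI)
  fix b assume "b \<in> {M (i - 1) | i. i \<in> {1..k}} \<union> {W j, P j k, Q j k k}"
  then show "b \<in> {b \<in> Bstar. ev b 0 \<noteq> 0}"
    using M_Bstar W_Bstar[OF j1] P_Bstar[OF j1 jk] Q_Bstar[OF j1 jk] k2 lam
    by (auto simp: ev_at_0 ev_at_0(1)[simplified] basis_vec_neq_0 simp del: br_eval.simps)
qed (use ev_nonzero_cases in blast)

text \<open>The hyperplane x_{k+2} = 0 contains all other nonzero values at the origin.\<close>

lemma Q_not_in_span: "ev (Q j k k) 0 \<notin> N_inf_at_0 f0 f1 j k"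
proof
  let ?V = "{x :: real ^ 'n. x $ ix (k + 2) = 0}"
  have "(\<lambda>b. ev b 0) ` N_inf j k \<subseteq> ?V"
  proof (intro image_subsetI)
    fix b assume b: "b \<in> N_inf j k"
    show "ev b 0 \<in> ?V"
    proof (cases "ev b 0 = 0")
      case False
      then have "b \<in> {M (i - 1) | i. i \<in> {1..k}} \<union> {W j, P j k}"
        using ev_nonzero_cases[of b] b by (auto simp: N_inf_def)
      then consider i where "i \<in> {1..k}" "b = M (i - 1)" | "b = W j" | "b = P j k"
        by blast
      then show ?thesis
        using k2 by cases (auto simp: ev_at_0 ev_at_0(1)[simplified] basis_vec_nth simp del: br_eval.simps)
    qed simp
  qed
  moreover have "subspace ?V"
    by (auto simp: subspace_def)
  ultimately have "N_inf_at_0 f0 f1 j k \<subseteq> ?V"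
    unfolding N_inf_at_0_def by (rule span_minimal)
  moreover assume "ev (Q j k k) 0 \<in> N_inf_at_0 f0 f1 j k"
  ultimately have "(4 *\<^sub>R e (k + 2)) $ ix (k + 2) = 0"
    unfolding ev_at_0(4) by blast
  then show False
    by (simp add: basis_vec_nth)
qed

end

theorem theorem7p6:
  fixes j k :: nat and lam :: real and ix :: "nat \<Rightarrow> 'n::finite"
  assumes "1 \<le> j" and "j < k" and "2 * j \<le> k" and "lam \<noteq> 0"
    and "bij_betw ix {1..k + 2} UNIV"
  shows "W0_STLC (int k - 2 * int j - 1) (sys_f0 ix j k lam) (sys_f1 ix) \<and>
    br_eval (sys_f0 ix j k lam) (sys_f1 ix) (Q j k k) 0
      \<notin> N_inf_at_0 (sys_f0 ix j k lam) (sys_f1 ix) j k \<and>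
    {b \<in> Bstar. br_eval (sys_f0 ix j k lam) (sys_f1 ix) b 0 \<noteq> 0}
      = {M (i - 1) | i. i \<in> {1..k}} \<union> {W j, P j k, Q j k k} \<and>
    (\<forall>i\<in>{1..k}. br_eval (sys_f0 ix j k lam) (sys_f1 ix) (M (i - 1)) 0 = basis_vec ix i) \<and>
    br_eval (sys_f0 ix j k lam) (sys_f1 ix) (W j) 0 = (2 * lam) *\<^sub>R basis_vec ix k \<and>
    br_eval (sys_f0 ix j k lam) (sys_f1 ix) (P j k) 0 = 4 *\<^sub>R basis_vec ix (k + 1) \<and>
    br_eval (sys_f0 ix j k lam) (sys_f1 ix) (Q j k k) 0 = 4 *\<^sub>R basis_vec ix (k + 2)"
proof -
  interpret nilpotent_system j k lam ix
    by unfold_locales fact+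
  show ?thesis
    using STLC Q_not_in_span ev_nonzero ev_at_0 by blast
qed

end
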